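(* Let $k$ be an algebraically closed field of characteristic $0$ and let $X$ be a non-smooth reduced algebroid curve over $k$ whose coordinate ring $A$ is Gorenstein. Then $X$ is quasihomogeneous if and only if $\rho'_X=1$, where $\rho'_X=\ell\big(\operatorname{End}_A(M_A^{-1})/A\big)$.
   Context: A reduced algebroid curve $X$ over $k$ is given by its coordinate ring $A$: a reduced complete Noetherian local $k$-algebra of Krull dimension $1$ with residue field $k$ and maximal ideal $\mathfrak m_A$. $X$ is smooth if $A$ is regular (i.e. $A\cong k[[t]]$). $X$ is quasihomogeneous if the kernel of some $k$-algebra epimorphism $k[[x_1,\dots,x_n]]\twoheadrightarrow A$ is a quasihomogeneous ideal (i.e. generated by weighted homogeneous polynomials) with respect to some positive weights on the variables. Let $\mathfrak p_1,\dots,\mathfrak p_r$ be the minimal primes of $A$ and $A_i=A/\mathfrak p_i$. The normalization $\tilde A$ of $A$ in the total ring of fractions $L=Q(A)$ factorizes as $\tilde A=\prod_{i=1}^r\tilde A_i$ with $\tilde A_i=k[[t_i]]$ the normalization of $A_i$ (parameters $t_i$ fixed), and $L=\prod_{i=1}^r L_i$, $L_i=k((t_i))$; $A$ and $\tilde A$ are identified with their images in $L$. The operator $t\partial_t$ on $L$ is $(f_1,\dots,f_r)\mapsto(t_1\partial_{t_1}f_1,\dots,t_r\partial_{t_r}f_r)$. A fractional ideal is a finitely generated $A$-submodule of $L$ containing a non-zero divisor of $A$. For fractional ideals $I_1,I_2$ one identifies $\operatorname{Hom}_A(I_1,I_2)=\{x\in L\mid xI_1\subseteq I_2\}$; $I^{-1}:=\operatorname{Hom}_A(I,A)$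 and $\operatorname{End}_A(I)=\{x\in L\mid xI\subseteq I\}\supseteq A$. $M_A:=A\cdot t\partial_t(\mathfrak m_A)\subseteq L$ is the $A$-submodule generated by $t\partial_t(\mathfrak m_A)$; it is a fractional ideal. $\ell$ denotes length of $A$-modules. *)

theory Defs
  imports
    "HOL-Computational_Algebra.Computational_Algebra"
    "HOL-Library.Function_Algebras"
    "HOL-Library.Poly_Mapping"
    "HOL-Library.Extended_Nat"
begin

section \<open>Commutative algebra over a type-class ring\<close>

text \<open>A ring is a type of class \<^class>\<open>comm_ring_1\<close>; its ideals are the submodules of the
  regular module.\<close>

lemma module_times: "module ((*) :: 'a::comm_ring_1 \<Rightarrow> 'a \<Rightarrow> 'a)"
  by unfold_locales (simp_all add: algebra_simps)

abbreviation is_ideal :: "'a::comm_ring_1 set \<Rightarrow> bool" where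
  "is_ideal \<equiv> module.subspace (*)"

abbreviation ideal_gen :: "'a::comm_ring_1 set \<Rightarrow> 'a set" where
  "ideal_gen \<equiv> module.span (*)"

definition is_ring_hom :: "('a::comm_ring_1 \<Rightarrow> 'b::comm_ring_1) \<Rightarrow> bool" where
  "is_ring_hom f \<longleftrightarrow>
     f 1 = 1 \<and> (\<forall>x y. f (x + y) = f x + f y) \<and> (\<forall>x y. f (x * y) = f x * f y)"

definition prime_ideal :: "'a::comm_ring_1 set \<Rightarrow> bool" where
  "prime_ideal P \<longleftrightarrow> is_ideal P \<and> P \<noteq> UNIV \<and> (\<forall>x y. x * y \<in> P \<longrightarrow> x \<in> P \<or> y \<in> P)"

definition minimal_prime :: "'a::comm_ring_1 set \<Rightarrow> bool" where
  "minimal_prime P \<longleftrightarrow> prime_ideal P \<and> (\<forall>Q. prime_ideal Q \<and> Q \<subseteq> P \<longrightarrow> Q = P)"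

definition maximal_ideal :: "'a::comm_ring_1 set \<Rightarrow> bool" where
  "maximal_ideal M \<longleftrightarrow>
     is_ideal M \<and> M \<noteq> UNIV \<and> (\<forall>I. is_ideal I \<and> M \<subseteq> I \<longrightarrow> I = M \<or> I = UNIV)"

definition local_ring :: "'a::comm_ring_1 itself \<Rightarrow> bool" where
  "local_ring _ \<longleftrightarrow> (\<exists>!M :: 'a set. maximal_ideal M)"

text \<open>Only meaningful for local rings.\<close>
definition the_maximal_ideal :: "'a::comm_ring_1 set" where
  "the_maximal_ideal = (THE M. maximal_ideal M)"

definition noetherian :: "'a::comm_ring_1 itself \<Rightarrow> bool" where
  "noetherian _ \<longleftrightarrow> (\<forall>I :: 'a set. is_ideal I \<longrightarrow> (\<exists>S. finite S \<and> I = ideal_gen S))"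

definition reduced :: "'a::comm_ring_1 itself \<Rightarrow> bool" where
  "reduced _ \<longleftrightarrow> (\<forall>(x :: 'a) n. x ^ n = 0 \<longrightarrow> x = 0)"

text \<open>\<open>n\<close> counts the strict inclusions of the chain \<open>P 0 \<subset> \<dots> \<subset> P n\<close>.\<close>
definition krull_dim :: "'a::comm_ring_1 itself \<Rightarrow> enat" where
  "krull_dim _ =
     (SUP n \<in> {n. \<exists>P :: nat \<Rightarrow> 'a set. (\<forall>i\<le>n. prime_ideal (P i)) \<and> (\<forall>i<n. P i \<subset> P (Suc i))}.
        enat n)"

primrec ideal_power :: "'a::comm_ring_1 set \<Rightarrow> nat \<Rightarrow> 'a set" where
  "ideal_power I 0 = UNIV"
| "ideal_power I (Suc n) = ideal_gen {x * y | x y. x \<in> I \<and> y \<in> ideal_power I n}"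

text \<open>Bijectivity of the canonical map \<open>A \<rightarrow> lim A/I\<^sup>n\<close>: injectivity and surjectivity.\<close>
definition adically_complete :: "'a::comm_ring_1 set \<Rightarrow> bool" where
  "adically_complete I \<longleftrightarrow>
     (\<Inter>n. ideal_power I n) = {0} \<and>
     (\<forall>a :: nat \<Rightarrow> 'a. (\<forall>n. a (Suc n) - a n \<in> ideal_power I n) \<longrightarrow>
        (\<exists>b. \<forall>n. b - a n \<in> ideal_power I n))"

definition regular_local_ring :: "'a::comm_ring_1 itself \<Rightarrow> bool" where
  "regular_local_ring T \<longleftrightarrow> local_ring T \<and> noetherian T \<and>
     (\<exists>S :: 'a set. finite S \<and> enat (card S) = krull_dim T \<and> ideal_gen S = the_maximal_ideal)"


subsection \<open>Gorenstein local rings\<close>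

definition regular_sequence :: "'a::comm_ring_1 list \<Rightarrow> bool" where
  "regular_sequence xs \<longleftrightarrow> ideal_gen (set xs) \<noteq> UNIV \<and>
     (\<forall>i < length xs. \<forall>a. xs ! i * a \<in> ideal_gen (set (take i xs)) \<longrightarrow>
        a \<in> ideal_gen (set (take i xs)))"

definition depth :: "'a::comm_ring_1 itself \<Rightarrow> enat" where
  "depth _ =
     (SUP xs \<in> {xs :: 'a list. set xs \<subseteq> the_maximal_ideal \<and> regular_sequence xs}.
        enat (length xs))"

definition cohen_macaulay :: "'a::comm_ring_1 itself \<Rightarrow> bool" where
  "cohen_macaulay T \<longleftrightarrow> local_ring T \<and> noetherian T \<and> depth T = krull_dim T"

definition system_of_parameters :: "'a::comm_ring_1 list \<Rightarrow> bool" where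
  "system_of_parameters xs \<longleftrightarrow>
     enat (length xs) = krull_dim TYPE('a) \<and> set xs \<subseteq> the_maximal_ideal \<and>
     (\<exists>n. ideal_power the_maximal_ideal n \<subseteq> ideal_gen (set xs))"

definition irreducible_ideal :: "'a::comm_ring_1 set \<Rightarrow> bool" where
  "irreducible_ideal Q \<longleftrightarrow> is_ideal Q \<and> Q \<noteq> UNIV \<and>
     (\<forall>I J. is_ideal I \<and> is_ideal J \<and> Q = I \<inter> J \<longrightarrow> Q = I \<or> Q = J)"

text \<open>The ideal-theoretic definition: Cohen-Macaulay with irreducible parameter ideals. Matsumura
  (Commutative Ring Theory, Section 18) defines Gorenstein local rings by the list of equivalent
  conditions in Theorem 18.1, of which this is (5).\<close>
definition gorenstein :: "'a::comm_ring_1 itself \<Rightarrow> bool" where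
  "gorenstein T \<longleftrightarrow> cohen_macaulay T \<and>
     (\<forall>xs :: 'a list. system_of_parameters xs \<longrightarrow> irreducible_ideal (ideal_gen (set xs)))"


section \<open>Algebroid curves\<close>

text \<open>The \<open>k\<close>-algebra structure of \<open>A\<close> is the structure map \<open>\<iota> :: 'k \<Rightarrow> 'a\<close>. The last conjunct
  says that \<open>k \<rightarrow> A \<rightarrow> A/\<mm>\<close> is bijective.\<close>
definition reduced_algebroid_curve :: "('k::field \<Rightarrow> 'a::comm_ring_1) \<Rightarrow> bool" where
  "reduced_algebroid_curve \<iota> \<longleftrightarrow>
     is_ring_hom \<iota> \<and>
     reduced TYPE('a) \<and> noetherian TYPE('a) \<and> local_ring TYPE('a) \<and>
     adically_complete (the_maximal_ideal :: 'a set) \<and>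
     krull_dim TYPE('a) = 1 \<and>
     (\<forall>a. \<exists>!c. a - \<iota> c \<in> the_maximal_ideal)"

abbreviation smooth :: "'a::comm_ring_1 itself \<Rightarrow> bool" where
  "smooth \<equiv> regular_local_ring"


subsection \<open>Formal power series in several variables\<close>

text \<open>Monomials are finitely supported exponent vectors. The type has countably many variables;
  \<open>k[[x\<^sub>1,\<dots>,x\<^sub>n]]\<close> is the subring \<open>mfps_ring n\<close> of series in the variables with index \<open>< n\<close>.\<close>

typedef 'k mfps = "UNIV :: ((nat \<Rightarrow>\<^sub>0 nat) \<Rightarrow> 'k) set"
  morphisms mcoeff Abs_mfps by simp

setup_lifting type_definition_mfps

lemma mfps_eqI: "(\<And>m. mcoeff f m = mcoeff g m) \<Longrightarrow> f = g"
  by (metis ext mcoeff_inject)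

lemma finite_monomial_splits: "finite {(a, b). a + b = (m :: nat \<Rightarrow>\<^sub>0 nat)}"
proof -
  let ?D = "{a :: nat \<Rightarrow>\<^sub>0 nat. \<exists>b. a + b = m}"
  let ?F = "{h. \<forall>i. (i \<in> Poly_Mapping.keys m \<longrightarrow>
                    h i \<in> {..Max (Poly_Mapping.lookup m ` Poly_Mapping.keys m)}) \<and>
                  (i \<notin> Poly_Mapping.keys m \<longrightarrow> h i = (0::nat))}"
  have "Poly_Mapping.lookup a \<in> ?F" if "a \<in> ?D" for a
  proof -
    obtain b where b: "a + b = m" using \<open>a \<in> ?D\<close> by blast
    have le: "Poly_Mapping.lookup a i \<le> Poly_Mapping.lookup m i" for i
      using b by (auto simp: lookup_add)
    have "Poly_Mapping.lookup a i \<le> Max (Poly_Mapping.lookup m ` Poly_Mapping.keys m)"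
      if "i \<in> Poly_Mapping.keys m" for i
      by (rule order_trans[OF le Max_ge]) (use that in auto)
    moreover have "Poly_Mapping.lookup a i = 0" if "i \<notin> Poly_Mapping.keys m" for i
      using le[of i] that by (simp add: in_keys_iff)
    ultimately show ?thesis by auto
  qed
  moreover have "finite ?F" by (rule finite_set_of_finite_funs) auto
  ultimately have "finite (Poly_Mapping.lookup ` ?D)" by (meson finite_subset image_subsetI)
  then have D: "finite ?D" by (rule finite_imageD) (simp add: inj_on_def lookup_inject)
  have "{(a, b). a + b = m} \<subseteq> ?D \<times> ?D" using add.commute by fastforce
  then show ?thesis by (rule finite_subset) (rule finite_cartesian_product[OF D D])
qed

instantiation mfps :: (comm_ring_1) comm_ring_1
begin

lift_definition zero_mfps :: "'a mfps" is "\<lambda>_. 0" .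
lift_definition one_mfps :: "'a mfps" is "\<lambda>m. if m = 0 then 1 else 0" .
lift_definition plus_mfps :: "'a mfps \<Rightarrow> 'a mfps \<Rightarrow> 'a mfps" is "\<lambda>f g m. f m + g m" .
lift_definition uminus_mfps :: "'a mfps \<Rightarrow> 'a mfps" is "\<lambda>f m. - f m" .
lift_definition minus_mfps :: "'a mfps \<Rightarrow> 'a mfps \<Rightarrow> 'a mfps" is "\<lambda>f g m. f m - g m" .
lift_definition times_mfps :: "'a mfps \<Rightarrow> 'a mfps \<Rightarrow> 'a mfps"
  is "\<lambda>f g m. \<Sum>(a, b) \<in> {(a, b). a + b = m}. f a * g b" .

instance
proof
  fix f g h :: "'a mfps"
  show "f + g + h = f + (g + h)" by transfer (simp add: add.assoc)
  show "f + g = g + f" by transfer (simp add: add.commute)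
  show "0 + f = f" by transfer simp
  show "- f + f = 0" by transfer simp
  show "f - g = f + - g" by transfer simp
  show "(0 :: 'a mfps) \<noteq> 1" by transfer (metis zero_neq_one)
  show "(f + g) * h = f * h + g * h"
    by transfer (simp add: case_prod_unfold distrib_right sum.distrib)
  show "f * g = g * f"
    by transfer (rule ext, rule sum.reindex_bij_witness[of _ prod.swap prod.swap],
        auto simp: ac_simps)
  show "1 * f = f"
  proof (rule mfps_eqI)
    fix m :: "nat \<Rightarrow>\<^sub>0 nat"
    have "mcoeff (1 * f) m
        = (\<Sum>(a, b) \<in> {(a, b). a + b = m}. (if a = 0 then 1 else 0) * mcoeff f b)"
      by (simp only: times_mfps.rep_eq one_mfps.rep_eq)
    also have "\<dots> = (\<Sum>(a, b) \<in> {(0 :: nat \<Rightarrow>\<^sub>0 nat, m)}. (if a = 0 then 1 else 0) * mcoeff f b)"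
      by (rule sum.mono_neutral_right[OF finite_monomial_splits]) (auto split: if_splits)
    finally show "mcoeff (1 * f) m = mcoeff f m" by simp
  qed
  show "f * g * h = f * (g * h)"
  proof (rule mfps_eqI)
    fix m :: "nat \<Rightarrow>\<^sub>0 nat"
    let ?L = "SIGMA p : {(a, b). a + b = m}. {(c, d). c + d = fst p}"
    let ?R = "SIGMA p : {(a, b). a + b = m}. {(c, d). c + d = snd p}"
    have "mcoeff (f * g * h) m
        = (\<Sum>p \<in> {(a, b). a + b = m}. \<Sum>q \<in> {(c, d). c + d = fst p}.
             mcoeff f (fst q) * mcoeff g (snd q) * mcoeff h (snd p))"
      by (simp only: times_mfps.rep_eq case_prod_unfold sum_distrib_right)
    also have "\<dots> = (\<Sum>(p, q) \<in> ?L. mcoeff f (fst q) * mcoeff g (snd q) * mcoeff h (snd p))"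
      by (rule sum.Sigma) (use finite_monomial_splits in auto)
    also have "\<dots> = (\<Sum>(p, q) \<in> ?R. mcoeff f (fst p) * (mcoeff g (fst q) * mcoeff h (snd q)))"
      by (rule sum.reindex_bij_witness[of _
            "\<lambda>((a, b), (c, d)). ((a + c, d), (a, c))" "\<lambda>((a, b), (c, d)). ((c, d + b), (d, b))"])
        (auto simp: ac_simps)
    also have "\<dots> = (\<Sum>p \<in> {(a, b). a + b = m}. \<Sum>q \<in> {(c, d). c + d = snd p}.
             mcoeff f (fst p) * (mcoeff g (fst q) * mcoeff h (snd q)))"
      by (rule sum.Sigma[symmetric]) (use finite_monomial_splits in auto)
    also have "\<dots> = mcoeff (f * (g * h)) m"
      by (simp only: times_mfps.rep_eq case_prod_unfold sum_distrib_left)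
    finally show "mcoeff (f * g * h) m = mcoeff (f * (g * h)) m" .
  qed
qed

end

lift_definition mfps_const :: "'k::zero \<Rightarrow> 'k mfps" is "\<lambda>c m. if m = 0 then c else 0" .

definition mfps_ring :: "nat \<Rightarrow> 'k::zero mfps set" where
  "mfps_ring n = {f. \<forall>m. mcoeff f m \<noteq> 0 \<longrightarrow> Poly_Mapping.keys m \<subseteq> {..<n}}"

definition mfps_ideal_gen :: "nat \<Rightarrow> 'k::comm_ring_1 mfps set \<Rightarrow> 'k mfps set" where
  "mfps_ideal_gen n S =
     {\<Sum>s\<in>F. c s * s | F c. finite F \<and> F \<subseteq> S \<and> (\<forall>s\<in>F. c s \<in> mfps_ring n)}"


subsection \<open>Quasihomogeneity\<close>

definition weighted_degree :: "(nat \<Rightarrow> nat) \<Rightarrow> (nat \<Rightarrow>\<^sub>0 nat) \<Rightarrow> nat" where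
  "weighted_degree w m = (\<Sum>i\<in>Poly_Mapping.keys m. w i * Poly_Mapping.lookup m i)"

definition weighted_homogeneous_polynomial :: "(nat \<Rightarrow> nat) \<Rightarrow> 'k::zero mfps \<Rightarrow> bool" where
  "weighted_homogeneous_polynomial w f \<longleftrightarrow>
     finite {m. mcoeff f m \<noteq> 0} \<and> (\<exists>d. \<forall>m. mcoeff f m \<noteq> 0 \<longrightarrow> weighted_degree w m = d)"

definition quasihomogeneous_ideal :: "nat \<Rightarrow> (nat \<Rightarrow> nat) \<Rightarrow> 'k::comm_ring_1 mfps set \<Rightarrow> bool" where
  "quasihomogeneous_ideal n w I \<longleftrightarrow>
     (\<exists>S \<subseteq> mfps_ring n. (\<forall>s\<in>S. weighted_homogeneous_polynomial w s) \<and> I = mfps_ideal_gen n S)"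

text \<open>Only the values of \<open>\<pi>\<close> on \<open>mfps_ring n\<close> are relevant.\<close>
definition algebra_epimorphism ::
    "('k::comm_ring_1 \<Rightarrow> 'a::comm_ring_1) \<Rightarrow> nat \<Rightarrow> ('k mfps \<Rightarrow> 'a) \<Rightarrow> bool" where
  "algebra_epimorphism \<iota> n \<pi> \<longleftrightarrow>
     (\<forall>c. \<pi> (mfps_const c) = \<iota> c) \<and>
     (\<forall>f \<in> mfps_ring n. \<forall>g \<in> mfps_ring n. \<pi> (f + g) = \<pi> f + \<pi> g \<and> \<pi> (f * g) = \<pi> f * \<pi> g) \<and>
     \<pi> ` mfps_ring n = UNIV"

definition quasihomogeneous :: "('k::field \<Rightarrow> 'a::comm_ring_1) \<Rightarrow> bool" where
  "quasihomogeneous \<iota> \<longleftrightarrow>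
     (\<exists>n \<pi> w. algebra_epimorphism \<iota> n \<pi> \<and> (\<forall>i<n. w i > 0) \<and>
        quasihomogeneous_ideal n w {f \<in> mfps_ring n. \<pi> f = 0})"


subsection \<open>Normalization\<close>

text \<open>\<open>L = k((t\<^sub>1)) \<times> \<dots> \<times> k((t\<^sub>r))\<close> is the function type \<open>'r \<Rightarrow> 'k fls\<close> with componentwise operations,
  where \<open>'r\<close> is a finite type with \<open>r\<close> elements; \<open>normal_ring\<close> is \<open>k[[t\<^sub>1]] \<times> \<dots> \<times> k[[t\<^sub>r]]\<close>.\<close>

definition normal_ring :: "('r \<Rightarrow> 'k::zero fls) set" where
  "normal_ring = {x. \<forall>i. x i \<in> range fps_to_fls}"

definition nonzerodivisor :: "'a::comm_ring_1 \<Rightarrow> bool" where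
  "nonzerodivisor b \<longleftrightarrow> (\<forall>a. b * a = 0 \<longrightarrow> a = 0)"

definition total_ring_of_fractions :: "('a::comm_ring_1 \<Rightarrow> 'b::comm_ring_1) \<Rightarrow> bool" where
  "total_ring_of_fractions \<phi> \<longleftrightarrow> is_ring_hom \<phi> \<and> inj \<phi> \<and>
     (\<forall>b. nonzerodivisor b \<longrightarrow> \<phi> b dvd 1) \<and>
     (\<forall>x. \<exists>a b. nonzerodivisor b \<and> \<phi> b * x = \<phi> a)"

definition integral_closure :: "'b::comm_ring_1 set \<Rightarrow> 'b set" where
  "integral_closure B =
     {x. \<exists>p. lead_coeff p = 1 \<and> (\<forall>i. coeff p i \<in> B) \<and> poly p x = 0}"

text \<open>The identification of \<open>L\<close> with \<open>Q(A)\<close>, including a choice of the parameters \<open>t\<^sub>i\<close>: an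
  embedding of \<open>k\<close>-algebras \<open>\<phi> : A \<rightarrow> L\<close> whose \<open>i\<close>-th component has the \<open>i\<close>-th minimal prime of \<open>A\<close>
  as its kernel.\<close>
definition normalization ::
    "('k::field \<Rightarrow> 'a::comm_ring_1) \<Rightarrow> ('a \<Rightarrow> 'r::finite \<Rightarrow> 'k fls) \<Rightarrow> bool" where
  "normalization \<iota> \<phi> \<longleftrightarrow>
     total_ring_of_fractions \<phi> \<and>
     (\<forall>c. \<phi> (\<iota> c) = (\<lambda>_. fls_const c)) \<and>
     bij_betw (\<lambda>i. {a. \<phi> a i = 0}) UNIV {P. minimal_prime P} \<and>
     integral_closure (range \<phi>) = normal_ring"


subsection \<open>The invariant\<close>

definition t_deriv :: "('r \<Rightarrow> 'k::field fls) \<Rightarrow> 'r \<Rightarrow> 'k fls" where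
  "t_deriv f = (\<lambda>i. fls_X * fls_deriv (f i))"

text \<open>The \<open>A\<close>-module structure of \<open>L\<close>.\<close>
definition act :: "('a::comm_ring_1 \<Rightarrow> 'b::comm_ring_1) \<Rightarrow> 'a \<Rightarrow> 'b \<Rightarrow> 'b" where
  "act \<phi> a x = \<phi> a * x"

lemma module_act: "is_ring_hom \<phi> \<Longrightarrow> module (act \<phi>)"
  by unfold_locales (simp_all add: act_def is_ring_hom_def algebra_simps)

definition frac_Hom :: "'b::comm_ring_1 set \<Rightarrow> 'b set \<Rightarrow> 'b set" where
  "frac_Hom I J = {x. \<forall>y\<in>I. x * y \<in> J}"

definition frac_inverse :: "('a::comm_ring_1 \<Rightarrow> 'b::comm_ring_1) \<Rightarrow> 'b set \<Rightarrow> 'b set" where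
  "frac_inverse \<phi> I = frac_Hom I (range \<phi>)"

definition frac_End :: "'b::comm_ring_1 set \<Rightarrow> 'b set" where
  "frac_End I = frac_Hom I I"

definition M_module :: "('a::comm_ring_1 \<Rightarrow> 'r \<Rightarrow> 'k::field fls) \<Rightarrow> ('r \<Rightarrow> 'k fls) set" where
  "M_module \<phi> = module.span (act \<phi>) ((\<lambda>a. t_deriv (\<phi> a)) ` the_maximal_ideal)"

text \<open>The length of \<open>N / N'\<close> for submodules \<open>N' \<subseteq> N\<close>: the supremum of the lengths of strict chains
  of submodules of \<open>N / N'\<close>, each given by its preimage in \<open>N\<close>.\<close>
definition quotient_length ::
    "('a::comm_ring_1 \<Rightarrow> 'b::ab_group_add \<Rightarrow> 'b) \<Rightarrow> 'b set \<Rightarrow> 'b set \<Rightarrow> enat" where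
  "quotient_length scale N N' =
     (SUP n \<in> {n. \<exists>C. (\<forall>i\<le>n. module.subspace scale (C i) \<and> N' \<subseteq> C i \<and> C i \<subseteq> N) \<and>
                     (\<forall>i<n. C i \<subset> C (Suc i))}.
        enat n)"

definition rho' :: "('a::comm_ring_1 \<Rightarrow> 'r \<Rightarrow> 'k::field fls) \<Rightarrow> enat" where
  "rho' \<phi> =
     quotient_length (act \<phi>) (frac_End (frac_inverse \<phi> (M_module \<phi>))) (range \<phi>)"

end

theory Submission
  imports Defs
begin

text \<open>Gorenstein duality says that an ideal with a nonzerodivisor is determined by its inverse, and that
  \<open>\<mm>\<^sup>-\<^sup>1\<close> is the only \<open>A\<close>-submodule \<open>N\<close> of \<open>L\<close> with \<open>A \<subset> N \<subseteq> \<mm>\<^sup>-\<^sup>1\<close>. The elements \<open>x\<close> of \<open>M\<^sup>-\<^sup>1\<close> correspond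
  to the derivations \<open>x t\<partial>\<^sub>t\<close> of \<open>A\<close>, and \<open>End(M\<^sup>-\<^sup>1)\<close> is the inverse of the trace ideal \<open>T = M\<^sup>-\<^sup>1 M\<close>.

  If \<open>\<rho>' = 1\<close>, then \<open>T\<^sup>-\<^sup>1 = \<mm>\<^sup>-\<^sup>1\<close>, hence \<open>T = \<mm>\<close>. As \<open>t\<partial>\<^sub>t\<close> preserves orders, \<open>M\<close> and \<open>\<mm>\<close> have the same
  minimal order on each branch, so a general \<open>x\<close> in \<open>M\<^sup>-\<^sup>1\<close> is a unit of the normalization. After a change
  of the parameters \<open>x t\<partial>\<^sub>t\<close> becomes diagonal, and its eigenspaces provide a grading of \<open>A\<close> by positive
  weights. The relations between homogeneous generators are then generated by homogeneous ones.

  Conversely, the Euler derivation of a quasihomogeneous presentation induces a derivation of \<open>A\<close> that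
  maps \<open>\<mm>\<close> onto \<open>\<mm>\<close>. It is of the form \<open>u t\<partial>\<^sub>t\<close> with a unit \<open>u\<close> of \<open>L\<close>, so \<open>M = u\<^sup>-\<^sup>1 \<mm>\<close> and \<open>End(M\<^sup>-\<^sup>1)\<close> equals
  \<open>End(\<mm>\<^sup>-\<^sup>1) = \<mm>\<^sup>-\<^sup>1\<close>, which has length \<open>1\<close> over \<open>A\<close>.\<close>

subsection \<open>Linear functionals\<close>

text \<open>\<open>End(M^-1)\<close> is the inverse of \<open>T\<close> because
  \<open>e M^-1 \<subseteq> M^-1\<close> means \<open>e M^-1 M \<subseteq> A\<close>. To get
  \<open>T = \<mm>\<close> from the equality of the inverses, duality is needed only modulo one
  nonzerodivisor \<open>y\<close> in \<open>T\<close>, where \<open>A/(y)\<close> has a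
  one-dimensional socle. Only the integral closure of \<open>A\<close> is given, so a conductor must
  be derived from completeness, by expansions in powers of a nonzerodivisor. Afterwards infinite
  series can be cut off: a family of order at least \<open>D\<close> on every branch lies in
  \<open>A\<close>. The eigenvalues of the diagonalized derivation lie in \<open>k\<close> and may
  be incommensurable between branches. It suffices to coarsen them: natural weights such that equal
  nonzero eigenvalues have equal weights. For the presentation, a homogeneous nonzerodivisor of the
  conductor is made a variable of weight \<open>q\<close>. Multiplication by it makes the graded
  pieces periodic from weight \<open>q\<close> on, which leaves finitely many generators and
  quadratic rewriting rules. Characteristic 0 is what makes orders survive \<open>t d/dt\<close>,
  integrates the exponent of the new parameter and inverts the Euler derivation.\<close>

lemma (in vector_space) functional_in_span:
  assumes "finite I" "\<And>i. i \<in> I \<Longrightarrow> Vector_Spaces.linear scale (*) (f i)"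
    and "Vector_Spaces.linear scale (*) g" "\<And>x. (\<forall>i\<in>I. f i x = 0) \<Longrightarrow> g x = 0"
  shows "\<exists>c. \<forall>x. g x = (\<Sum>i\<in>I. c i * f i x)"
  using assms
proof (induction I arbitrary: g rule: finite_induct)
  case empty
  then show ?case by simp
next
  case (insert j I)
  have lin: "h (x + y) = h x + h y" "h (x - y) = h x - h y" "h (scale c x) = c * h x"
    if "Vector_Spaces.linear scale (*) h" for h :: "'b \<Rightarrow> 'a" and x y c
  proof -
    have "module_hom scale (*) h" using that unfolding Vector_Spaces.linear_def by blast
    then show "h (x + y) = h x + h y" "h (x - y) = h x - h y" "h (scale c x) = c * h x"
      by (fact module_hom.add module_hom.diff module_hom.scale)+
  qed
  show ?case
  proof (cases "\<exists>x0. (\<forall>i\<in>I. f i x0 = 0) \<and> f j x0 \<noteq> 0")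
    case True
    then obtain x0 where x0: "\<And>i. i \<in> I \<Longrightarrow> f i x0 = 0" "f j x0 \<noteq> 0" by blast
    \<comment> \<open>Subtracting the multiple of \<open>f j\<close> with the same value at
      \<open>x0\<close> makes \<open>g\<close> vanish on the common kernel of the smaller family:
      \<open>z\<close> projects such an \<open>x\<close> along \<open>x0\<close> into the kernel of
      \<open>f j\<close>.\<close>
    define d where "d = g x0 / f j x0"
    define g' where "g' x = g x - d * f j x" for x
    have fj: "Vector_Spaces.linear scale (*) (f j)" using insert by blast
    have g'0: "g' x = 0" if "\<forall>i\<in>I. f i x = 0" for x
    proof -
      define z where "z = x - scale (f j x / f j x0) x0"
      have "\<forall>i\<in>insert j I. f i z = 0"
        unfolding z_def using that x0 insert.prems(1) by (simp add: lin)
      then have "g z = 0" using insert.prems by blast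
      then have "g x = f j x / f j x0 * g x0"
        unfolding z_def by (simp add: lin[OF insert.prems(2)])
      then show ?thesis unfolding g'_def d_def by simp
    qed
    have "Vector_Spaces.linear scale (*) g'"
      unfolding g'_def Vector_Spaces.linear_def
      apply (intro conjI vector_space_axioms)
       apply (unfold_locales; simp add: algebra_simps)
      apply (unfold_locales)
        apply (simp_all add: lin[OF insert.prems(2)] lin[OF fj] algebra_simps)
      done
    then obtain c where c: "\<And>x. g' x = (\<Sum>i\<in>I. c i * f i x)"
      using insert.IH[of g'] insert.prems(1) g'0 by blast
    have "g x = (\<Sum>i\<in>insert j I. (c(j := d)) i * f i x)" for x
    proof -
      have "(\<Sum>i\<in>insert j I. (c(j := d)) i * f i x) = d * f j x + (\<Sum>i\<in>I. (c(j := d)) i * f i x)"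
        using insert.hyps by simp
      also have "(\<Sum>i\<in>I. (c(j := d)) i * f i x) = (\<Sum>i\<in>I. c i * f i x)"
        using insert.hyps by (intro sum.cong) auto
      finally show ?thesis using c[of x] unfolding g'_def by (metis diff_add_cancel add.commute)
    qed
    then show ?thesis by blast
  next
    case False
    then have "g x = 0" if "\<forall>i\<in>I. f i x = 0" for x using insert.prems(3) that by auto
    then obtain c where c: "\<And>x. g x = (\<Sum>i\<in>I. c i * f i x)"
      using insert.IH[of g] insert.prems(1,2) by blast
    have "g x = (\<Sum>i\<in>insert j I. (c(j := 0)) i * f i x)" for x
    proof -
      have "(\<Sum>i\<in>I. (c(j := 0)) i * f i x) = (\<Sum>i\<in>I. c i * f i x)"
        using insert.hyps by (intro sum.cong) auto
      then show ?thesis using c[of x] insert.hyps by simp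
    qed
    then show ?thesis by blast
  qed
qed

text \<open>In the duality it provides both the functional that is nonzero on the socle and the
  functional to be represented.\<close>

lemma (in vector_space) functional_separating:
  assumes "subspace J" "x \<notin> J"
  shows "\<exists>g. Vector_Spaces.linear scale (*) g \<and> (\<forall>y\<in>J. g y = 0) \<and> g x = 1"
proof -
  interpret vector_space_pair scale "(*) :: 'a \<Rightarrow> 'a \<Rightarrow> 'a"
    by unfold_locales (simp_all add: algebra_simps)
  obtain B where B: "B \<subseteq> J" "independent B" "J \<subseteq> span B"
    using basis_exists by metis
  have J: "J = span B" using B assms(1) by (meson span_minimal subset_antisym)
  have ind: "independent (insert x B)" using B assms(2) J independent_insert by auto
  obtain g where g: "Vector_Spaces.linear scale (*) g" "\<forall>y\<in>insert x B. g y = (if y = x then 1 else 0)"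
    using linear_independent_extend[OF ind, of "\<lambda>y. if y = x then 1 else 0"] by blast
  have "g y = 0" if "y \<in> J" for y
    by (rule linear_eq_0_on_span[OF g(1), of B]) (use g(2) B(1) assms(2) J that in auto)
  then show ?thesis using g by auto
qed

subsection \<open>Local rings\<close>

interpretation rm: module "(*) :: 'a::comm_ring_1 \<Rightarrow> 'a \<Rightarrow> 'a"
  by (rule module_times)

text \<open>With ring multiplication as the scalar action this rule is associativity read from right
  to left, against \<open>mult.assoc\<close>.\<close>

declare rm.scale_scale [simp del]

lemma ideal_mult: "is_ideal I \<Longrightarrow> x \<in> I \<Longrightarrow> a * x \<in> I"
  for I :: "'a::comm_ring_1 set"
  by (rule rm.subspace_scale)

lemma ideal_mult_right: "is_ideal I \<Longrightarrow> x \<in> I \<Longrightarrow> x * a \<in> I"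
  for I :: "'a::comm_ring_1 set"
  using ideal_mult[of I x a] by (simp add: mult.commute)

lemma ideal_UNIV_iff: "is_ideal I \<Longrightarrow> I = UNIV \<longleftrightarrow> 1 \<in> I"
  for I :: "'a::comm_ring_1 set"
  using ideal_mult[of I 1] by auto

lemma ideal_gen_single: "ideal_gen {y} = range (\<lambda>a. a * y)" for y :: "'a::comm_ring_1"
  by (simp add: rm.span_singleton)

lemma ideal_gen_insert: "x \<in> ideal_gen (insert y S) \<longleftrightarrow> (\<exists>a. x - a * y \<in> ideal_gen S)"
  for y :: "'a::comm_ring_1"
  by (simp add: rm.span_insert)

lemma ex_maximal_ideal:
  assumes "is_ideal I" "I \<noteq> (UNIV :: 'a::comm_ring_1 set)"
  shows "\<exists>M. maximal_ideal M \<and> I \<subseteq> M"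
proof -
  \<comment> \<open>Properness is expressed by the missing \<open>1\<close>, a condition that passes
    to unions of chains.\<close>
  let ?A = "{J. is_ideal J \<and> I \<subseteq> J \<and> 1 \<notin> J}"
  have "\<exists>M\<in>?A. \<forall>X\<in>?A. M \<subseteq> X \<longrightarrow> X = M"
  proof (rule subset_Zorn_nonempty)
    have "I \<in> ?A" using assms ideal_UNIV_iff[OF assms(1)] by simp
    then show "?A \<noteq> {}" by (metis empty_iff)
  next
    fix C assume C: "C \<noteq> {}" "subset.chain ?A C"
    have ch: "X \<subseteq> Y \<or> Y \<subseteq> X" if "X \<in> C" "Y \<in> C" for X Y
      using C(2) that by (auto simp: subset_chain_def)
    have id: "is_ideal X" "I \<subseteq> X" "1 \<notin> X" if "X \<in> C" for X
      using C(2) that by (auto simp: subset_chain_def)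
    have U: "is_ideal (\<Union>C)"
    proof (rule rm.subspaceI)
      show "0 \<in> \<Union>C" using C(1) id rm.subspace_0 by fast
      show "x + y \<in> \<Union>C" if "x \<in> \<Union>C" "y \<in> \<Union>C" for x y
      proof -
        obtain X Y where "X \<in> C" "Y \<in> C" "x \<in> X" "y \<in> Y"
          using \<open>x \<in> \<Union>C\<close> \<open>y \<in> \<Union>C\<close> by blast
        moreover from this have "(x \<in> X \<and> y \<in> X) \<or> (x \<in> Y \<and> y \<in> Y)" using ch[of X Y] by blast
        ultimately show ?thesis using id(1) rm.subspace_add by (meson UnionI)
      qed
      show "c * x \<in> \<Union>C" if "x \<in> \<Union>C" for c x
        using that ideal_mult[OF id(1)] by (meson UnionE UnionI)
    qed
    obtain X where "X \<in> C" using C(1) by blast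
    then have "I \<subseteq> \<Union>C" using id(2) by blast
    moreover have "1 \<notin> \<Union>C" using id(3) by blast
    ultimately show "\<Union>C \<in> ?A" using U by simp
  qed
  then obtain M where MA: "M \<in> ?A" and Mmax: "\<forall>X\<in>?A. M \<subseteq> X \<longrightarrow> X = M" by (rule bexE)
  have M: "is_ideal M" "I \<subseteq> M" "1 \<notin> M" using MA by simp_all
  have max: "X = M" if "is_ideal X" "I \<subseteq> X" "1 \<notin> X" "M \<subseteq> X" for X
    using bspec[OF Mmax, of X] that by simp
  have "X = M \<or> X = UNIV" if "is_ideal X" "M \<subseteq> X" for X
    using max[OF that(1)] that(2) M(2) ideal_UNIV_iff[OF that(1)] by (meson order_trans)
  then have "maximal_ideal M"
    unfolding maximal_ideal_def using M by blast
  then show ?thesis using M by blast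
qed

lemma
  assumes "local_ring TYPE('a::comm_ring_1)"
  shows maximal_the_maximal_ideal: "maximal_ideal (the_maximal_ideal :: 'a set)"
    and nonunit_iff: "\<not> a dvd 1 \<longleftrightarrow> a \<in> (the_maximal_ideal :: 'a set)"
proof -
  show M: "maximal_ideal (the_maximal_ideal :: 'a set)"
    using assms unfolding local_ring_def the_maximal_ideal_def by (rule theI')
  have uniq: "N = the_maximal_ideal" if "maximal_ideal N" for N :: "'a set"
    using assms M that unfolding local_ring_def by blast
  show "\<not> a dvd 1 \<longleftrightarrow> a \<in> (the_maximal_ideal :: 'a set)"
  proof
    assume "\<not> a dvd 1"
    then have "1 \<notin> ideal_gen {a}" by (auto simp: ideal_gen_single dvd_def mult.commute)
    then have "ideal_gen {a} \<noteq> UNIV" by blast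
    then obtain N where "maximal_ideal N" "ideal_gen {a} \<subseteq> N"
      using ex_maximal_ideal rm.subspace_span by metis
    then show "a \<in> the_maximal_ideal" using uniq rm.span_base by blast
  next
    assume "a \<in> the_maximal_ideal"
    then show "\<not> a dvd 1"
      using M unfolding maximal_ideal_def
      using ideal_UNIV_iff ideal_mult_right[of the_maximal_ideal a] by (metis dvdE)
  qed
qed

lemma ideal_power_ideal: "is_ideal (ideal_power I n)"
  by (cases n) (simp_all add: rm.subspace_UNIV)

lemma ideal_power_mult: "x \<in> I \<Longrightarrow> y \<in> ideal_power I n \<Longrightarrow> x * y \<in> ideal_power I (Suc n)"
  by (auto intro: rm.span_base)

lemma power_in_ideal_power: "x \<in> I \<Longrightarrow> x ^ n \<in> ideal_power I n"
proof (induction n)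
  case (Suc n)
  then show ?case using ideal_power_mult[of x I "x ^ n" n] by simp
qed simp

locale curve =
  fixes \<iota> :: "'k::field \<Rightarrow> 'a::comm_ring_1"
  assumes curve: "reduced_algebroid_curve \<iota>"
begin

abbreviation mI :: "'a set" ("\<mm>") where "\<mm> \<equiv> the_maximal_ideal"

lemma iota [simp]:
  "\<iota> 1 = 1" "\<iota> 0 = 0" "\<iota> (c + d) = \<iota> c + \<iota> d" "\<iota> (c * d) = \<iota> c * \<iota> d"
  "\<iota> (- c) = - \<iota> c" "\<iota> (c - d) = \<iota> c - \<iota> d"
proof -
  have h: "\<iota> 1 = 1" "\<And>c d. \<iota> (c + d) = \<iota> c + \<iota> d" "\<And>c d. \<iota> (c * d) = \<iota> c * \<iota> d"
    using curve by (auto simp: reduced_algebroid_curve_def is_ring_hom_def)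
  show "\<iota> 1 = 1" "\<iota> (c + d) = \<iota> c + \<iota> d" "\<iota> (c * d) = \<iota> c * \<iota> d" by (fact h)+
  show 0: "\<iota> 0 = 0" using h(2)[of 0 0] by simp
  have m: "\<iota> (- c) = - \<iota> c" for c using h(2)[of c "- c"] 0 by (simp add: eq_neg_iff_add_eq_0 add.commute)
  show "\<iota> (- c) = - \<iota> c" "\<iota> (c - d) = \<iota> c - \<iota> d"
    using m h(2)[of c "- d"] by auto
qed

lemma local: "local_ring TYPE('a)" and noeth: "noetherian TYPE('a)"
  and complete: "adically_complete \<mm>" and dim1: "krull_dim TYPE('a) = 1"
  using curve by (auto simp: reduced_algebroid_curve_def)

lemma m_ideal: "is_ideal \<mm>" and one_notin_m: "1 \<notin> \<mm>"
  using maximal_the_maximal_ideal[OF local] ideal_UNIV_iff by (auto simp: maximal_ideal_def)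

lemma unit_iff: "a dvd 1 \<longleftrightarrow> a \<notin> \<mm>"
  using nonunit_iff[OF local] by blast

lemma unit_inverse: "a \<notin> \<mm> \<Longrightarrow> \<exists>b. b * a = 1"
  using unit_iff[of a] by (metis dvdE mult.commute)

lemma residue: obtains c where "a - \<iota> c \<in> \<mm>"
  using curve unfolding reduced_algebroid_curve_def by metis

lemma iota_unit: "c \<noteq> 0 \<Longrightarrow> \<iota> c * \<iota> (1 / c) = 1"
  by (simp flip: iota(4))

lemma iota_notin_m: "c \<noteq> 0 \<Longrightarrow> \<iota> c \<notin> \<mm>"
  using iota_unit[of c] unit_iff by (metis dvdI)

lemma proper_ideal_subset: "is_ideal I \<Longrightarrow> I \<noteq> UNIV \<Longrightarrow> I \<subseteq> \<mm>"
proof (rule subsetI, rule ccontr)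
  fix x assume I: "is_ideal I" "I \<noteq> UNIV" and x: "x \<in> I" "x \<notin> \<mm>"
  have "x dvd 1" using x(2) unit_iff[of x] by blast
  then obtain y where "1 = x * y" by (rule dvdE)
  then show False using ideal_mult_right[OF I(1) x(1), of y] I ideal_UNIV_iff[OF I(1)] by simp
qed

definition kscale :: "'k \<Rightarrow> 'a \<Rightarrow> 'a" where "kscale c a = \<iota> c * a"

sublocale kvs: vector_space kscale
  unfolding vector_space_def kscale_def by (simp only: iota algebra_simps) simp

lemma ideal_ksubspace: "is_ideal I \<Longrightarrow> kvs.subspace I"
  by (simp add: kvs.subspace_def kscale_def rm.subspace_0 rm.subspace_add ideal_mult)

text \<open>Each power of \<open>\<mm>\<close> is finitely generated, and modulo the next power the
  coefficients may be replaced by their residues in \<open>k\<close>. The set \<open>E\<close> later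
  lets finitely many functionals decide membership in a parameter ideal.\<close>

lemma finite_codim_power:
  "\<exists>E. finite E \<and> (\<forall>a. \<exists>c. a - (\<Sum>e\<in>E. \<iota> (c e) * e) \<in> ideal_power \<mm> n)"
proof -
  have "\<exists>E. finite E \<and> (\<forall>a. \<exists>b \<in> kvs.span E. a - b \<in> ideal_power \<mm> n)"
  proof (induction n)
    case 0
    have "\<forall>a. \<exists>b \<in> kvs.span {}. a - b \<in> ideal_power \<mm> 0"
      unfolding ideal_power.simps using kvs.span_zero by blast
    then show ?case by (metis finite.emptyI)
  next
    case (Suc n)
    then obtain E where E: "finite E" "\<And>a. \<exists>b \<in> kvs.span E. a - b \<in> ideal_power \<mm> n" by blast
    obtain S where S: "finite S" "ideal_power \<mm> n = ideal_gen S"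
      using noeth ideal_power_ideal unfolding noetherian_def by blast
    have "\<exists>b \<in> kvs.span S. a - b \<in> ideal_power \<mm> (Suc n)" if a: "a \<in> ideal_gen S" for a
      using a
    proof (induction rule: rm.span_induct_alt)
      case base
      show ?case using kvs.span_zero rm.span_zero by (auto intro!: bexI[of _ 0])
    next
      case (step u x y)
      then obtain b where b: "b \<in> kvs.span S" "y - b \<in> ideal_power \<mm> (Suc n)" by blast
      obtain c where c: "u - \<iota> c \<in> \<mm>" by (rule residue)
      have "(u - \<iota> c) * x \<in> ideal_power \<mm> (Suc n)"
        using c step S rm.span_base by (intro ideal_power_mult) auto
      then have "(u - \<iota> c) * x + (y - b) \<in> ideal_power \<mm> (Suc n)"
        using b ideal_power_ideal rm.subspace_add by blast
      moreover have "(u - \<iota> c) * x + (y - b) = u * x + y - (kscale c x + b)"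
        by (simp add: kscale_def algebra_simps)
      ultimately show ?case
        using kvs.span_add[OF kvs.span_scale[OF kvs.span_base[OF step(1)]] b(1), of c] by metis
    qed
    note sp = this
    have "\<exists>b \<in> kvs.span (E \<union> S). a - b \<in> ideal_power \<mm> (Suc n)" for a
    proof -
      obtain b where b: "b \<in> kvs.span E" "a - b \<in> ideal_gen S" using E(2) S by metis
      obtain b' where b': "b' \<in> kvs.span S" "a - b - b' \<in> ideal_power \<mm> (Suc n)" using sp b by blast
      have "b + b' \<in> kvs.span (E \<union> S)"
        using b b' kvs.span_mono[of E "E \<union> S"] kvs.span_mono[of S "E \<union> S"] kvs.span_add by blast
      then show ?thesis using b' by (metis diff_diff_add)
    qed
    then show ?case using E S by (intro exI[of _ "E \<union> S"]) simp
  qed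
  then obtain E where E: "finite E" "\<And>a. \<exists>b \<in> kvs.span E. a - b \<in> ideal_power \<mm> n" by blast
  show ?thesis
  proof (intro exI[of _ E] conjI allI E)
    fix a
    obtain b where "b \<in> kvs.span E" "a - b \<in> ideal_power \<mm> n" using E by blast
    then show "\<exists>c. a - (\<Sum>e\<in>E. \<iota> (c e) * e) \<in> ideal_power \<mm> n"
      unfolding kvs.span_finite[OF E(1)] kscale_def by auto
  qed
qed

lemma kscale_linear:
  assumes "Vector_Spaces.linear kscale (*) f"
  shows "f (x + y) = f x + f y" "f (x - y) = f x - f y" "f (\<iota> c * x) = c * f x" "f 0 = 0"
    "f (sum g I) = (\<Sum>i\<in>I. f (g i))"
proof -
  have m: "module_hom kscale (*) f" using assms unfolding Vector_Spaces.linear_def by blast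
  show "f (x + y) = f x + f y" "f (x - y) = f x - f y" "f 0 = 0" "f (sum g I) = (\<Sum>i\<in>I. f (g i))"
    by (fact module_hom.add[OF m] module_hom.diff[OF m] module_hom.zero[OF m] module_hom.sum[OF m])+
  show "f (\<iota> c * x) = c * f x" using module_hom.scale[OF m] by (simp add: kscale_def)
qed

end

subsection \<open>Duality in Gorenstein rings of dimension one\<close>

locale gorenstein_curve = curve \<iota>
  for \<iota> :: "'k::field \<Rightarrow> 'a::comm_ring_1" +
  assumes gor: "gorenstein TYPE('a)"
begin

text \<open>The Cohen-Macaulay condition makes the depth equal to the dimension one, so there is a
  nonempty regular sequence; its first entry is regular modulo the zero ideal.\<close>

lemma ex_nonzerodivisor: "\<exists>y\<in>\<mm>. nonzerodivisor y"
proof -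
  have d: "depth TYPE('a) = 1"
    using gor dim1 unfolding gorenstein_def cohen_macaulay_def by metis
  have "\<exists>xs :: 'a list. set xs \<subseteq> \<mm> \<and> regular_sequence xs \<and> xs \<noteq> []"
  proof (rule ccontr)
    assume a: "\<not> ?thesis"
    have "depth TYPE('a) \<le> 0" unfolding depth_def
    proof (rule SUP_least)
      fix xs :: "'a list" assume "xs \<in> {xs. set xs \<subseteq> \<mm> \<and> regular_sequence xs}"
      then have "xs = []" using a by blast
      then show "enat (length xs) \<le> 0" by (simp add: zero_enat_def)
    qed
    then show False using d by simp
  qed
  then obtain xs :: "'a list" where xs: "set xs \<subseteq> \<mm>" "regular_sequence xs" "xs \<noteq> []" by blast
  have "\<forall>a. xs ! 0 * a \<in> ideal_gen (set (take 0 xs)) \<longrightarrow> a \<in> ideal_gen (set (take 0 xs))"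
    using xs(2,3) unfolding regular_sequence_def by blast
  then have "nonzerodivisor (xs ! 0)" by (simp add: nonzerodivisor_def)
  moreover have "xs ! 0 \<in> \<mm>" using xs(1,3) by auto
  ultimately show ?thesis by blast
qed

context
  fixes y n
  assumes y: "y \<in> \<mm>" and n: "ideal_power \<mm> n \<subseteq> ideal_gen {y}"
begin

lemma irreducible_param: "irreducible_ideal (ideal_gen {y})"
proof -
  have "system_of_parameters [y]"
    using y n dim1 by (auto simp: system_of_parameters_def one_enat_def)
  then have "irreducible_ideal (ideal_gen (set [y]))"
    using gor unfolding gorenstein_def by blast
  then show ?thesis by simp
qed

text \<open>Taken from the last power of \<open>\<mm>\<close> that is not contained in
  \<open>ideal_gen {y}\<close>.\<close>

lemma ex_socle: "\<exists>s. s \<notin> ideal_gen {y} \<and> (\<forall>x\<in>\<mm>. x * s \<in> ideal_gen {y})"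
proof -
  define N where "N = (LEAST N. ideal_power \<mm> N \<subseteq> ideal_gen {y})"
  have N: "ideal_power \<mm> N \<subseteq> ideal_gen {y}" unfolding N_def by (rule LeastI) (rule n)
  have "N \<noteq> 0"
  proof
    assume "N = 0"
    then have "1 \<in> ideal_gen {y}" using N by auto
    then obtain a where "1 = y * a" by (auto simp: ideal_gen_single mult.commute)
    then have "y dvd 1" by (rule dvdI)
    then show False using y unit_iff by blast
  qed
  then obtain N' where N': "N = Suc N'" by (cases N) auto
  have "\<not> ideal_power \<mm> N' \<subseteq> ideal_gen {y}"
    using not_less_Least[of N' "\<lambda>N. ideal_power \<mm> N \<subseteq> ideal_gen {y}"] N' unfolding N_def by simp
  then obtain s where s: "s \<in> ideal_power \<mm> N'" "s \<notin> ideal_gen {y}" by blast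
  have "x * s \<in> ideal_gen {y}" if "x \<in> \<mm>" for x
    using ideal_power_mult[OF that s(1)] N N' by blast
  then show ?thesis using s by blast
qed

context
  fixes s
  assumes s: "s \<notin> ideal_gen {y}" and ms: "\<And>x. x \<in> \<mm> \<Longrightarrow> x * s \<in> ideal_gen {y}"
begin

text \<open>Irreducibility prevents \<open>ideal_gen {y}\<close> from being the intersection of the
  strictly larger ideals \<open>J\<close> and \<open>ideal_gen {s, y}\<close>. A common element
  outside it is \<open>a * s\<close> modulo \<open>y\<close>, and \<open>a\<close> is a unit because
  \<open>\<mm>\<close> kills \<open>s\<close>.\<close>

lemma socle_in_ideal:
  assumes J: "is_ideal J" "y \<in> J" "z \<in> J" "z \<notin> ideal_gen {y}"
  shows "s \<in> J"
proof -
  let ?J' = "ideal_gen {s, y}"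
  have yJ: "ideal_gen {y} \<subseteq> J" using J by (intro rm.span_minimal) auto
  have "ideal_gen {y} \<subseteq> ?J'" by (rule rm.span_mono) simp
  moreover have "ideal_gen {y} \<noteq> J" using J by blast
  moreover have "ideal_gen {y} \<noteq> ?J'" using s by (metis insertI1 rm.span_base)
  ultimately have "ideal_gen {y} \<noteq> J \<inter> ?J'"
    using irreducible_param J(1) rm.subspace_span unfolding irreducible_ideal_def by blast
  then obtain w where w: "w \<in> J" "w \<in> ?J'" "w \<notin> ideal_gen {y}"
    using yJ \<open>ideal_gen {y} \<subseteq> ?J'\<close> by blast
  obtain a where a: "w - a * s \<in> ideal_gen {y}" using w(2) ideal_gen_insert by blast
  have "a \<notin> \<mm>"
  proof
    assume "a \<in> \<mm>"
    from rm.span_add[OF a ms[OF this]] show False using w(3) by simp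
  qed
  then obtain b where b: "b * a = 1" using unit_inverse by blast
  have "w - a * s \<in> J" using a yJ by blast
  then have "b * (w - (w - a * s)) \<in> J"
    by (rule ideal_mult[OF J(1) rm.subspace_diff[OF J(1) w(1)]])
  moreover have "b * (w - (w - a * s)) = s" using b mult.assoc[of b a s] by simp
  ultimately show ?thesis by (simp only:)
qed

text \<open>One-dimensionality of the socle: unless \<open>z\<close> is zero modulo
  \<open>y\<close>, the ideal of \<open>z\<close> and \<open>y\<close> contains \<open>s\<close>. So
  \<open>s\<close> is \<open>a * z\<close> modulo \<open>y\<close>, and \<open>a\<close> is a unit
  since \<open>\<mm>\<close> kills \<open>z\<close>.\<close>

lemma socle_annihilator:
  assumes "\<And>x. x \<in> \<mm> \<Longrightarrow> x * z \<in> ideal_gen {y}"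
  shows "z \<in> ideal_gen {s, y}"
proof (cases "z \<in> ideal_gen {y}")
  case True
  then show ?thesis using rm.span_mono[of "{y}" "{s, y}"] by blast
next
  case False
  have "s \<in> ideal_gen {z, y}"
    by (rule socle_in_ideal[OF rm.subspace_span _ _ False]) (auto intro: rm.span_base)
  then obtain a where a: "s - a * z \<in> ideal_gen {y}" using ideal_gen_insert by blast
  have "a \<notin> \<mm>"
  proof
    assume "a \<in> \<mm>"
    from rm.span_add[OF a assms[OF this]] show False using s by simp
  qed
  then obtain b where b: "b * a = 1" using unit_inverse by blast
  have "s - a * z \<in> ideal_gen {s, y}" using a rm.span_mono[of "{y}" "{s, y}"] by blast
  moreover have "s \<in> ideal_gen {s, y}" by (rule rm.span_base) simp
  ultimately have "b * s - b * (s - a * z) \<in> ideal_gen {s, y}"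
    by (intro rm.span_diff[OF rm.span_scale rm.span_scale])
  moreover have "b * s - b * (s - a * z) = z"
    using b mult.assoc[of b a z] by (simp add: right_diff_distrib)
  ultimately show ?thesis by (simp only:)
qed

text \<open>A functional \<open>\<sigma>\<close> on \<open>A/(y)\<close> that does not kill the socle makes \<open>(a, b) \<mapsto> \<sigma> (a b)\<close> a
  perfect pairing, so every functional is \<open>\<sigma> (b \<cdot>)\<close> for some \<open>b\<close>.\<close>
lemma annihilator_duality:
  assumes J: "is_ideal J" "y \<in> J" "x0 \<notin> J"
  shows "\<exists>b. (\<forall>a\<in>J. b * a \<in> ideal_gen {y}) \<and> b * x0 \<notin> ideal_gen {y}"
proof -
  let ?Y = "ideal_gen {y}"
  have Ymul: "a \<in> ?Y \<Longrightarrow> a * b \<in> ?Y" for a b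
    using ideal_mult_right[OF rm.subspace_span] by blast
  obtain \<sigma> where \<sigma>: "Vector_Spaces.linear kscale (*) \<sigma>" "\<And>a. a \<in> ?Y \<Longrightarrow> \<sigma> a = 0" "\<sigma> s = 1"
    using kvs.functional_separating[OF ideal_ksubspace[OF rm.subspace_span] s] by metis
  obtain \<tau> where \<tau>: "Vector_Spaces.linear kscale (*) \<tau>" "\<And>a. a \<in> J \<Longrightarrow> \<tau> a = 0" "\<tau> x0 = 1"
    using kvs.functional_separating[OF ideal_ksubspace[OF J(1)] J(3)] by metis
  \<comment> \<open>A nonzero class \<open>z\<close> would generate an ideal containing the socle
    element \<open>s\<close>, on which \<open>\<sigma>\<close> is nonzero.\<close>
  have nondeg: "z \<in> ?Y" if z: "\<And>a. \<sigma> (a * z) = 0" for z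
  proof (rule ccontr)
    assume "z \<notin> ?Y"
    then have "s \<in> ideal_gen {z, y}"
      by (intro socle_in_ideal[OF rm.subspace_span]) (auto intro: rm.span_base)
    then obtain a where a: "s - a * z \<in> ?Y" using ideal_gen_insert by blast
    have "\<sigma> s = \<sigma> (s - a * z) + \<sigma> (a * z)" by (simp flip: kscale_linear(1)[OF \<sigma>(1)])
    then show False using \<sigma>(2)[OF a] \<sigma>(3) z by simp
  qed
  \<comment> \<open>As \<open>ideal_power \<mm> n\<close> lies in \<open>?Y\<close>, vanishing of
    \<open>\<sigma> (e * x)\<close> for the finitely many \<open>e\<close> in \<open>E\<close>
    implies vanishing of \<open>\<sigma> (a * x)\<close> for all \<open>a\<close>.\<close>
  obtain E where E: "finite E" "\<And>a. \<exists>c. a - (\<Sum>e\<in>E. \<iota> (c e) * e) \<in> ideal_power \<mm> n"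
    using finite_codim_power by blast
  have lin: "Vector_Spaces.linear kscale (*) (\<lambda>a. \<sigma> (e * a))" for e
  proof -
    have "\<sigma> (e * (a + b)) = \<sigma> (e * a) + \<sigma> (e * b)" for a b
      by (simp only: distrib_left kscale_linear(1)[OF \<sigma>(1)])
    moreover have "\<sigma> (e * kscale c a) = c * \<sigma> (e * a)" for c a
      by (simp only: kscale_def mult.left_commute[of e] kscale_linear(3)[OF \<sigma>(1)])
    ultimately show ?thesis
      using \<sigma>(1) unfolding Vector_Spaces.linear_iff by blast
  qed
  have ker: "\<tau> x = 0" if "\<forall>e\<in>E. \<sigma> (e * x) = 0" for x
  proof -
    have "\<sigma> (a * x) = 0" for a
    proof -
      obtain c where c: "a - (\<Sum>e\<in>E. \<iota> (c e) * e) \<in> ideal_power \<mm> n" using E(2) by blast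
      let ?d = "a - (\<Sum>e\<in>E. \<iota> (c e) * e)"
      have "a * x = ?d * x + (\<Sum>e\<in>E. \<iota> (c e) * (e * x))"
        by (simp add: left_diff_distrib sum_distrib_right mult.assoc)
      then have "\<sigma> (a * x) = \<sigma> (?d * x) + (\<Sum>e\<in>E. c e * \<sigma> (e * x))"
        by (simp only: kscale_linear[OF \<sigma>(1)])
      moreover have "\<sigma> (?d * x) = 0" using c n Ymul \<sigma>(2) by blast
      ultimately show ?thesis using that by simp
    qed
    then have "x \<in> ?Y" by (rule nondeg)
    then have "x \<in> J" using J rm.span_minimal[of "{y}" J] by blast
    then show ?thesis by (rule \<tau>(2))
  qed
  obtain c where c: "\<And>x. \<tau> x = (\<Sum>e\<in>E. c e * \<sigma> (e * x))"
    using kvs.functional_in_span[of E "\<lambda>e a. \<sigma> (e * a)" \<tau>, OF E(1) lin \<tau>(1) ker] by blast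
  define b where "b = (\<Sum>e\<in>E. \<iota> (c e) * e)"
  have b: "\<sigma> (b * x) = \<tau> x" for x
  proof -
    have "b * x = (\<Sum>e\<in>E. \<iota> (c e) * (e * x))"
      by (simp add: b_def sum_distrib_right mult.assoc)
    then show ?thesis by (simp only: c kscale_linear[OF \<sigma>(1)])
  qed
  show ?thesis
  proof (intro exI[of _ b] conjI ballI)
    fix a assume "a \<in> J"
    then have "\<tau> (a' * a) = 0" for a' using \<tau>(2) ideal_mult[OF J(1)] by blast
    then have "\<sigma> (a' * (b * a)) = 0" for a' using b[of "a' * a"] by (simp add: mult.left_commute)
    then show "b * a \<in> ?Y" by (rule nondeg)
  next
    show "b * x0 \<notin> ?Y" using b[of x0] \<tau>(3) \<sigma>(2)[of "b * x0"] by auto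
  qed
qed

end
end
end

subsection \<open>The normalization and the conductor\<close>

lemma sum_fun_apply: "(\<Sum>i\<in>I. f i) x = (\<Sum>i\<in>I. f i x)"
  by (induction I rule: infinite_finite_induct) auto

lemma power_fun_apply: "(f ^ n) x = (f x) ^ n"
  by (induction n) auto

text \<open>Stated through coefficients so that zero components have every order; their
  \<open>subdegree\<close> would be 0.\<close>

definition ord_ge :: "nat \<Rightarrow> ('r \<Rightarrow> 'k::zero fps) \<Rightarrow> bool" where
  "ord_ge n f \<longleftrightarrow> (\<forall>i. \<forall>k<n. f i $ k = 0)"

lemma ord_ge_mono: "ord_ge n f \<Longrightarrow> m \<le> n \<Longrightarrow> ord_ge m f"
  by (auto simp: ord_ge_def)

lemma fps_mult_nth_zero:
  assumes "\<And>k. k < m \<Longrightarrow> f $ k = 0" "\<And>k. k < n \<Longrightarrow> g $ k = 0" "k < m + n"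
  shows "(f * g) $ k = (0 :: 'k::comm_ring_1)"
  unfolding fps_mult_nth using assms
  by (intro sum.neutral ballI) (metis add_less_mono le_add_diff_inverse atLeastAtMost_iff linorder_not_less
      mult_zero_left mult_zero_right add_le_mono)

lemma ord_ge_mult: "ord_ge m f \<Longrightarrow> ord_ge n g \<Longrightarrow> ord_ge (m + n) (f * g)"
  for f :: "'r \<Rightarrow> 'k::comm_ring_1 fps"
  unfolding ord_ge_def by (auto intro: fps_mult_nth_zero[of m _ n])

lemma fps_cutoff_eq_sum: "fps_cutoff n f = (\<Sum>k<n. fps_const (f $ k) * fps_X ^ k)"
  for f :: "'k::comm_ring_1 fps"
  by (rule fps_ext) (simp add: fps_sum_nth fps_X_power_nth if_distrib[of "\<lambda>x. _ * x"] cong: if_cong)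

locale normalized_curve = gorenstein_curve \<iota>
  for \<iota> :: "'k::field_char_0 \<Rightarrow> 'a::comm_ring_1" +
  fixes \<phi> :: "'a \<Rightarrow> 'r::finite \<Rightarrow> 'k fls"
  assumes norm: "normalization \<iota> \<phi>"
begin

lemma phi_hom: "is_ring_hom \<phi>" and phi_inj: "inj \<phi>"
  and phi_nzd: "nonzerodivisor b \<Longrightarrow> \<phi> b dvd 1"
  and phi_frac: "\<exists>a b. nonzerodivisor b \<and> \<phi> b * x = \<phi> a"
  and phi_const: "\<phi> (\<iota> c) = (\<lambda>_. fls_const c)"
  and closure: "integral_closure (range \<phi>) = normal_ring"
  using norm unfolding normalization_def total_ring_of_fractions_def by blast+

lemma phi [simp]: "\<phi> 1 = 1" "\<phi> (a + b) = \<phi> a + \<phi> b" "\<phi> (a * b) = \<phi> a * \<phi> b"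
  using phi_hom by (auto simp: is_ring_hom_def)

lemma phi_0 [simp]: "\<phi> 0 = 0" using phi(2)[of 0 0] by simp

lemma phi_minus [simp]: "\<phi> (- a) = - \<phi> a"
  using phi(2)[of a "- a"] by (simp add: eq_neg_iff_add_eq_0 add.commute)

lemma phi_diff [simp]: "\<phi> (a - b) = \<phi> a - \<phi> b"
  using phi(2)[of a "- b"] by simp

definition \<psi> :: "'a \<Rightarrow> 'r \<Rightarrow> 'k fps" where "\<psi> a i = fls_regpart (\<phi> a i)"

text \<open>Elements of \<open>A\<close> are integral over \<open>A\<close>, as roots of monic
  linear polynomials, so the regular part in \<open>\<psi>\<close> loses nothing.\<close>

lemma psi_phi [simp]: "fps_to_fls (\<psi> a i) = \<phi> a i"
proof -
  let ?p = "[:- \<phi> a, 1:]"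
  have "coeff ?p j \<in> range \<phi>" for j
  proof (cases j)
    case 0
    then show ?thesis by (metis coeff_pCons_0 phi_minus rangeI)
  next
    case (Suc n)
    then show ?thesis by (cases n) (auto intro: rev_image_eqI[of 1] rev_image_eqI[of 0])
  qed
  moreover have "lead_coeff ?p = 1" "poly ?p (\<phi> a) = 0" by simp_all
  ultimately have "\<phi> a \<in> integral_closure (range \<phi>)"
    unfolding integral_closure_def by blast
  then have "\<phi> a i \<in> range fps_to_fls"
    unfolding closure normal_ring_def by blast
  then show ?thesis unfolding \<psi>_def by auto
qed

lemma psi [simp]: "\<psi> 1 = 1" "\<psi> (a + b) = \<psi> a + \<psi> b" "\<psi> (a * b) = \<psi> a * \<psi> b"
    "\<psi> 0 = 0" "\<psi> (- a) = - \<psi> a" "\<psi> (a - b) = \<psi> a - \<psi> b"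
  by (rule ext, rule fps_to_fls_eq_imp_fps_eq, 
      simp add: fls_times_fps_to_fls)+

lemma psi_sum: "\<psi> (\<Sum>i\<in>I. f i) = (\<Sum>i\<in>I. \<psi> (f i))"
  by (induction I rule: infinite_finite_induct) simp_all

lemma psi_power: "\<psi> (a ^ n) = \<psi> a ^ n"
  by (induction n) simp_all

lemma psi_const [simp]: "\<psi> (\<iota> c) = (\<lambda>_. fps_const c)"
  by (rule ext, rule fps_to_fls_eq_imp_fps_eq) (simp add: phi_const)

lemma psi_inj: "\<psi> a = \<psi> b \<longleftrightarrow> a = b"
  by (metis (no_types) ext injD phi_inj psi_phi)

lemma psi_unit: "a \<notin> \<mm> \<Longrightarrow> \<psi> a i $ 0 \<noteq> 0"
proof
  assume "a \<notin> \<mm>" and 0: "\<psi> a i $ 0 = 0"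
  then obtain b where "b * a = 1" using unit_inverse by blast
  then have "\<psi> b * \<psi> a = 1" by (metis psi(1,3))
  then have "(\<psi> b * \<psi> a) i $ 0 = 1 i $ (0::nat)" by (rule arg_cong)
  then show False using 0 by (simp add: fps_mult_nth)
qed

text \<open>Subtracting the constant term on one branch leaves a nonunit by \<open>psi_unit\<close>,
  so this constant itself lies in \<open>\<mm>\<close> and must be zero.\<close>

lemma psi_m: assumes "a \<in> \<mm>" shows "\<psi> a i $ 0 = 0"
proof (rule ccontr)
  assume n: "\<psi> a i $ 0 \<noteq> 0"
  let ?c = "\<psi> a i $ 0"
  have "a - \<iota> ?c \<in> \<mm>" using psi_unit[of "a - \<iota> ?c" i] by auto
  then have "a - (a - \<iota> ?c) \<in> \<mm>" by (rule rm.subspace_diff[OF m_ideal assms])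
  then show False using iota_notin_m[OF n] by simp
qed

lemma m_iff: "a \<in> \<mm> \<longleftrightarrow> (\<forall>i. \<psi> a i $ 0 = 0)"
  using psi_m psi_unit by blast

lemma psi_ideal_power: "a \<in> ideal_power \<mm> n \<Longrightarrow> ord_ge n (\<psi> a)"
proof (induction n arbitrary: a)
  case (Suc n)
  from Suc.prems have "a \<in> ideal_gen {x * y |x y. x \<in> \<mm> \<and> y \<in> ideal_power \<mm> n}" by simp
  then show ?case
  proof (induction rule: rm.span_induct_alt)
    case base
    then show ?case by (simp add: ord_ge_def)
  next
    case (step c x y)
    then obtain u v where uv: "x = u * v" "u \<in> \<mm>" "v \<in> ideal_power \<mm> n" by blast
    have "ord_ge 1 (\<psi> u)" using psi_m[OF uv(2)] by (simp add: ord_ge_def)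
    moreover have "ord_ge n (\<psi> v)" by (rule Suc.IH[OF uv(3)])
    ultimately have "ord_ge (1 + n) (\<psi> u * \<psi> v)" by (rule ord_ge_mult)
    moreover have "ord_ge 0 (\<psi> c)" by (simp add: ord_ge_def)
    ultimately have "ord_ge (0 + (1 + n)) (\<psi> c * (\<psi> u * \<psi> v))"
      by (rule ord_ge_mult[rotated])
    then show ?case using step uv by (simp add: ord_ge_def)
  qed
qed (simp add: ord_ge_def)

lemma psi_nzd: assumes "nonzerodivisor b" shows "\<psi> b i \<noteq> 0"
proof
  assume "\<psi> b i = 0"
  then have "\<phi> b i = 0" using psi_phi[of b i] by simp
  moreover obtain c where "1 = \<phi> b * c" using phi_nzd[OF assms] by (rule dvdE)
  then have "1 i = (\<phi> b * c) i" by (rule arg_cong)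
  ultimately show False by simp
qed

lemma psi_frac: "\<exists>a b. (\<forall>i. \<psi> b i \<noteq> 0) \<and> \<psi> b * f = \<psi> a"
proof -
  obtain a b where ab: "nonzerodivisor b" "\<phi> b * (\<lambda>i. fps_to_fls (f i)) = \<phi> a"
    using phi_frac by blast
  have "\<psi> b * f = \<psi> a"
  proof (rule ext, rule fps_to_fls_eq_imp_fps_eq)
    fix i
    show "fps_to_fls ((\<psi> b * f) i) = fps_to_fls (\<psi> a i)"
      using fun_cong[OF ab(2), of i] by (simp add: fls_times_fps_to_fls)
  qed
  then show ?thesis using psi_nzd[OF ab(1)] by blast
qed

text \<open>Completeness gives a value in \<open>A\<close> to a power series in \<open>y\<close>
  with constant coefficients.\<close>

lemma adic_limit:
  assumes "y \<in> \<mm>"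
  shows "\<exists>a. \<forall>K. a - (\<Sum>k<K. \<iota> (c k) * y ^ k) \<in> ideal_power \<mm> K"
proof -
  let ?s = "\<lambda>K. \<Sum>k<K. \<iota> (c k) * y ^ k"
  have "?s (Suc K) - ?s K \<in> ideal_power \<mm> K" for K
    using ideal_mult[OF ideal_power_ideal power_in_ideal_power[OF assms], of "\<iota> (c K)" K] by simp
  then show ?thesis
    using complete[unfolded adically_complete_def, THEN conjunct2, rule_format, of ?s] by blast
qed

text \<open>Repeated division by \<open>y\<close> writes each component \<open>f i\<close> as a
  \<open>y\<close>-adic series whose digits are polynomials of degree below \<open>N i\<close>.
  Summing the coefficients of each \<open>fps_X ^ n\<close> in the complete ring \<open>A\<close>
  shows that the normalization is generated by finitely many elements over \<open>A\<close>. A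
  common denominator \<open>b\<close> of these carries all of it into \<open>A\<close>.\<close>

theorem conductor: "\<exists>D. \<forall>f. ord_ge D f \<longrightarrow> f \<in> range \<psi>"
proof -
  obtain y where y: "y \<in> \<mm>" "nonzerodivisor y" using ex_nonzerodivisor by blast
  define N where "N i = subdegree (\<psi> y i)" for i
  have y0: "\<psi> y i \<noteq> 0" for i using psi_nzd y(2) by blast
  have ym: "ord_ge 1 (\<psi> y)" using psi_m[OF y(1)] by (simp add: ord_ge_def)
  have step: "\<exists>f'. \<forall>i. f i = fps_cutoff (N i) (f i) + \<psi> y i * f' i" for f
  proof -
    have "\<exists>h. f i = fps_cutoff (N i) (f i) + \<psi> y i * h" for i
    proof -
      let ?d = "f i - fps_cutoff (N i) (f i)"
      have "\<psi> y i dvd ?d"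
      proof (cases "?d = 0")
        case False
        then have "N i \<le> subdegree ?d" by (intro subdegree_geI) auto
        then show ?thesis using False y0 by (simp add: fps_dvd_iff N_def)
      qed simp
      then obtain h where "?d = \<psi> y i * h" by (rule dvdE)
      then show ?thesis by (intro exI[of _ h]) (metis add.commute diff_add_cancel)
    qed
    then show ?thesis by metis
  qed
  then obtain st where st: "\<And>f i. f i = fps_cutoff (N i) (f i) + \<psi> y i * st f i" by metis
  have rep: "\<exists>a. \<forall>i. f i = (\<Sum>n<N i. \<psi> (a i n) i * fps_X ^ n)" for f
  proof -
    define fs where "fs k = (st ^^ k) f" for k
    have fs: "fs k i = fps_cutoff (N i) (fs k i) + \<psi> y i * fs (Suc k) i" for k i
      unfolding fs_def using st[of "(st ^^ k) f" i] by simp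
    have expand: "f i = (\<Sum>k<K. \<psi> y i ^ k * fps_cutoff (N i) (fs k i)) + \<psi> y i ^ K * fs K i" for K i
    proof (induction K)
      case 0
      then show ?case by (simp add: fs_def)
    next
      case (Suc K)
      have "\<psi> y i ^ K * fs K i = \<psi> y i ^ K * fps_cutoff (N i) (fs K i) + \<psi> y i ^ Suc K * fs (Suc K) i"
        by (subst fs) (simp add: distrib_left mult.assoc mult.left_commute)
      then show ?case using Suc by (simp add: add.assoc)
    qed
    obtain a where a: "\<And>i n K. a i n - (\<Sum>k<K. \<iota> (fs k i $ n) * y ^ k) \<in> ideal_power \<mm> K"
    proof -
      have "\<forall>i n. \<exists>a. \<forall>K. a - (\<Sum>k<K. \<iota> (fs k i $ n) * y ^ k) \<in> ideal_power \<mm> K"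
        using adic_limit[OF y(1)] by simp
      then obtain a where "\<forall>i n. \<forall>K. a i n - (\<Sum>k<K. \<iota> (fs k i $ n) * y ^ k) \<in> ideal_power \<mm> K"
        unfolding choice_iff by blast
      then show ?thesis using that by blast
    qed
    have "f i = (\<Sum>n<N i. \<psi> (a i n) i * fps_X ^ n)" for i
    proof (rule fps_ext)
      fix l
      define K where "K = Suc l"
      have A: "ord_ge K (\<psi> (a i n - (\<Sum>k<K. \<iota> (fs k i $ n) * y ^ k)))" for n
        by (rule psi_ideal_power[OF a])
      have "\<psi> (a i n) i $ k' = (\<Sum>k<K. fps_const (fs k i $ n) * \<psi> y i ^ k) $ k'" if "k' < K" for n k'
      proof -
        have "\<psi> (a i n - (\<Sum>k<K. \<iota> (fs k i $ n) * y ^ k)) i $ k' = 0"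
          using A that by (simp add: ord_ge_def del: psi)
        then show ?thesis by (simp add: psi_sum psi_power sum_fun_apply power_fun_apply)
      qed
      then have B: "(\<psi> (a i n) i - (\<Sum>k<K. fps_const (fs k i $ n) * \<psi> y i ^ k)) $ k' = 0" if "k' < K" for n k'
        using that by simp
      have "((\<psi> (a i n) i - (\<Sum>k<K. fps_const (fs k i $ n) * \<psi> y i ^ k)) * fps_X ^ n) $ l = 0" for n
        by (rule fps_mult_nth_zero[of K _ 0]) (use B in \<open>auto simp: K_def\<close>)
      then have C: "(\<psi> (a i n) i * fps_X ^ n) $ l = ((\<Sum>k<K. fps_const (fs k i $ n) * \<psi> y i ^ k) * fps_X ^ n) $ l" for n
        by (simp add: left_diff_distrib)
      have "ord_ge K (\<psi> y ^ K)"
        using psi_ideal_power[OF power_in_ideal_power[OF y(1)], of K] by (simp add: psi_power)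
      then have D: "(\<psi> y i ^ K * fs K i) $ l = 0"
        by (intro fps_mult_nth_zero[of K _ 0]) (auto simp: ord_ge_def power_fun_apply K_def)
      have "f i = (\<Sum>k<K. \<psi> y i ^ k * (\<Sum>n<N i. fps_const (fs k i $ n) * fps_X ^ n)) + \<psi> y i ^ K * fs K i"
        using expand[of i K] by (simp only: fps_cutoff_eq_sum)
      also have "(\<Sum>k<K. \<psi> y i ^ k * (\<Sum>n<N i. fps_const (fs k i $ n) * fps_X ^ n))
          = (\<Sum>n<N i. (\<Sum>k<K. fps_const (fs k i $ n) * \<psi> y i ^ k) * fps_X ^ n)"
        unfolding sum_distrib_left sum_distrib_right
        by (rule trans[OF sum.swap]) (intro sum.cong refl, simp only: ac_simps)
      finally have F: "f i = (\<Sum>n<N i. (\<Sum>k<K. fps_const (fs k i $ n) * \<psi> y i ^ k) * fps_X ^ n)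
          + \<psi> y i ^ K * fs K i" .
      have "f i $ l = (\<Sum>n<N i. (\<Sum>k<K. fps_const (fs k i $ n) * \<psi> y i ^ k) * fps_X ^ n) $ l"
        by (subst F) (simp only: fps_add_nth D add_0_right)
      also have "\<dots> = (\<Sum>n<N i. \<psi> (a i n) i * fps_X ^ n) $ l"
        by (simp only: fps_sum_nth C)
      finally show "f i $ l = (\<Sum>n<N i. \<psi> (a i n) i * fps_X ^ n) $ l" .
    qed
    then show ?thesis by blast
  qed
  \<comment> \<open>The coefficients \<open>a i n\<close> depend on the branch, so the generators
    have to be supported on single branches.\<close>
  define e :: "'r \<Rightarrow> nat \<Rightarrow> 'r \<Rightarrow> 'k fps" where "e j n i = (if i = j then fps_X ^ n else 0)" for j n i
  have "\<forall>j n. \<exists>v. \<exists>u. (\<forall>i. \<psi> v i \<noteq> 0) \<and> \<psi> v * e j n = \<psi> u" using psi_frac by blast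
  then obtain v u where uv: "\<And>j n i. \<psi> (v j n) i \<noteq> 0" "\<And>j n. \<psi> (v j n) * e j n = \<psi> (u j n)"
    unfolding choice_iff by blast
  define S where "S = (SIGMA j : (UNIV :: 'r set). {..<N j})"
  have finS: "finite S" unfolding S_def by auto
  define b where "b = (\<Prod>(j,n)\<in>S. v j n)"
  have psi_prod: "\<psi> (\<Prod>p\<in>T. w p) i = (\<Prod>p\<in>T. \<psi> (w p) i)" for T :: "('r \<times> nat) set" and w i
    by (induction T rule: infinite_finite_induct) simp_all
  have b0: "\<psi> b i \<noteq> 0" for i
    unfolding b_def psi_prod using finS uv(1) by (auto simp: prod_zero_iff)
  have be: "\<exists>c. \<psi> b * e j n = \<psi> c" if "(j, n) \<in> S" for j n
  proof -
    define w where "w = (\<Prod>p\<in>S - {(j,n)}. v (fst p) (snd p))"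
    have "b = v j n * w"
      unfolding b_def w_def using that finS
      by (subst prod.remove[of _ "(j,n)"]) (simp_all add: case_prod_unfold)
    then have "\<psi> b * e j n = \<psi> w * (\<psi> (v j n) * e j n)" by (simp add: ac_simps)
    then have "\<psi> b * e j n = \<psi> (w * u j n)" by (simp only: uv(2) psi(3))
    then show ?thesis by blast
  qed
  have bf: "\<psi> b * f \<in> range \<psi>" for f
  proof -
    obtain a where a: "\<And>i. f i = (\<Sum>n<N i. \<psi> (a i n) i * fps_X ^ n)" using rep[of f] by blast
    have "\<forall>j n. \<exists>c. (j, n) \<in> S \<longrightarrow> \<psi> b * e j n = \<psi> c" using be by blast
    then obtain c where c: "\<And>j n. (j, n) \<in> S \<Longrightarrow> \<psi> b * e j n = \<psi> (c j n)"
      unfolding choice_iff by blast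
    have "f = (\<Sum>(j,n)\<in>S. \<psi> (a j n) * e j n)"
    proof
      fix i
      have "(\<Sum>(j,n)\<in>S. \<psi> (a j n) * e j n) i = (\<Sum>(j,n)\<in>S. \<psi> (a j n) i * e j n i)"
        by (simp add: sum_fun_apply case_prod_unfold)
      also have "\<dots> = (\<Sum>j\<in>UNIV. \<Sum>n<N j. \<psi> (a j n) i * e j n i)"
        unfolding S_def by (rule sum.Sigma[symmetric]) auto
      also have "\<dots> = (\<Sum>j\<in>UNIV. if j = i then \<Sum>n<N j. \<psi> (a j n) i * fps_X ^ n else 0)"
        by (rule sum.cong) (auto simp: e_def)
      also have "\<dots> = f i" using a by simp
      finally show "f i = (\<Sum>(j,n)\<in>S. \<psi> (a j n) * e j n) i" by simp
    qed
    then have "\<psi> b * f = (\<Sum>(j,n)\<in>S. \<psi> (a j n) * (\<psi> b * e j n))"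
      by (simp add: sum_distrib_left case_prod_unfold mult.left_commute)
    also have "\<dots> = (\<Sum>(j,n)\<in>S. \<psi> (a j n * c j n))"
      by (rule sum.cong) (auto simp: c)
    also have "\<dots> = \<psi> (\<Sum>(j,n)\<in>S. a j n * c j n)"
      by (simp add: psi_sum case_prod_unfold)
    finally show ?thesis by blast
  qed
  \<comment> \<open>A common bound for the orders of \<open>b\<close>; a family of at least this
    order is a multiple of \<open>b\<close>.\<close>
  define D where "D = (\<Sum>i\<in>UNIV. subdegree (\<psi> b i))"
  have "f \<in> range \<psi>" if f: "ord_ge D f" for f
  proof -
    have "\<psi> b i dvd f i" for i
    proof (cases "f i = 0")
      case False
      have "subdegree (\<psi> b i) \<le> D" unfolding D_def by (rule member_le_sum) auto
      also have "D \<le> subdegree (f i)" using False f by (intro subdegree_geI) (auto simp: ord_ge_def)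
      finally show ?thesis using False b0 by (simp add: fps_dvd_iff)
    qed simp
    then have "\<forall>i. \<exists>g. f i = \<psi> b i * g" unfolding dvd_def by blast
    then obtain g where "\<forall>i. f i = \<psi> b i * g i" unfolding choice_iff by blast
    then have "f = \<psi> b * g" by (intro ext) simp
    then show ?thesis using bf by simp
  qed
  then show ?thesis by blast
qed

end

subsection \<open>Weighted monomials and power series\<close>

abbreviation "keys \<equiv> Poly_Mapping.keys"
abbreviation "lookup \<equiv> Poly_Mapping.lookup"

lemma keys_plus_nat: "keys (a + b) = keys a \<union> keys b"
  for a b :: "nat \<Rightarrow>\<^sub>0 nat"
  by (auto simp: in_keys_iff lookup_add)

lemma monomial_induct [consumes 1, case_names zero plus]:
  assumes "keys m \<subseteq> {..<N}" and "P 0"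
    and "\<And>m j. j < N \<Longrightarrow> keys m \<subseteq> {..<N} \<Longrightarrow> P m \<Longrightarrow> P (m + Poly_Mapping.single j 1)"
  shows "P (m :: nat \<Rightarrow>\<^sub>0 nat)"
  using assms(1)
proof (induction "\<Sum>j<N. lookup m j" arbitrary: m)
  case 0
  then have "lookup m j = 0" for j
    by (cases "j < N") (auto simp: in_keys_iff)
  then have "m = 0" by (intro poly_mapping_eqI) simp
  then show ?case using assms(2) by simp
next
  case (Suc d)
  then obtain j where j: "j < N" "lookup m j \<noteq> 0"
    by (metis lessThan_iff nat.distinct(1) sum.neutral)
  let ?m = "m - Poly_Mapping.single j 1"
  have m: "m = ?m + Poly_Mapping.single j 1"
    using j by (intro poly_mapping_eqI) (auto simp: lookup_add lookup_minus lookup_single when_def)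
  have k: "keys ?m \<subseteq> {..<N}"
  proof
    fix i assume "i \<in> keys ?m"
    then have "lookup m i - lookup (Poly_Mapping.single j 1) i \<noteq> 0"
      by (simp only: in_keys_iff lookup_minus not_False_eq_True)
    then have "lookup m i \<noteq> 0" by (metis diff_0_eq_0)
    then have "i \<in> keys m" by (simp only: in_keys_iff not_False_eq_True)
    then show "i \<in> {..<N}" using Suc.prems by blast
  qed
  have "(\<Sum>i<N. lookup m i) = (\<Sum>i<N. lookup ?m i) + (\<Sum>i<N. if i = j then 1 else 0)"
    unfolding sum.distrib[symmetric] using j
    by (intro sum.cong) (auto simp: lookup_minus lookup_single when_def)
  then have "d = (\<Sum>i<N. lookup ?m i)" using Suc.hyps(2) j by simp
  then have "P ?m" using Suc.hyps(1) k by blast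
  then show ?case using assms(3)[OF j(1) k] m by simp
qed

lemma weighted_degree_superset:
  assumes "finite U" "keys m \<subseteq> U"
  shows "weighted_degree w m = (\<Sum>i\<in>U. w i * lookup m i)"
  unfolding weighted_degree_def
  by (rule sum.mono_neutral_left) (use assms in \<open>auto simp: in_keys_iff\<close>)

lemma weighted_degree_add [simp]: "weighted_degree w (a + b) = weighted_degree w a + weighted_degree w b"
proof -
  let ?U = "keys a \<union> keys b"
  have "weighted_degree w (a + b) = (\<Sum>i\<in>?U. w i * lookup (a + b) i)"
    by (rule weighted_degree_superset) (auto simp: keys_plus_nat)
  also have "\<dots> = (\<Sum>i\<in>?U. w i * lookup a i) + (\<Sum>i\<in>?U. w i * lookup b i)"
    by (simp add: lookup_add distrib_left sum.distrib)
  also have "\<dots> = weighted_degree w a + weighted_degree w b"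
    by (simp add: weighted_degree_superset[of ?U])
  finally show ?thesis .
qed

lemma weighted_degree_0 [simp]: "weighted_degree w 0 = 0"
  by (simp add: weighted_degree_def)

lemma weighted_degree_single [simp]: "weighted_degree w (Poly_Mapping.single j c) = w j * c"
  by (cases "c = 0") (simp_all add: weighted_degree_def)

definition monval :: "(nat \<Rightarrow> 'b::comm_monoid_mult) \<Rightarrow> (nat \<Rightarrow>\<^sub>0 nat) \<Rightarrow> 'b" where
  "monval \<rho> m = (\<Prod>j\<in>keys m. \<rho> j ^ lookup m j)"

lemma monval_superset:
  assumes "finite U" "keys m \<subseteq> U"
  shows "monval \<rho> m = (\<Prod>i\<in>U. \<rho> i ^ lookup m i)"
  unfolding monval_def
  by (rule prod.mono_neutral_left) (use assms in \<open>auto simp: in_keys_iff\<close>)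

lemma monval_add [simp]: "monval \<rho> (a + b) = monval \<rho> a * monval \<rho> b"
proof -
  let ?U = "keys a \<union> keys b"
  have "monval \<rho> (a + b) = (\<Prod>i\<in>?U. \<rho> i ^ lookup (a + b) i)"
    by (rule monval_superset) (auto simp: keys_plus_nat)
  also have "\<dots> = (\<Prod>i\<in>?U. \<rho> i ^ lookup a i) * (\<Prod>i\<in>?U. \<rho> i ^ lookup b i)"
    by (simp add: lookup_add power_add prod.distrib)
  also have "\<dots> = monval \<rho> a * monval \<rho> b"
    by (simp add: monval_superset[of ?U])
  finally show ?thesis .
qed

lemma monval_0 [simp]: "monval \<rho> 0 = 1"
  by (simp add: monval_def)

lemma monval_single [simp]: "monval \<rho> (Poly_Mapping.single j (Suc 0)) = \<rho> j"
  by (simp add: monval_def)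

definition monomials :: "nat \<Rightarrow> (nat \<Rightarrow> nat) \<Rightarrow> nat \<Rightarrow> (nat \<Rightarrow>\<^sub>0 nat) set" where
  "monomials N w u = {m. keys m \<subseteq> {..<N} \<and> weighted_degree w m = u}"

text \<open>Positive weights bound every exponent by \<open>u\<close>.\<close>

lemma finite_monomials [simp]:
  assumes "\<And>j. j < N \<Longrightarrow> w j > 0"
  shows "finite (monomials N w u)"
proof -
  let ?F = "{h. \<forall>i. (i \<in> {..<N} \<longrightarrow> h i \<in> {..u}) \<and> (i \<notin> {..<N} \<longrightarrow> h i = (0::nat))}"
  have "lookup m \<in> ?F" if m: "m \<in> monomials N w u" for m
  proof -
    have k: "keys m \<subseteq> {..<N}" and d: "weighted_degree w m = u"
      using m by (auto simp: monomials_def)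
    have "lookup m i \<le> u" if i: "i < N" for i
    proof -
      have "lookup m i \<le> w i * lookup m i" using assms[OF i] by simp
      also have "\<dots> \<le> (\<Sum>i<N. w i * lookup m i)"
        by (rule member_le_sum) (use i in auto)
      also have "\<dots> = u" using weighted_degree_superset[OF _ k] d by simp
      finally show ?thesis .
    qed
    moreover have "lookup m i = 0" if "i \<notin> {..<N}" for i
      using k that by (auto simp: in_keys_iff)
    ultimately show ?thesis by auto
  qed
  moreover have "finite ?F" by (rule finite_set_of_finite_funs) auto
  ultimately have "finite (lookup ` monomials N w u)" by (meson finite_subset image_subsetI)
  then show ?thesis by (rule finite_imageD) (simp add: inj_on_def lookup_inject)
qed

section \<open>Coefficients, monomials and finitely generated ideals of power series\<close>

lemma mcoeff_mult: "mcoeff (f * g) m = (\<Sum>(a, b) \<in> {(a, b). a + b = m}. mcoeff f a * mcoeff g b)"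
  by (simp only: times_mfps.rep_eq)

lemmas mcoeff_simps [simp] = zero_mfps.rep_eq plus_mfps.rep_eq uminus_mfps.rep_eq minus_mfps.rep_eq

lemma mcoeff_sum: "mcoeff (\<Sum>i\<in>I. f i) m = (\<Sum>i\<in>I. mcoeff (f i) m)"
  by (induction I rule: infinite_finite_induct) simp_all

lemma mcoeff_const_mult [simp]: "mcoeff (mfps_const c * f) m = c * mcoeff f m"
proof -
  have "mcoeff (mfps_const c * f) m
      = (\<Sum>(a, b) \<in> {(a, b). a + b = m}. (if a = 0 then c else 0) * mcoeff f b)"
    by (simp only: mcoeff_mult mfps_const.rep_eq)
  also have "\<dots> = (\<Sum>(a, b) \<in> {(0 :: nat \<Rightarrow>\<^sub>0 nat, m)}. (if a = 0 then c else 0) * mcoeff f b)"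
    by (rule sum.mono_neutral_right[OF finite_monomial_splits]) (auto split: if_splits)
  finally show ?thesis by simp
qed

lemma mfps_ring_iff: "f \<in> mfps_ring N \<longleftrightarrow> (\<forall>m. \<not> keys m \<subseteq> {..<N} \<longrightarrow> mcoeff f m = 0)"
  unfolding mfps_ring_def by blast

lemma mfps_ring_closed [simp]:
  fixes f g :: "'k::comm_ring_1 mfps"
  shows "0 \<in> (mfps_ring N :: 'k mfps set)" "1 \<in> (mfps_ring N :: 'k mfps set)" "mfps_const c \<in> (mfps_ring N :: 'k mfps set)"
    "f \<in> mfps_ring N \<Longrightarrow> g \<in> mfps_ring N \<Longrightarrow> f + g \<in> mfps_ring N"
    "f \<in> mfps_ring N \<Longrightarrow> g \<in> mfps_ring N \<Longrightarrow> f - g \<in> mfps_ring N"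
    "f \<in> mfps_ring N \<Longrightarrow> - f \<in> mfps_ring N"
    "f \<in> mfps_ring N \<Longrightarrow> g \<in> mfps_ring N \<Longrightarrow> f * g \<in> mfps_ring N"
proof -
  show "f \<in> mfps_ring N \<Longrightarrow> g \<in> mfps_ring N \<Longrightarrow> f * g \<in> mfps_ring N"
    unfolding mfps_ring_iff mcoeff_mult
  proof (intro allI impI sum.neutral ballI)
    fix m :: "nat \<Rightarrow>\<^sub>0 nat" and p
    assume fg: "\<forall>m. \<not> keys m \<subseteq> {..<N} \<longrightarrow> mcoeff f m = 0"
      "\<forall>m. \<not> keys m \<subseteq> {..<N} \<longrightarrow> mcoeff g m = 0"
      and m: "\<not> keys m \<subseteq> {..<N}" and p: "p \<in> {(a, b). a + b = m}"
    obtain a b where ab: "p = (a, b)" "a + b = m" using p by auto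
    have "keys m = keys a \<union> keys b"
      using ab(2) keys_plus_nat[of a b] by simp
    then have "\<not> keys a \<subseteq> {..<N} \<or> \<not> keys b \<subseteq> {..<N}"
      using m by blast
    then have "mcoeff f a = 0 \<or> mcoeff g b = 0" using fg by blast
    then show "(case p of (a, b) \<Rightarrow> mcoeff f a * mcoeff g b) = 0" using ab by auto
  qed
qed (auto simp: mfps_ring_iff one_mfps.rep_eq mfps_const.rep_eq)

lemma mfps_ring_sum [simp]: "(\<And>i. i \<in> I \<Longrightarrow> f i \<in> mfps_ring N) \<Longrightarrow> (\<Sum>i\<in>I. f i) \<in> mfps_ring N"
  for f :: "_ \<Rightarrow> 'k::comm_ring_1 mfps"
  by (induction I rule: infinite_finite_induct) simp_all

definition mfps_monom :: "'k::zero \<Rightarrow> (nat \<Rightarrow>\<^sub>0 nat) \<Rightarrow> 'k mfps" where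
  "mfps_monom c m = Abs_mfps (\<lambda>m'. if m' = m then c else 0)"

lemma mcoeff_monom: "mcoeff (mfps_monom c m) m' = (if m' = m then c else 0)"
  by (simp add: mfps_monom_def Abs_mfps_inverse)

lemma mfps_monom_ring: "keys m \<subseteq> {..<N} \<Longrightarrow> mfps_monom c m \<in> mfps_ring N"
  by (auto simp: mfps_ring_iff mcoeff_monom)

lemma mfps_monom_mult: "mfps_monom c a * mfps_monom d b = mfps_monom (c * d) (a + b)" for c d :: "'k::comm_ring_1"
proof (rule mfps_eqI)
  fix m
  have "mcoeff (mfps_monom c a * mfps_monom d b) m
      = (\<Sum>(x, y) \<in> {(x, y). x + y = m}. (if x = a then c else 0) * (if y = b then d else 0))"
    by (simp only: mcoeff_mult mcoeff_monom)
  also have "\<dots> = (\<Sum>p \<in> {(x, y). x + y = m}. if p = (a, b) then c * d else 0)"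
    by (rule sum.cong) (auto split: if_splits)
  also have "\<dots> = mcoeff (mfps_monom (c * d) (a + b)) m"
    by (simp add: mcoeff_monom finite_monomial_splits)
  finally show "mcoeff (mfps_monom c a * mfps_monom d b) m = mcoeff (mfps_monom (c * d) (a + b)) m" .
qed

lemma mfps_monom_0: "mfps_monom c 0 = mfps_const c"
  by (rule mfps_eqI) (simp add: mcoeff_monom mfps_const.rep_eq)

lemma mfps_monom_add: "mfps_monom (c + d) m = mfps_monom c m + mfps_monom d m" for c d :: "'k::comm_ring_1"
  by (rule mfps_eqI) (simp add: mcoeff_monom)

lemma mfps_monom_zero [simp]: "mfps_monom 0 m = (0 :: 'k::comm_ring_1 mfps)"
  by (rule mfps_eqI) (simp add: mcoeff_monom)

lemma finite_support_expand:
  assumes "finite T" "\<And>m. m \<notin> T \<Longrightarrow> mcoeff f m = (0::'k::comm_ring_1)"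
  shows "f = (\<Sum>m\<in>T. mfps_monom (mcoeff f m) m)"
  by (rule mfps_eqI) (use assms in \<open>auto simp: mcoeff_sum mcoeff_monom\<close>)

definition mfps_part :: "(nat \<Rightarrow> nat) \<Rightarrow> nat \<Rightarrow> 'k::zero mfps \<Rightarrow> 'k mfps" where
  "mfps_part w u f = Abs_mfps (\<lambda>m. if weighted_degree w m = u then mcoeff f m else 0)"

lemma mcoeff_part: "mcoeff (mfps_part w u f) m = (if weighted_degree w m = u then mcoeff f m else 0)"
  by (simp add: mfps_part_def Abs_mfps_inverse)

text \<open>Filling up with zero coefficients gives all elements the same index set, so that sums
  and gluing can be done generator by generator.\<close>

lemma mfps_ideal_gen_finite:
  assumes "finite S"
  shows "mfps_ideal_gen N S = {\<Sum>s\<in>S. c s * s | c. \<forall>s\<in>S. c s \<in> mfps_ring N}"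
proof (intro equalityI subsetI)
  fix f assume "f \<in> mfps_ideal_gen N S"
  then obtain F c where F: "finite F" "F \<subseteq> S" "\<forall>s\<in>F. c s \<in> mfps_ring N" "f = (\<Sum>s\<in>F. c s * s)"
    unfolding mfps_ideal_gen_def by blast
  have "f = (\<Sum>s\<in>S. (if s \<in> F then c s else 0) * s)"
    unfolding F(4) by (rule sum.mono_neutral_cong_left) (use F assms in auto)
  moreover have "\<forall>s\<in>S. (if s \<in> F then c s else 0) \<in> mfps_ring N" using F by simp
  ultimately show "f \<in> {\<Sum>s\<in>S. c s * s | c. \<forall>s\<in>S. c s \<in> mfps_ring N}"
    by (intro CollectI exI[of _ "\<lambda>s. if s \<in> F then c s else 0"]) simp
next
  fix f assume "f \<in> {\<Sum>s\<in>S. c s * s | c. \<forall>s\<in>S. c s \<in> mfps_ring N}"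
  then show "f \<in> mfps_ideal_gen N S" unfolding mfps_ideal_gen_def using assms by blast
qed

lemma
  fixes S :: "'k::comm_ring_1 mfps set"
  assumes S: "finite S"
  shows mfps_ideal_gen_0: "0 \<in> mfps_ideal_gen N S"
    and mfps_ideal_gen_add: "f \<in> mfps_ideal_gen N S \<Longrightarrow> g \<in> mfps_ideal_gen N S \<Longrightarrow> f + g \<in> mfps_ideal_gen N S"
    and mfps_ideal_gen_mult: "f \<in> mfps_ideal_gen N S \<Longrightarrow> h \<in> mfps_ring N \<Longrightarrow> h * f \<in> mfps_ideal_gen N S"
    and mfps_ideal_gen_base: "s \<in> S \<Longrightarrow> s \<in> mfps_ideal_gen N S"
proof -
  note e = mfps_ideal_gen_finite[OF S]
  show "0 \<in> mfps_ideal_gen N S" unfolding e by (auto intro!: exI[of _ "\<lambda>_. 0"])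
  show "f + g \<in> mfps_ideal_gen N S" if fg: "f \<in> mfps_ideal_gen N S" "g \<in> mfps_ideal_gen N S"
  proof -
    obtain c d where "\<forall>s\<in>S. c s \<in> mfps_ring N" "\<forall>s\<in>S. d s \<in> mfps_ring N"
      "f = (\<Sum>s\<in>S. c s * s)" "g = (\<Sum>s\<in>S. d s * s)" using fg unfolding e by blast
    then show ?thesis unfolding e
      by (intro CollectI exI[of _ "\<lambda>s. c s + d s"]) (simp add: distrib_right sum.distrib)
  qed
  show "h * f \<in> mfps_ideal_gen N S" if fg: "f \<in> mfps_ideal_gen N S" "h \<in> mfps_ring N"
  proof -
    obtain c where "\<forall>s\<in>S. c s \<in> mfps_ring N" "f = (\<Sum>s\<in>S. c s * s)" using fg unfolding e by blast
    then show ?thesis unfolding e using fg(2)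
      by (intro CollectI exI[of _ "\<lambda>s. h * c s"]) (simp add: sum_distrib_left mult.assoc)
  qed
  show "s \<in> mfps_ideal_gen N S" if "s \<in> S"
    unfolding mfps_ideal_gen_def using that
    by (intro CollectI exI[of _ "{s}"] exI[of _ "\<lambda>_. 1"]) simp
qed

text \<open>The coefficient of \<open>s\<close> is glued from its values on the homogeneous parts: only the part of
  weight \<open>weighted_degree w m + d s\<close> of the series can see the coefficient at \<open>m\<close>.\<close>
lemma homogeneous_parts_in_ideal:
  fixes S :: "'k::comm_ring_1 mfps set"
  assumes S: "finite S" and hom: "\<And>s m. s \<in> S \<Longrightarrow> mcoeff s m \<noteq> 0 \<Longrightarrow> weighted_degree w m = d s"
    and f: "\<And>u. mfps_part w u f \<in> mfps_ideal_gen N S"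
  shows "f \<in> mfps_ideal_gen N S"
proof -
  have "\<forall>u. \<exists>c. (\<forall>s\<in>S. c s \<in> mfps_ring N) \<and> mfps_part w u f = (\<Sum>s\<in>S. c s * s)"
    using f unfolding mfps_ideal_gen_finite[OF S] by blast
  then obtain c where c: "\<And>u s. s \<in> S \<Longrightarrow> c u s \<in> mfps_ring N"
      "\<And>u. mfps_part w u f = (\<Sum>s\<in>S. c u s * s)" unfolding choice_iff by blast
  define c' where "c' s = Abs_mfps (\<lambda>m. mcoeff (c (weighted_degree w m + d s) s) m)" for s
  have c': "mcoeff (c' s) m = mcoeff (c (weighted_degree w m + d s) s) m" for s m
    by (simp add: c'_def Abs_mfps_inverse)
  have "f = (\<Sum>s\<in>S. c' s * s)"
  proof (rule mfps_eqI)
    fix m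
    let ?u = "weighted_degree w m"
    have "mcoeff (c' s * s) m = mcoeff (c ?u s * s) m" if s: "s \<in> S" for s
      unfolding mcoeff_mult
    proof (rule sum.cong[OF refl])
      fix p assume "p \<in> {(a, b). a + b = m}"
      then obtain a b where p: "p = (a, b)" "a + b = m" by auto
      have "mcoeff (c' s) a * mcoeff s b = mcoeff (c ?u s) a * mcoeff s b"
      proof (cases "mcoeff s b = 0")
        case False
        then have "weighted_degree w b = d s" using hom s by blast
        then show ?thesis using p(2) c' weighted_degree_add by metis
      qed simp
      then show "(case p of (a, b) \<Rightarrow> mcoeff (c' s) a * mcoeff s b)
          = (case p of (a, b) \<Rightarrow> mcoeff (c ?u s) a * mcoeff s b)" using p by simp
    qed
    then have "mcoeff (\<Sum>s\<in>S. c' s * s) m = mcoeff (\<Sum>s\<in>S. c ?u s * s) m"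
      by (simp add: mcoeff_sum)
    also have "\<dots> = mcoeff f m" unfolding c(2)[symmetric] by (simp add: mcoeff_part)
    finally show "mcoeff f m = mcoeff (\<Sum>s\<in>S. c' s * s) m" by simp
  qed
  moreover have "\<forall>s\<in>S. c' s \<in> mfps_ring N" using c(1) by (simp add: mfps_ring_iff c')
  ultimately show ?thesis unfolding mfps_ideal_gen_finite[OF S] by blast
qed

definition fscale :: "'k::comm_ring_1 \<Rightarrow> ('r \<Rightarrow> 'k) \<Rightarrow> 'r \<Rightarrow> 'k" where
  "fscale c f = (\<lambda>_. c) * f"

lemma fscale_apply [simp]: "fscale c f i = c * f i"
  by (simp add: fscale_def)

text \<open>The component of weight \<open>u\<close> of the value of a power series at \<open>\<rho>\<close>, when the value \<open>\<rho> j\<close> of the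
  \<open>j\<close>-th variable has weight \<open>w j\<close>.\<close>
definition evw :: "nat \<Rightarrow> (nat \<Rightarrow> nat) \<Rightarrow> (nat \<Rightarrow> 'r \<Rightarrow> 'k::comm_ring_1) \<Rightarrow> nat \<Rightarrow> 'k mfps \<Rightarrow> 'r \<Rightarrow> 'k" where
  "evw N w \<rho> u f = (\<Sum>m\<in>monomials N w u. fscale (mcoeff f m) (monval \<rho> m))"

lemma evw_add: "evw N w \<rho> u (f + g) = evw N w \<rho> u f + evw N w \<rho> u g"
  unfolding evw_def sum.distrib[symmetric]
  by (rule sum.cong) (auto simp: fun_eq_iff distrib_right)

lemma evw_diff: "evw N w \<rho> u (f - g) = evw N w \<rho> u f - evw N w \<rho> u g"
  unfolding evw_def sum_subtractf[symmetric]
  by (rule sum.cong) (auto simp: fun_eq_iff left_diff_distrib)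

lemma evw_0 [simp]: "evw N w \<rho> u 0 = 0"
  unfolding evw_def by (rule sum.neutral) (auto simp: fun_eq_iff)

lemma evw_sum: "evw N w \<rho> u (\<Sum>i\<in>I. f i) = (\<Sum>i\<in>I. evw N w \<rho> u (f i))"
  by (induction I rule: infinite_finite_induct) (simp_all add: evw_add)

lemma evw_part: "evw N w \<rho> u (mfps_part w v f) = (if u = v then evw N w \<rho> u f else 0)"
proof (cases "u = v")
  case True
  then show ?thesis unfolding evw_def
    by (auto intro!: sum.cong simp: mcoeff_part monomials_def)
next
  case False
  then have "fscale (mcoeff (mfps_part w v f) m) (monval \<rho> m) = 0" if "m \<in> monomials N w u" for m
    using that by (simp add: mcoeff_part monomials_def fun_eq_iff)
  then show ?thesis unfolding evw_def using False by simp
qed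

lemma evw_monom:
  assumes "\<And>j. j < N \<Longrightarrow> w j > 0" "keys m \<subseteq> {..<N}"
  shows "evw N w \<rho> u (mfps_monom c m) = (if weighted_degree w m = u then fscale c (monval \<rho> m) else 0)"
proof -
  have "evw N w \<rho> u (mfps_monom c m) = (\<Sum>m'\<in>monomials N w u. if m' = m then fscale c (monval \<rho> m) else 0)"
    unfolding evw_def by (rule sum.cong) (auto simp: mcoeff_monom fun_eq_iff)
  also have "\<dots> = (if m \<in> monomials N w u then fscale c (monval \<rho> m) else 0)"
    using finite_monomials[of N w u, OF assms(1)] by simp
  finally show ?thesis using assms(2) by (simp add: monomials_def)
qed

text \<open>Pairs of monomials are regrouped by the weight \<open>v\<close> of the first factor;
  positive weights keep all sums finite.\<close>

lemma evw_mult: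
  assumes w: "\<And>j. j < N \<Longrightarrow> w j > 0"
  shows "evw N w \<rho> u (f * g) = (\<Sum>v\<le>u. evw N w \<rho> v f * evw N w \<rho> (u - v) g)"
proof -
  let ?M = "monomials N w"
  let ?t = "\<lambda>a b. fscale (mcoeff f a) (monval \<rho> a) * fscale (mcoeff g b) (monval \<rho> b)"
  note fin = finite_monomials[of N w, OF w]
  have "evw N w \<rho> u (f * g) = (\<Sum>m\<in>?M u. \<Sum>(a, b)\<in>{(a, b). a + b = m}. ?t a b)"
    unfolding evw_def
  proof (rule sum.cong[OF refl])
    fix m
    have "fscale (mcoeff (f * g) m) (monval \<rho> m) i
        = (\<Sum>(a, b)\<in>{(a, b). a + b = m}. ?t a b) i" for i
      unfolding mcoeff_mult sum_fun_apply fscale_apply sum_distrib_right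
      by (rule sum.cong) (auto simp: ac_simps)
    then show "fscale (mcoeff (f * g) m) (monval \<rho> m)
        = (\<Sum>(a, b)\<in>{(a, b). a + b = m}. ?t a b)" by blast
  qed
  also have "\<dots> = (\<Sum>(m, p)\<in>(SIGMA m : ?M u. {(a, b). a + b = m}). ?t (fst p) (snd p))"
    by (subst sum.Sigma) (use fin finite_monomial_splits in \<open>auto simp: case_prod_unfold\<close>)
  also have "\<dots> = (\<Sum>(v, p)\<in>(SIGMA v : {..u}. ?M v \<times> ?M (u - v)). ?t (fst p) (snd p))"
    by (rule sum.reindex_bij_witness[of _ "\<lambda>(v, (a, b)). (a + b, (a, b))"
          "\<lambda>(m, (a, b)). (weighted_degree w a, (a, b))"])
      (auto simp: monomials_def keys_plus_nat)
  also have "\<dots> = (\<Sum>v\<le>u. \<Sum>p\<in>?M v \<times> ?M (u - v). ?t (fst p) (snd p))"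
    by (rule sum.Sigma[symmetric]) (auto simp: fin)
  also have "\<dots> = (\<Sum>v\<le>u. evw N w \<rho> v f * evw N w \<rho> (u - v) g)"
    unfolding evw_def sum_product
    by (rule sum.cong) (simp_all add: sum.cartesian_product case_prod_unfold)
  finally show ?thesis .
qed

subsection \<open>Presentations of graded algebras of dimension one\<close>

interpretation fv: vector_space "fscale :: 'k::field \<Rightarrow> ('r \<Rightarrow> 'k) \<Rightarrow> 'r \<Rightarrow> 'k"
  by unfold_locales (auto simp: fun_eq_iff algebra_simps)

text \<open>A homogeneous element of \<open>k[[t\<^sub>1]] \<times> \<dots> \<times> k[[t\<^sub>r]]\<close> of a given weight is determined by one coefficient
  per factor. \<open>V w\<close> collects these coefficient vectors for the elements of weight \<open>w\<close> of a graded
  subalgebra; the vector \<open>1\<close> in weight \<open>q\<close> is a homogeneous nonzerodivisor of the conductor.\<close>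
locale graded_vectors =
  fixes V :: "nat \<Rightarrow> ('r::finite \<Rightarrow> 'k::field) set" and q :: nat
  assumes V_sub: "fv.subspace (V w)"
    and V_mult: "f \<in> V a \<Longrightarrow> g \<in> V b \<Longrightarrow> f * g \<in> V (a + b)"
    and V_0: "V 0 \<subseteq> range (\<lambda>c _. c)"
    and one_0: "1 \<in> V 0" and one_q: "1 \<in> V q" and q_pos: "q > 0"
    and stab: "q \<le> w \<Longrightarrow> V (w + q) \<subseteq> V w"
begin

text \<open>Multiplication by the element of weight \<open>q\<close> whose coefficients are all 1
  does not change coefficient vectors.\<close>

lemma V_mono: "V w \<subseteq> V (w + q)"
  using V_mult[OF _ one_q, of _ w] by fastforce

lemma finite_independent: "fv.independent (B :: ('r \<Rightarrow> 'k) set) \<Longrightarrow> finite B"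
proof -
  assume B: "fv.independent B"
  let ?T = "range (\<lambda>j i. if i = j then 1 else 0 :: 'k) :: ('r \<Rightarrow> 'k) set"
  have "f \<in> fv.span ?T" for f :: "'r \<Rightarrow> 'k"
  proof -
    have "f = (\<Sum>j\<in>UNIV. fscale (f j) (\<lambda>i. if i = j then 1 else 0))"
      by (auto simp: fun_eq_iff sum_fun_apply if_distrib[of "\<lambda>x. _ * x"] cong: if_cong)
    also have "\<dots> \<in> fv.span ?T"
      by (intro fv.span_sum fv.span_scale fv.span_base) auto
    finally show ?thesis .
  qed
  then show "finite B" using fv.independent_span_bound[OF _ B, of ?T] by auto
qed

lemma V_stable: "V (r + q + j * q) = V (r + q)"
proof (induction j)
  case (Suc j)
  have "V (r + q + j * q + q) = V (r + q + j * q)"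
    using V_mono[of "r + q + j * q"] stab[of "r + q + j * q"] by auto
  then show ?case using Suc by (simp add: ac_simps)
qed simp

text \<open>The inclusions \<open>B w \<subseteq> B (w + q)\<close> make multiplication by the
  element of weight \<open>q\<close> map basis elements to basis elements. Since \<open>V\<close>
  has period \<open>q\<close> from weight \<open>q\<close> on, only weights below
  \<open>2 * q\<close> require a choice.\<close>

lemma ex_bases:
  "\<exists>B. (\<forall>w. B w \<subseteq> V w \<and> fv.independent (B w) \<and> V w \<subseteq> fv.span (B w)) \<and> B 0 = {1} \<and>
     (\<forall>w. B w \<subseteq> B (w + q))"
proof -
  have "\<exists>B. B \<subseteq> V r \<and> fv.independent B \<and> V r \<subseteq> fv.span B \<and> (r = 0 \<longrightarrow> B = {1})" for r
  proof (cases "r = 0")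
    case True
    have "v \<in> fv.span {1}" if v: "v \<in> V 0" for v
    proof -
      obtain c where "v = (\<lambda>_. c)" using v V_0 by blast
      then have "v = fscale c 1" by (simp add: fun_eq_iff)
      then show ?thesis using fv.span_scale[OF fv.span_base[of 1 "{1}"], of c] by simp
    qed
    moreover have "fv.independent {1 :: 'r \<Rightarrow> 'k}" by simp
    ultimately show ?thesis using True one_0 by (intro exI[of _ "{1}"]) auto
  next
    case False
    then show ?thesis using fv.maximal_independent_subset[of "V r"] by metis
  qed
  then have "\<forall>r. \<exists>B. B \<subseteq> V r \<and> fv.independent B \<and> V r \<subseteq> fv.span B \<and> (r = 0 \<longrightarrow> B = {1})" by blast
  then obtain B0 where "\<forall>r. B0 r \<subseteq> V r \<and> fv.independent (B0 r) \<and> V r \<subseteq> fv.span (B0 r) \<and> (r = 0 \<longrightarrow> B0 r = {1})"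
    unfolding choice_iff by (rule exE)
  then have B0: "\<And>r. B0 r \<subseteq> V r" "\<And>r. fv.independent (B0 r)" "\<And>r. V r \<subseteq> fv.span (B0 r)"
      "B0 0 = {1}" by simp_all
  have "\<forall>r. \<exists>B. B0 r \<subseteq> B \<and> B \<subseteq> V (r + q) \<and> fv.independent B \<and> V (r + q) \<subseteq> fv.span B"
  proof
    fix r
    have "B0 r \<subseteq> V (r + q)" using B0(1) V_mono by blast
    then show "\<exists>B. B0 r \<subseteq> B \<and> B \<subseteq> V (r + q) \<and> fv.independent B \<and> V (r + q) \<subseteq> fv.span B"
      using fv.maximal_independent_subset_extend[OF _ B0(2)[of r], of "V (r + q)"] by metis
  qed
  then obtain B1 where "\<forall>r. B0 r \<subseteq> B1 r \<and> B1 r \<subseteq> V (r + q) \<and> fv.independent (B1 r) \<and> V (r + q) \<subseteq> fv.span (B1 r)"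
    unfolding choice_iff by (rule exE)
  then have B1: "\<And>r. B0 r \<subseteq> B1 r" "\<And>r. B1 r \<subseteq> V (r + q)" "\<And>r. fv.independent (B1 r)"
      "\<And>r. V (r + q) \<subseteq> fv.span (B1 r)" by simp_all
  define B where "B w = (if w < q then B0 w else B1 (w mod q))" for w
  have V_mod: "V w = V (w mod q + q)" if "\<not> w < q" for w
  proof -
    have "w = w mod q + q + (w div q - 1) * q"
      using that q_pos div_mult_mod_eq[of w q] by (cases "w div q") (auto simp: div_eq_0_iff)
    then show ?thesis using V_stable by metis
  qed
  have "B w \<subseteq> V w \<and> fv.independent (B w) \<and> V w \<subseteq> fv.span (B w)" for w
  proof (cases "w < q")
    case True
    then show ?thesis using B0(1-3)[of w] by (simp add: B_def)
  next
    case False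
    then have "B w = B1 (w mod q)" by (simp add: B_def)
    then show ?thesis using B1(2-4)[of "w mod q"] unfolding V_mod[OF False] by simp
  qed
  moreover have "B 0 = {1}" using q_pos B0 by (simp add: B_def)
  moreover have "B w \<subseteq> B (w + q)" for w
    using B1(1)[of w] by (simp add: B_def)
  ultimately show ?thesis by blast
qed

end

text \<open>Variable 0 stands for the element of weight \<open>q\<close> with coefficient vector 1.
  The others enumerate the pairs of a weight and a basis vector that is new there, that is, not yet
  a basis vector \<open>q\<close> below; \<open>var\<close> inverts the enumeration.\<close>

locale graded_generators = graded_vectors V q
  for V :: "nat \<Rightarrow> ('r::finite \<Rightarrow> 'k::field) set" and q :: nat +
  fixes B :: "nat \<Rightarrow> ('r \<Rightarrow> 'k) set" and N :: nat and wt :: "nat \<Rightarrow> nat" and \<rho> :: "nat \<Rightarrow> 'r \<Rightarrow> 'k"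
    and var :: "nat \<Rightarrow> ('r \<Rightarrow> 'k) \<Rightarrow> nat"
  assumes B_V: "B w \<subseteq> V w" and B_indep: "fv.independent (B w)" and B_span: "V w \<subseteq> fv.span (B w)"
    and B_0: "B 0 = {1}" and B_mono: "B w \<subseteq> B (w + q)"
    and N_pos: "0 < N" and wt_0: "wt 0 = q" and \<rho>_0: "\<rho> 0 = 1"
    and var: "\<lbrakk>0 < w; g \<in> B w; q \<le> w \<Longrightarrow> g \<notin> B (w - q)\<rbrakk> \<Longrightarrow>
        var w g < N \<and> wt (var w g) = w \<and> \<rho> (var w g) = g"
    and gen: "\<lbrakk>j < N; j \<noteq> 0\<rbrakk> \<Longrightarrow> 0 < wt j \<and> \<rho> j \<in> B (wt j) \<and> (q \<le> wt j \<longrightarrow> \<rho> j \<notin> B (wt j - q)) \<and>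
        var (wt j) (\<rho> j) = j"
begin

lemma finite_B [simp]: "finite (B w)"
  by (rule finite_independent[OF B_indep])

lemma wt_pos: "j < N \<Longrightarrow> wt j > 0"
  using gen[of j] wt_0 q_pos by (cases "j = 0") auto

lemma \<rho>_B: "j < N \<Longrightarrow> \<rho> j \<in> B (wt j)"
  using gen[of j] wt_0 \<rho>_0 B_0 B_mono[of 0] by (cases "j = 0") auto

section \<open>Normal monomials\<close>

abbreviation X :: "nat \<Rightarrow> nat \<Rightarrow>\<^sub>0 nat" where "X j \<equiv> Poly_Mapping.single j 1"

text \<open>The normal monomial of \<open>g\<close> in weight \<open>j * q + r\<close>: a factor
  \<open>X 0\<close> is split off as long as \<open>g\<close> already is a basis vector
  \<open>q\<close> below, and a single variable remains, or 1 in weight 0. Passing the quotient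
  \<open>j\<close> separately makes the recursion primitive.\<close>

primrec nf :: "nat \<Rightarrow> nat \<Rightarrow> ('r \<Rightarrow> 'k) \<Rightarrow> nat \<Rightarrow>\<^sub>0 nat" where
  "nf 0 r g = (if r = 0 then 0 else X (var r g))"
| "nf (Suc j) r g = (if g \<in> B (j * q + r) then X 0 + nf j r g else X (var (Suc j * q + r) g))"

definition nm :: "nat \<Rightarrow> ('r \<Rightarrow> 'k) \<Rightarrow> nat \<Rightarrow>\<^sub>0 nat" where
  "nm w g = nf (w div q) (w mod q) g"

lemma nm_0 [simp]: "nm 0 g = 0"
  by (simp add: nm_def)

lemma nm_small: "0 < w \<Longrightarrow> w < q \<Longrightarrow> nm w g = X (var w g)"
  by (simp add: nm_def)

lemma nm_step: "nm (w + q) g = (if g \<in> B w then X 0 + nm w g else X (var (w + q) g))"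
proof -
  have "(w + q) div q = Suc (w div q)" "(w + q) mod q = w mod q" "w div q * q + w mod q = w"
    "Suc (w div q) * q + w mod q = w + q"
    using q_pos by (simp_all add: ac_simps)
  then show ?thesis unfolding nm_def by (simp only: nf.simps)
qed

lemma nm_new: "\<lbrakk>0 < w; g \<in> B w; q \<le> w \<Longrightarrow> g \<notin> B (w - q)\<rbrakk> \<Longrightarrow> nm w g = X (var w g)"
  using nm_small[of w g] nm_step[of "w - q" g] by (cases "w < q") auto

lemma nm_props:
  "g \<in> B w \<Longrightarrow> keys (nm w g) \<subseteq> {..<N} \<and> weighted_degree wt (nm w g) = w \<and> monval \<rho> (nm w g) = g"
proof (induction w rule: less_induct)
  case (less w)
  show ?case
  proof (cases "w = 0")
    case True
    then show ?thesis using less.prems B_0 by simp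
  next
    case w0: False
    show ?thesis
    proof (cases "q \<le> w \<and> g \<in> B (w - q)")
      case True
      then have w: "w = (w - q) + q" and g: "g \<in> B (w - q)" by auto
      have "nm w g = X 0 + nm (w - q) g" using nm_step[of "w - q" g] w g by simp
      moreover have "w - q < w" using True q_pos by simp
      ultimately show ?thesis using less.IH[of "w - q"] g N_pos wt_0 \<rho>_0 True by (simp add: keys_plus_nat)
    next
      case False
      then show ?thesis using nm_new[of w g] var[of w g] less.prems w0 by simp
    qed
  qed
qed

text \<open>Each variable is its own normal monomial, which settles the case \<open>w = 0\<close> of
  \<open>Red_X_nm\<close>.\<close>

lemma nm_gen: assumes "j < N" shows "nm (wt j) (\<rho> j) = X j"
proof (cases "j = 0")
  case True
  then show ?thesis using nm_step[of 0 1] B_0 wt_0 \<rho>_0 by simp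
next
  case False
  note a = gen[OF assms False]
  have "nm (wt j) (\<rho> j) = X (var (wt j) (\<rho> j))" by (rule nm_new) (use a in blast)+
  then show ?thesis using a by simp
qed

lemma coeffs: "v \<in> V w \<Longrightarrow> \<exists>\<kappa>. v = (\<Sum>g\<in>B w. fscale (\<kappa> g) g)"
  using subsetD[OF B_span[of w], of v] unfolding fv.span_finite[OF finite_B] by (simp add: image_iff)

definition nform :: "nat \<Rightarrow> (('r \<Rightarrow> 'k) \<Rightarrow> 'k) \<Rightarrow> 'k mfps" where
  "nform w \<kappa> = (\<Sum>g\<in>B w. mfps_monom (\<kappa> g) (nm w g))"

lemma nform_ring [simp]: "nform w \<kappa> \<in> mfps_ring N"
  unfolding nform_def using nm_props by (intro mfps_ring_sum mfps_monom_ring) blast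

lemma nform_homogeneous: "mcoeff (nform w \<kappa>) m \<noteq> 0 \<Longrightarrow> weighted_degree wt m = w"
proof (rule ccontr)
  assume nz: "mcoeff (nform w \<kappa>) m \<noteq> 0" and d: "weighted_degree wt m \<noteq> w"
  have "(if m = nm w g then \<kappa> g else 0) = 0" if "g \<in> B w" for g
    using nm_props[OF that] d by auto
  then have "(\<Sum>g\<in>B w. if m = nm w g then \<kappa> g else 0) = 0" by (intro sum.neutral ballI)
  then show False using nz unfolding nform_def mcoeff_sum mcoeff_monom by simp
qed

abbreviation "ev \<equiv> evw N wt \<rho>"

lemma ev_nform: "ev u (nform w \<kappa>) = (if u = w then (\<Sum>g\<in>B w. fscale (\<kappa> g) g) else 0)"
proof -
  have "ev u (nform w \<kappa>) = (\<Sum>g\<in>B w. if u = w then fscale (\<kappa> g) g else 0)"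
    unfolding nform_def evw_sum
  proof (rule sum.cong[OF refl])
    fix g assume g: "g \<in> B w"
    show "ev u (mfps_monom (\<kappa> g) (nm w g)) = (if u = w then fscale (\<kappa> g) g else 0)"
      using evw_monom[of N wt "nm w g" \<rho> u "\<kappa> g", OF wt_pos] nm_props[OF g] by auto
  qed
  then show ?thesis by simp
qed

section \<open>Quadratic rewriting relations\<close>

definition "\<kappa>prod i j = (SOME \<kappa>. \<rho> i * \<rho> j = (\<Sum>g\<in>B (wt i + wt j). fscale (\<kappa> g) g))"

text \<open>The multiplication table of the generators. Quadratic relations suffice because a normal
  monomial is a power of \<open>X 0\<close> times at most one further variable.\<close>

definition rel :: "nat \<Rightarrow> nat \<Rightarrow> 'k mfps" where
  "rel i j = mfps_monom 1 (X i + X j) - nform (wt i + wt j) (\<kappa>prod i j)"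

definition rels :: "'k mfps set" where
  "rels = (\<lambda>(i, j). rel i j) ` ({..<N} \<times> {..<N})"

abbreviation "J \<equiv> mfps_ideal_gen N rels"

lemma finite_rels [simp]: "finite rels"
  unfolding rels_def by simp

lemma relsE:
  assumes "s \<in> rels"
  obtains i j where "i < N" "j < N" "s = rel i j"
  using assms unfolding rels_def by auto

lemma \<rho>_prod: "i < N \<Longrightarrow> j < N \<Longrightarrow> \<rho> i * \<rho> j = (\<Sum>g\<in>B (wt i + wt j). fscale (\<kappa>prod i j g) g)"
proof -
  assume ij: "i < N" "j < N"
  have "\<rho> i \<in> V (wt i)" "\<rho> j \<in> V (wt j)" using \<rho>_B B_V ij by blast+
  from someI_ex[OF coeffs[OF V_mult[OF this]]] show ?thesis unfolding \<kappa>prod_def .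
qed

lemma rel_ring: "i < N \<Longrightarrow> j < N \<Longrightarrow> rel i j \<in> mfps_ring N"
  unfolding rel_def by (intro mfps_ring_closed mfps_monom_ring nform_ring) (simp add: keys_plus_nat)

lemma rel_homogeneous: "mcoeff (rel i j) m \<noteq> 0 \<Longrightarrow> weighted_degree wt m = wt i + wt j"
  using nform_homogeneous[of "wt i + wt j" "\<kappa>prod i j" m]
  by (auto simp: rel_def mcoeff_monom split: if_splits)

lemma ev_rel: "i < N \<Longrightarrow> j < N \<Longrightarrow> ev u (rel i j) = 0"
  using evw_monom[of N wt "X i + X j" \<rho> u 1, OF wt_pos] \<rho>_prod[of i j]
  by (auto simp: rel_def evw_diff ev_nform keys_plus_nat fun_eq_iff)

lemma J_kernel: assumes "f \<in> J" shows "f \<in> mfps_ring N" "ev u f = 0"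
proof -
  obtain c where c: "\<forall>s\<in>rels. c s \<in> mfps_ring N" "f = (\<Sum>s\<in>rels. c s * s)"
    using assms unfolding mfps_ideal_gen_finite[OF finite_rels] by blast
  show "f \<in> mfps_ring N" unfolding c(2)
    using c(1) rel_ring by (intro mfps_ring_sum mfps_ring_closed) (auto simp: rels_def)
  have "ev u (c s * s) = 0" if "s \<in> rels" for s
  proof -
    have "ev v s = 0" for v using that by (elim relsE) (simp add: ev_rel)
    then show ?thesis by (subst evw_mult[of N wt, OF wt_pos]) simp_all
  qed
  then show "ev u f = 0" unfolding c(2) evw_sum by (rule sum.neutral[rule_format])
qed

definition Red :: "nat \<Rightarrow> 'k mfps \<Rightarrow> bool" where
  "Red w f \<longleftrightarrow> (\<exists>\<kappa>. f - nform w \<kappa> \<in> J)"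

lemma nform_add: "nform w \<kappa> + nform w \<kappa>' = nform w (\<lambda>g. \<kappa> g + \<kappa>' g)"
  unfolding nform_def sum.distrib[symmetric] by (simp add: mfps_monom_add)

lemma nform_scale: "mfps_const c * nform w \<kappa> = nform w (\<lambda>g. c * \<kappa> g)"
  unfolding nform_def sum_distrib_left mfps_monom_0[symmetric] mfps_monom_mult by simp

lemma nform_zero: "nform w (\<lambda>_. 0) = 0"
  unfolding nform_def by simp

lemma Red_0: "Red w 0"
  unfolding Red_def using nform_zero mfps_ideal_gen_0[OF finite_rels] by (metis diff_self)

lemma Red_add: assumes "Red w f" "Red w g" shows "Red w (f + g)"
proof -
  obtain \<kappa> \<kappa>' where "f - nform w \<kappa> \<in> J" "g - nform w \<kappa>' \<in> J" using assms unfolding Red_def by blast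
  then have "(f - nform w \<kappa>) + (g - nform w \<kappa>') \<in> J" by (rule mfps_ideal_gen_add[OF finite_rels])
  then have "f + g - nform w (\<lambda>g. \<kappa> g + \<kappa>' g) \<in> J"
    unfolding nform_add[symmetric] by (simp add: algebra_simps)
  then show ?thesis unfolding Red_def by blast
qed

lemma Red_scale: assumes "Red w f" shows "Red w (mfps_const c * f)"
proof -
  obtain \<kappa> where "f - nform w \<kappa> \<in> J" using assms unfolding Red_def by blast
  then have "mfps_const c * (f - nform w \<kappa>) \<in> J" by (rule mfps_ideal_gen_mult[OF finite_rels]) simp
  then show ?thesis unfolding Red_def right_diff_distrib nform_scale by blast
qed

lemma Red_sum: "(\<And>i. i \<in> I \<Longrightarrow> Red w (f i)) \<Longrightarrow> Red w (\<Sum>i\<in>I. f i)"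
  by (induction I rule: infinite_finite_induct) (simp_all add: Red_0 Red_add)

lemma Red_J: assumes "f \<in> J" shows "Red w f"
  unfolding Red_def using assms nform_zero by (intro exI[of _ "\<lambda>_. 0"]) simp

lemma Red_nm: assumes "g \<in> B w" shows "Red w (mfps_monom 1 (nm w g))"
proof -
  have "nform w (\<lambda>h. if h = g then 1 else 0) = (\<Sum>h\<in>B w. if h = g then mfps_monom 1 (nm w g) else 0)"
    unfolding nform_def by (rule sum.cong) auto
  also have "\<dots> = mfps_monom 1 (nm w g)" using assms by simp
  finally show ?thesis
    unfolding Red_def using mfps_ideal_gen_0[OF finite_rels] by (metis diff_self)
qed

lemma nform_sum: "nform w \<kappa> = (\<Sum>g\<in>B w. mfps_const (\<kappa> g) * mfps_monom 1 (nm w g))"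
  unfolding nform_def mfps_monom_0[symmetric] mfps_monom_mult by simp

lemma Red_mult:
  assumes "Red w f" "h \<in> mfps_ring N" "\<And>g. g \<in> B w \<Longrightarrow> Red v (h * mfps_monom 1 (nm w g))"
  shows "Red v (h * f)"
proof -
  obtain \<kappa> where \<kappa>: "f - nform w \<kappa> \<in> J" using assms(1) unfolding Red_def by blast
  have "Red v (h * (f - nform w \<kappa>))"
    by (rule Red_J, rule mfps_ideal_gen_mult[OF finite_rels \<kappa> assms(2)])
  moreover have "Red v (\<Sum>g\<in>B w. mfps_const (\<kappa> g) * (h * mfps_monom 1 (nm w g)))"
    by (intro Red_sum Red_scale assms(3))
  ultimately have "Red v (h * (f - nform w \<kappa>) + (\<Sum>g\<in>B w. mfps_const (\<kappa> g) * (h * mfps_monom 1 (nm w g))))"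
    by (rule Red_add)
  also have "h * (f - nform w \<kappa>) + (\<Sum>g\<in>B w. mfps_const (\<kappa> g) * (h * mfps_monom 1 (nm w g))) = h * f"
    unfolding nform_sum by (simp add: right_diff_distrib sum_distrib_left mult.left_commute)
  finally show ?thesis .
qed

lemma X_ring: "j < N \<Longrightarrow> mfps_monom 1 (X j) \<in> (mfps_ring N :: 'k mfps set)"
  by (rule mfps_monom_ring) simp

text \<open>Normal monomials stay normal under \<open>X 0\<close>, since a vector of
  \<open>B w\<close> remains a basis vector in \<open>B (w + q)\<close>.\<close>

lemma Red_shift: assumes "Red w f" shows "Red (w + q) (mfps_monom 1 (X 0) * f)"
proof (rule Red_mult[OF assms])
  show "mfps_monom 1 (X 0) \<in> (mfps_ring N :: 'k mfps set)" using X_ring N_pos by blast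
  fix g assume g: "g \<in> B w"
  then have "nm (w + q) g = X 0 + nm w g" by (simp add: nm_step)
  then show "Red (w + q) (mfps_monom 1 (X 0) * mfps_monom 1 (nm w g))"
    using Red_nm[of g "w + q"] g B_mono by (auto simp: mfps_monom_mult)
qed

text \<open>Factors \<open>X 0\<close> of the normal monomial are stripped by induction and restored
  by \<open>Red_shift\<close>. In the end a single variable is left, whose product with
  \<open>X j\<close> is rewritten by \<open>rel\<close>, or 1, and \<open>X j\<close> itself is
  normal.\<close>

lemma Red_X_nm: "j < N \<Longrightarrow> g \<in> B w \<Longrightarrow> Red (wt j + w) (mfps_monom 1 (X j) * mfps_monom 1 (nm w g))"
proof (induction w rule: less_induct)
  case (less w)
  show ?case
  proof (cases "w = 0")
    case True
    then show ?thesis using Red_nm[OF \<rho>_B[OF less.prems(1)]] nm_gen[OF less.prems(1)]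
      by (simp add: mfps_monom_mult)
  next
    case w0: False
    show ?thesis
    proof (cases "q \<le> w \<and> g \<in> B (w - q)")
      case True
      then have w: "w = (w - q) + q" and g: "g \<in> B (w - q)" by auto
      have nm: "nm w g = X 0 + nm (w - q) g" using nm_step[of "w - q" g] w g by simp
      have "w - q < w" using True q_pos by simp
      then have "Red (wt j + (w - q)) (mfps_monom 1 (X j) * mfps_monom 1 (nm (w - q) g))"
        using less g by blast
      from Red_shift[OF this] show ?thesis
        using w True unfolding nm mfps_monom_mult by (simp add: ac_simps)
    next
      case False
      then have v: "var w g < N" "wt (var w g) = w" "nm w g = X (var w g)"
        using nm_new[of w g] var[of w g] less.prems w0 by auto
      then have "rel j (var w g) \<in> J"
        using less.prems by (intro mfps_ideal_gen_base) (auto simp: rels_def)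
      then show ?thesis unfolding Red_def rel_def using v by (auto simp: mfps_monom_mult)
    qed
  qed
qed

lemma Red_X: "j < N \<Longrightarrow> Red w f \<Longrightarrow> Red (wt j + w) (mfps_monom 1 (X j) * f)"
  by (rule Red_mult[OF _ X_ring Red_X_nm]) assumption+

lemma Red_monomial: "keys m \<subseteq> {..<N} \<Longrightarrow> Red (weighted_degree wt m) (mfps_monom 1 m)"
proof (induction rule: monomial_induct)
  case zero
  then show ?case using Red_nm[of 1 0] B_0 by simp
next
  case (plus m j)
  from Red_X[OF plus(1,3)] show ?case by (simp add: mfps_monom_mult ac_simps)
qed

lemma Red_part: assumes "f \<in> mfps_ring N" shows "Red u (mfps_part wt u f)"
proof -
  have "mfps_part wt u f = (\<Sum>m\<in>monomials N wt u. mfps_monom (mcoeff (mfps_part wt u f) m) m)"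
    by (rule finite_support_expand[OF finite_monomials[OF wt_pos]])
      (use assms in \<open>auto simp: mcoeff_part mfps_ring_iff monomials_def\<close>)
  also have "\<dots> = (\<Sum>m\<in>monomials N wt u. mfps_const (mcoeff (mfps_part wt u f) m) * mfps_monom 1 m)"
    unfolding mfps_monom_0[symmetric] mfps_monom_mult by simp
  finally have e: "mfps_part wt u f
      = (\<Sum>m\<in>monomials N wt u. mfps_const (mcoeff (mfps_part wt u f) m) * mfps_monom 1 m)" .
  show ?thesis
    by (subst e, intro Red_sum Red_scale) (use Red_monomial in \<open>auto simp: monomials_def\<close>)
qed

text \<open>Each homogeneous part of a kernel element is congruent modulo \<open>J\<close> to a
  combination of normal monomials. Its value is the same combination of independent basis vectors,
  so all coefficients vanish.\<close>

lemma kernel_quasihomogeneous: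
  "quasihomogeneous_ideal N wt {f \<in> mfps_ring N. \<forall>u. ev u f = 0}"
proof -
  have "{f \<in> mfps_ring N. \<forall>u. ev u f = 0} = J"
  proof (intro equalityI subsetI)
    fix f assume "f \<in> {f \<in> mfps_ring N. \<forall>u. ev u f = 0}"
    then have f: "f \<in> mfps_ring N" "\<And>u. ev u f = 0" by auto
    have parts: "mfps_part wt u f \<in> J" for u
    proof -
      obtain \<kappa> where \<kappa>: "mfps_part wt u f - nform u \<kappa> \<in> J" using Red_part[OF f(1), of u] unfolding Red_def by blast
      have "ev u (mfps_part wt u f - nform u \<kappa>) = 0" by (rule J_kernel(2)[OF \<kappa>])
      then have "(\<Sum>g\<in>B u. fscale (\<kappa> g) g) = 0" by (simp add: evw_diff ev_nform evw_part f(2))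
      then have "\<kappa> g = 0" if "g \<in> B u" for g
        using fv.independentD[OF B_indep finite_B subset_refl] that by blast
      then have "nform u \<kappa> = 0" unfolding nform_def by simp
      then show ?thesis using \<kappa> by simp
    qed
    have "\<forall>s. \<exists>d. s \<in> rels \<longrightarrow> (\<forall>m. mcoeff s m \<noteq> 0 \<longrightarrow> weighted_degree wt m = d)"
    proof
      fix s
      show "\<exists>d. s \<in> rels \<longrightarrow> (\<forall>m. mcoeff s m \<noteq> 0 \<longrightarrow> weighted_degree wt m = d)"
      proof (cases "s \<in> rels")
        case True
        then obtain i j where "s = rel i j" by (rule relsE)
        then show ?thesis using rel_homogeneous[of i j] by blast
      qed simp
    qed
    then obtain d where "\<forall>s. s \<in> rels \<longrightarrow> (\<forall>m. mcoeff s m \<noteq> 0 \<longrightarrow> weighted_degree wt m = d s)"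
      unfolding choice_iff by (rule exE)
    then have "s \<in> rels \<Longrightarrow> mcoeff s m \<noteq> 0 \<Longrightarrow> weighted_degree wt m = d s" for s m by simp
    then show "f \<in> J" by (rule homogeneous_parts_in_ideal[OF finite_rels _ parts])
  next
    fix f assume "f \<in> J"
    then show "f \<in> {f \<in> mfps_ring N. \<forall>u. ev u f = 0}" using J_kernel by blast
  qed
  moreover have "rels \<subseteq> mfps_ring N" using rel_ring by (auto simp: rels_def)
  moreover have "weighted_homogeneous_polynomial wt s" if "s \<in> rels" for s
  proof -
    obtain i j where s: "i < N" "j < N" "s = rel i j" using \<open>s \<in> rels\<close> by (rule relsE)
    have "{m. mcoeff s m \<noteq> 0} \<subseteq> monomials N wt (wt i + wt j)"
      using rel_ring rel_homogeneous s by (auto simp: monomials_def mfps_ring_def)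
    then have "finite {m. mcoeff s m \<noteq> 0}"
      by (rule finite_subset) (rule finite_monomials[of N wt, OF wt_pos])
    then show ?thesis unfolding weighted_homogeneous_polynomial_def
      using rel_homogeneous[of i j] s(3) by blast
  qed
  ultimately show ?thesis unfolding quasihomogeneous_ideal_def
    by (intro exI[of _ rels] conjI ballI)
qed

lemma ev_surjective:
  assumes "\<And>u. v u \<in> V u"
  shows "\<exists>f\<in>mfps_ring N. \<forall>u. ev u f = v u"
proof -
  have "\<forall>u. \<exists>\<kappa>. v u = (\<Sum>g\<in>B u. fscale (\<kappa> g) g)" using coeffs assms by blast
  then obtain \<kappa> where \<kappa>: "\<forall>u. v u = (\<Sum>g\<in>B u. fscale (\<kappa> u g) g)" unfolding choice_iff by (rule exE)
  \<comment> \<open>The normal forms of all weights are glued into one series: each monomial takes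
    its coefficient from the form of its own weight.\<close>
  define f where "f = Abs_mfps (\<lambda>m. mcoeff (nform (weighted_degree wt m) (\<kappa> (weighted_degree wt m))) m)"
  have f: "mcoeff f m = mcoeff (nform (weighted_degree wt m) (\<kappa> (weighted_degree wt m))) m" for m
    by (simp add: f_def Abs_mfps_inverse)
  have "f \<in> mfps_ring N" using nform_ring by (simp add: mfps_ring_iff f)
  moreover have "mfps_part wt u f = nform u (\<kappa> u)" for u
    by (rule mfps_eqI) (use nform_homogeneous in \<open>auto simp: mcoeff_part f\<close>)
  then have "ev u f = v u" for u
    using evw_part[of N wt \<rho> u u f] \<kappa> by (simp add: ev_nform)
  ultimately show ?thesis by blast
qed

lemma ev_monomial_V: "keys m \<subseteq> {..<N} \<Longrightarrow> monval \<rho> m \<in> V (weighted_degree wt m)"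
proof (induction rule: monomial_induct)
  case (plus m j)
  have "\<rho> j \<in> V (wt j)" using \<rho>_B[OF plus(1)] B_V by blast
  from V_mult[OF plus(3) this] show ?case
    by (simp only: monval_add monval_single weighted_degree_add weighted_degree_single One_nat_def mult_1_right
        mult_Suc_right mult_0_right add_0_right)
qed (simp only: monval_0 weighted_degree_0 one_0)

lemma ev_V: "ev u f \<in> V u"
  unfolding evw_def
  by (intro fv.subspace_sum[OF V_sub] fv.subspace_scale[OF V_sub])
    (use ev_monomial_V in \<open>auto simp: monomials_def\<close>)

end

context graded_vectors
begin

theorem graded_presentation:
  "\<exists>N wt \<rho>. (\<forall>j<N. wt j > 0) \<and> (\<forall>u f. evw N wt \<rho> u f \<in> V u) \<and>
     (\<forall>v. (\<forall>u. v u \<in> V u) \<longrightarrow> (\<exists>f\<in>mfps_ring N. \<forall>u. evw N wt \<rho> u f = v u)) \<and>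
     quasihomogeneous_ideal N wt {f \<in> mfps_ring N. \<forall>u. evw N wt \<rho> u f = 0}"
proof -
  obtain B where "(\<forall>w. B w \<subseteq> V w \<and> fv.independent (B w) \<and> V w \<subseteq> fv.span (B w)) \<and> B 0 = {1} \<and>
      (\<forall>w. B w \<subseteq> B (w + q))"
    using ex_bases by (rule exE)
  then have B: "\<And>w. B w \<subseteq> V w" "\<And>w. fv.independent (B w)" "\<And>w. V w \<subseteq> fv.span (B w)"
      "B 0 = {1}" "\<And>w. B w \<subseteq> B (w + q)"
    by simp_all
  define I where "I = {(w, g). 0 < w \<and> g \<in> B w \<and> (q \<le> w \<longrightarrow> g \<notin> B (w - q))}"
  \<comment> \<open>From weight \<open>2 * q\<close> on, \<open>V w\<close> lies in
    \<open>V (w - q)\<close>, which is spanned by \<open>B (w - q)\<close>. Independence leaves no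
    room for a new vector, so there are only finitely many variables.\<close>
  have "w < 2 * q" if "(w, g) \<in> I" for w g
  proof (rule ccontr)
    assume n: "\<not> w < 2 * q"
    then have w: "q \<le> w - q" "w = (w - q) + q" by auto
    have g: "g \<in> B w" "g \<notin> B (w - q)" using that n by (auto simp: I_def)
    have "g \<in> V (w - q)" using g(1) B(1)[of w] stab[OF w(1)] w(2) by auto
    then have "g \<in> fv.span (B (w - q))" using B(3) by blast
    moreover have "B (w - q) \<subseteq> B w - {g}" using B(5)[of "w - q"] g w(2) by auto
    ultimately have "g \<in> fv.span (B w - {g})" using fv.span_mono by blast
    then show False using B(2)[of w] g(1) unfolding fv.dependent_def by blast
  qed
  then have "I \<subseteq> (SIGMA w : {..<2 * q}. B w)" by (auto simp: I_def)
  then have finI: "finite I" by (rule finite_subset) (intro finite_SigmaI finite_lessThan finite_independent B(2))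
  obtain h where h: "bij_betw h {0..<card I} I" using ex_bij_betw_nat_finite[OF finI] by blast
  \<comment> \<open>Index 0 is reserved for the element of weight \<open>q\<close>, so the
    enumeration \<open>h\<close> is shifted by one.\<close>
  define wt where "wt j = (case j of 0 \<Rightarrow> q | Suc i \<Rightarrow> fst (h i))" for j
  define \<rho> where "\<rho> j = (case j of 0 \<Rightarrow> 1 | Suc i \<Rightarrow> snd (h i))" for j
  define var where "var w g = Suc (inv_into {0..<card I} h (w, g))" for w g
  interpret graded_generators V q B "Suc (card I)" wt \<rho> var
  proof unfold_locales
    fix w g assume a: "0 < w" "g \<in> B w" "q \<le> w \<Longrightarrow> g \<notin> B (w - q)"
    then have i: "(w, g) \<in> I" by (auto simp: I_def)
    have "inv_into {0..<card I} h (w, g) \<in> {0..<card I}" "h (inv_into {0..<card I} h (w, g)) = (w, g)"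
      using i h by (metis bij_betw_imp_surj_on inv_into_into, metis bij_betw_inv_into_right)
    then show "var w g < Suc (card I) \<and> wt (var w g) = w \<and> \<rho> (var w g) = g"
      by (simp add: var_def wt_def \<rho>_def)
  next
    fix j assume "j < Suc (card I)" "j \<noteq> 0"
    then obtain i where j: "j = Suc i" "i < card I" by (cases j) auto
    have "h i \<in> I" using h j by (auto simp: bij_betw_def)
    moreover have "inv_into {0..<card I} h (h i) = i" using h j by (auto simp: bij_betw_def)
    ultimately show "0 < wt j \<and> \<rho> j \<in> B (wt j) \<and> (q \<le> wt j \<longrightarrow> \<rho> j \<notin> B (wt j - q)) \<and> var (wt j) (\<rho> j) = j"
      by (auto simp: j wt_def \<rho>_def var_def I_def)
  qed (use B in \<open>auto simp: wt_def \<rho>_def\<close>)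
  show ?thesis
    by (intro exI[of _ "Suc (card I)"] exI[of _ wt] exI[of _ \<rho>] conjI allI impI wt_pos ev_V
        ev_surjective kernel_quasihomogeneous) simp_all
qed

end

subsection \<open>Graded curves are quasihomogeneous\<close>

definition weight_comp :: "('r \<Rightarrow> nat) \<Rightarrow> nat \<Rightarrow> ('r \<Rightarrow> 'k::zero fps) \<Rightarrow> 'r \<Rightarrow> 'k fps" where
  "weight_comp d w f = (\<lambda>i. Abs_fps (\<lambda>n. if n * d i = w then f i $ n else 0))"

lemma weight_comp_nth: "weight_comp d w f i $ n = (if n * d i = w then f i $ n else 0)"
  by (simp add: weight_comp_def)

text \<open>To be applied to the embedding \<open>\<psi>\<close> after a change of the parameters,
  with \<open>d i\<close> as the weight of the new \<open>i\<close>-th parameter.\<close>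

locale graded_curve =
  fixes \<iota> :: "'k::field \<Rightarrow> 'a::comm_ring_1" and \<sigma> :: "'a \<Rightarrow> 'r::finite \<Rightarrow> 'k fps"
    and d :: "'r \<Rightarrow> nat" and D :: nat
  assumes \<sigma>_add: "\<sigma> (a + b) = \<sigma> a + \<sigma> b" and \<sigma>_mult: "\<sigma> (a * b) = \<sigma> a * \<sigma> b"
    and \<sigma>_const: "\<sigma> (\<iota> c) = (\<lambda>_. fps_const c)" and \<sigma>_inj: "inj \<sigma>"
    and \<sigma>_conductor: "ord_ge D f \<Longrightarrow> f \<in> range \<sigma>"
    and \<sigma>_local: "\<exists>c. \<forall>i. \<sigma> a i $ 0 = c"
    and d_pos: "d i > 0"
    and \<sigma>_graded: "f \<in> range \<sigma> \<Longrightarrow> weight_comp d w f \<in> range \<sigma>"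
begin

lemma range_add: "f \<in> range \<sigma> \<Longrightarrow> g \<in> range \<sigma> \<Longrightarrow> f + g \<in> range \<sigma>"
  using \<sigma>_add by (metis (no_types, lifting) imageE rangeI)

lemma range_mult: "f \<in> range \<sigma> \<Longrightarrow> g \<in> range \<sigma> \<Longrightarrow> f * g \<in> range \<sigma>"
  using \<sigma>_mult by (metis (no_types, lifting) imageE rangeI)

lemma range_const: "(\<lambda>_. fps_const c) \<in> range \<sigma>"
  using \<sigma>_const by (metis rangeI)

lemma range_0: "0 \<in> range \<sigma>"
  using range_const[of 0] by (simp add: zero_fun_def)

lemma range_sum: "(\<And>i. i \<in> I \<Longrightarrow> f i \<in> range \<sigma>) \<Longrightarrow> (\<Sum>i\<in>I. f i) \<in> range \<sigma>"
  by (induction I rule: infinite_finite_induct) (simp_all only: sum.infinite sum.empty sum.insert range_0 range_add insert_iff simp_thms)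

text \<open>If \<open>d i\<close> does not divide \<open>w\<close>, the rounded exponent has no
  meaning; \<open>V\<close> then forces \<open>v i = 0\<close>.\<close>

definition emb :: "nat \<Rightarrow> ('r \<Rightarrow> 'k) \<Rightarrow> 'r \<Rightarrow> 'k fps" where
  "emb w v = (\<lambda>i. fps_const (v i) * fps_X ^ (w div d i))"

definition V :: "nat \<Rightarrow> ('r \<Rightarrow> 'k) set" where
  "V w = {v. (\<forall>i. v i \<noteq> 0 \<longrightarrow> d i dvd w) \<and> emb w v \<in> range \<sigma>}"

text \<open>A multiple of every \<open>d i\<close> for which \<open>q div d i\<close> reaches the
  conductor order \<open>D\<close> on each branch; \<open>Suc\<close> keeps it positive when
  \<open>D\<close> is 0.\<close>

definition q :: nat where "q = Suc D * (\<Prod>i\<in>UNIV. d i)"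

lemma V_support: "v \<in> V w \<Longrightarrow> v i \<noteq> 0 \<Longrightarrow> d i dvd w"
  by (simp add: V_def)

lemma V_emb: "v \<in> V w \<Longrightarrow> emb w v \<in> range \<sigma>"
  by (simp add: V_def)

lemma emb_nth: "v \<in> V w \<Longrightarrow> emb w v i $ n = (if n * d i = w then v i else 0)"
  using V_support[of v w i] d_pos[of i]
  by (cases "v i = 0") (auto simp: emb_def fps_X_power_nth)

lemma prod_split: "(\<Prod>j\<in>UNIV. d j) = d i * (\<Prod>j\<in>UNIV - {i}. d j)"
  by (simp add: prod.remove)

lemma d_dvd_q: "d i dvd q"
  unfolding q_def by (subst prod_split[of i]) simp

lemma q_pos: "q > 0"
  unfolding q_def using d_pos by (simp add: prod_pos)

lemma q_div: "D \<le> q div d i"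
proof -
  have "q = d i * (Suc D * (\<Prod>j\<in>UNIV - {i}. d j))"
    unfolding q_def by (subst prod_split[of i]) (simp only: ac_simps)
  then have "q div d i = Suc D * (\<Prod>j\<in>UNIV - {i}. d j)"
    using d_pos[of i] by (metis nonzero_mult_div_cancel_left less_numeral_extra(3))
  moreover have "(\<Prod>j\<in>UNIV - {i}. d j) \<ge> 1"
    using d_pos by (simp add: Suc_le_eq prod_pos)
  ultimately have "Suc D * 1 \<le> q div d i" using mult_le_mono2 by metis
  then show ?thesis by simp
qed

sublocale graded_vectors V q
proof
  fix w
  show "fv.subspace (V w)"
  proof (rule fv.subspaceI)
    have "emb w 0 = 0" by (simp add: emb_def fun_eq_iff)
    then show "0 \<in> V w" using range_0 by (simp add: V_def)
    show "u + v \<in> V w" if uv: "u \<in> V w" "v \<in> V w" for u v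
    proof -
      have "emb w (u + v) = emb w u + emb w v"
        by (simp add: emb_def fun_eq_iff distrib_right flip: fps_const_add)
      then have "emb w (u + v) \<in> range \<sigma>" using range_add V_emb uv by metis
      moreover have "d i dvd w" if "(u + v) i \<noteq> 0" for i
        using that V_support[OF uv(1), of i] V_support[OF uv(2), of i] by (cases "u i = 0") auto
      ultimately show ?thesis by (simp add: V_def)
    qed
    show "fscale c v \<in> V w" if v: "v \<in> V w" for c v
    proof -
      have "emb w (fscale c v) = (\<lambda>_. fps_const c) * emb w v"
        by (simp add: emb_def fun_eq_iff mult.assoc flip: fps_const_mult)
      then have "emb w (fscale c v) \<in> range \<sigma>" using range_mult[OF range_const V_emb[OF v]] by metis
      moreover have "d i dvd w" if "fscale c v i \<noteq> 0" for i
        using that V_support[OF v, of i] by auto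
      ultimately show ?thesis by (simp add: V_def)
    qed
  qed
next
  fix f g :: "'r \<Rightarrow> 'k" and a b
  assume f: "f \<in> V a" and g: "g \<in> V b"
  have "emb a f i * emb b g i = emb (a + b) (f * g) i" for i
  proof (cases "f i = 0 \<or> g i = 0")
    case True
    then show ?thesis by (auto simp: emb_def)
  next
    case False
    then have "(a + b) div d i = a div d i + b div d i"
      using V_support[OF f, of i] by (simp add: div_plus_div_distrib_dvd_left)
    then show ?thesis by (simp add: emb_def power_add ac_simps flip: fps_const_mult)
  qed
  then have "emb (a + b) (f * g) = emb a f * emb b g" by (simp add: fun_eq_iff)
  then have "emb (a + b) (f * g) \<in> range \<sigma>" using range_mult[OF V_emb[OF f] V_emb[OF g]] by metis
  moreover have "d i dvd a + b" if "(f * g) i \<noteq> 0" for i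
    using that V_support[OF f, of i] V_support[OF g, of i] by auto
  ultimately show "f * g \<in> V (a + b)" by (simp add: V_def)
next
  show "V 0 \<subseteq> range (\<lambda>c _. c)"
  proof
    fix v assume v: "v \<in> V 0"
    then obtain a where a: "emb 0 v = \<sigma> a" using V_emb by blast
    obtain c where c: "\<And>i. \<sigma> a i $ 0 = c" using \<sigma>_local[of a] by blast
    have "v i = c" for i using c[of i] unfolding a[symmetric] by (simp add: emb_def)
    then show "v \<in> range (\<lambda>c _. c)" by (intro image_eqI[of _ _ c]) auto
  qed
  have "emb 0 1 = (\<lambda>_. fps_const 1)" by (simp add: emb_def fun_eq_iff)
  then show "1 \<in> V 0" using range_const[of 1] by (simp add: V_def)
  have "ord_ge D (emb q 1)"
    unfolding ord_ge_def
  proof (intro allI impI)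
    fix i k assume "k < D"
    then have "k \<noteq> q div d i" using q_div[of i] by simp
    then show "emb q 1 i $ k = 0" by (simp add: emb_def fps_X_power_nth)
  qed
  then show "1 \<in> V q" using \<sigma>_conductor d_dvd_q by (simp add: V_def)
  show "q > 0" by (rule q_pos)
next
  fix w assume w: "q \<le> w"
  show "V (w + q) \<subseteq> V w"
  proof
    fix v assume v: "v \<in> V (w + q)"
    have "d i dvd w" if "v i \<noteq> 0" for i
      using V_support[OF v that] d_dvd_q[of i] by (simp add: dvd_add_left_iff)
    moreover have "ord_ge D (emb w v)"
      unfolding ord_ge_def
    proof (intro allI impI)
      fix i k assume "k < D"
      moreover have "q div d i \<le> w div d i" using w by (rule div_le_mono)
      ultimately have "k \<noteq> w div d i" using q_div[of i] by simp
      then show "emb w v i $ k = 0" by (simp add: emb_def fps_X_power_nth)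
    qed
    ultimately show "v \<in> V w" using \<sigma>_conductor by (simp add: V_def)
  qed
qed

text \<open>All terms of order below \<open>D\<close> have weight less than \<open>W\<close>, so
  subtracting finitely many components leaves an element of the conductor.\<close>

lemma range_from_comps:
  assumes "\<And>w. weight_comp d w f \<in> range \<sigma>"
  shows "f \<in> range \<sigma>"
proof -
  define W where "W = D * (\<Sum>i\<in>UNIV. d i)"
  let ?g = "\<Sum>w<W. weight_comp d w f"
  have g: "?g i $ n = (if n * d i < W then f i $ n else 0)" for i n
    by (simp add: sum_fun_apply fps_sum_nth weight_comp_nth)
  have "ord_ge D (f - ?g)"
    unfolding ord_ge_def
  proof (intro allI impI)
    fix i k assume k: "k < D"
    have "k * d i < D * d i" using k d_pos by simp
    also have "\<dots> \<le> W" unfolding W_def by (intro mult_le_mono2 member_le_sum) auto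
    finally show "(f - ?g) i $ k = 0" using g by simp
  qed
  then have "f - ?g \<in> range \<sigma>" by (rule \<sigma>_conductor)
  moreover have "?g \<in> range \<sigma>" by (intro range_sum assms)
  ultimately have "(f - ?g) + ?g \<in> range \<sigma>" by (rule range_add)
  then show ?thesis by simp
qed

theorem quasihomogeneous: "quasihomogeneous \<iota>"
proof -
  obtain N wt \<rho> where "(\<forall>j<N. wt j > 0) \<and> (\<forall>u f. evw N wt \<rho> u f \<in> V u) \<and>
     (\<forall>v. (\<forall>u. v u \<in> V u) \<longrightarrow> (\<exists>f\<in>mfps_ring N. \<forall>u. evw N wt \<rho> u f = v u)) \<and>
     quasihomogeneous_ideal N wt {f \<in> mfps_ring N. \<forall>u. evw N wt \<rho> u f = 0}"
    using graded_presentation by (elim exE)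
  then have wt: "\<And>j. j < N \<Longrightarrow> wt j > 0" and evV: "\<And>u f. evw N wt \<rho> u f \<in> V u"
    and surj: "\<And>v. (\<And>u. v u \<in> V u) \<Longrightarrow> \<exists>f\<in>mfps_ring N. \<forall>u. evw N wt \<rho> u f = v u"
    and ker: "quasihomogeneous_ideal N wt {f \<in> mfps_ring N. \<forall>u. evw N wt \<rho> u f = 0}"
    by simp_all
  let ?ev = "evw N wt \<rho>"
  have ev_zero: "?ev u f i = 0" if "\<not> d i dvd u" for u f i
    using V_support[OF evV] that by blast
  \<comment> \<open>The values in all weights are assembled into power series: on branch
    \<open>i\<close> the power \<open>fps_X ^ n\<close> has weight \<open>n * d i\<close>.\<close>
  define E where "E f = (\<lambda>i. Abs_fps (\<lambda>n. ?ev (n * d i) f i))" for f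
  have E: "E f i $ n = ?ev (n * d i) f i" for f i n by (simp add: E_def)
  have E_range: "E f \<in> range \<sigma>" for f
  proof (rule range_from_comps)
    fix w
    have "weight_comp d w (E f) = emb w (?ev w f)"
      by (intro ext fps_ext) (simp add: weight_comp_nth E emb_nth[OF evV])
    then show "weight_comp d w (E f) \<in> range \<sigma>" using V_emb[OF evV] by metis
  qed
  define \<pi> where "\<pi> f = inv \<sigma> (E f)" for f
  have \<pi>: "\<sigma> (\<pi> f) = E f" for f unfolding \<pi>_def by (rule f_inv_into_f[OF E_range])
  have \<pi>I: "\<pi> f = a" if "E f = \<sigma> a" for f a using that \<pi> \<sigma>_inj by (metis injD)
  have \<sigma>_0: "\<sigma> 0 = 0" using \<sigma>_add[of 0 0] by simp
  have "algebra_epimorphism \<iota> N \<pi>"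
    unfolding algebra_epimorphism_def
  proof (intro conjI allI ballI)
    fix c
    show "\<pi> (mfps_const c) = \<iota> c"
    proof (rule \<pi>I, intro ext fps_ext)
      fix i n
      have "E (mfps_const c) i $ n = (if 0 = n * d i then fscale c 1 else 0) i"
        using evw_monom[of N wt 0 \<rho> "n * d i" c, OF wt] by (simp add: E mfps_monom_0)
      then show "E (mfps_const c) i $ n = \<sigma> (\<iota> c) i $ n"
        using d_pos[of i] by (simp add: \<sigma>_const)
    qed
  next
    fix f g
    show "\<pi> (f + g) = \<pi> f + \<pi> g"
      by (rule \<pi>I) (simp add: \<sigma>_add \<pi> fun_eq_iff fps_eq_iff E evw_add)
    show "\<pi> (f * g) = \<pi> f * \<pi> g"
    proof (rule \<pi>I, intro ext fps_ext)
      fix i n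
      let ?t = "\<lambda>v. ?ev v f i * ?ev (n * d i - v) g i"
      have "E (f * g) i $ n = (\<Sum>v\<le>n * d i. ?t v)"
        unfolding E by (subst evw_mult[of N wt, OF wt]) (simp_all add: sum_fun_apply)
      \<comment> \<open>On branch \<open>i\<close> only weights divisible by \<open>d i\<close>
        contribute, which turns the convolution over weights into the Cauchy product.\<close>
      also have "\<dots> = (\<Sum>v\<in>(\<lambda>k. k * d i) ` {..n}. ?t v)"
      proof (rule sum.mono_neutral_right)
        show "\<forall>v\<in>{..n * d i} - (\<lambda>k. k * d i) ` {..n}. ?t v = 0"
        proof
          fix v assume v: "v \<in> {..n * d i} - (\<lambda>k. k * d i) ` {..n}"
          have "\<not> d i dvd v"
          proof
            assume "d i dvd v"
            then obtain k where k: "v = k * d i" by (metis dvd_def mult.commute)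
            then have "k \<le> n" using v d_pos[of i] by simp
            then show False using v k by blast
          qed
          then show "?t v = 0" using ev_zero by simp
        qed
      qed (use d_pos in auto)
      also have "\<dots> = (\<Sum>k\<le>n. ?t (k * d i))"
        using d_pos[of i] by (subst sum.reindex) (auto simp: inj_on_def)
      also have "\<dots> = (E f i * E g i) $ n"
        unfolding fps_mult_nth E atMost_atLeast0 by (simp add: diff_mult_distrib)
      finally show "E (f * g) i $ n = \<sigma> (\<pi> f * \<pi> g) i $ n" by (simp add: \<sigma>_mult \<pi>)
    qed
  next
    show "\<pi> ` mfps_ring N = UNIV"
    proof (intro equalityI subsetI UNIV_I)
      fix a
      define v where "v w i = (if d i dvd w then \<sigma> a i $ (w div d i) else 0)" for w i
      have "emb w (v w) = weight_comp d w (\<sigma> a)" for w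
      proof (intro ext fps_ext)
        fix i n
        have "n * d i = w \<longleftrightarrow> d i dvd w \<and> n = w div d i" using d_pos[of i] by auto
        then show "emb w (v w) i $ n = weight_comp d w (\<sigma> a) i $ n"
          by (simp add: emb_def v_def weight_comp_nth fps_X_power_nth)
      qed
      then have "v w \<in> V w" for w
        using \<sigma>_graded[of "\<sigma> a" w] by (auto simp: V_def v_def)
      then obtain f where f: "f \<in> mfps_ring N" "\<And>u. ?ev u f = v u" using surj by blast
      have "E f = \<sigma> a" using d_pos by (intro ext fps_ext) (simp add: E f(2) v_def)
      then show "a \<in> \<pi> ` mfps_ring N" using \<pi>I f(1) by (intro image_eqI[of _ _ f]) auto
    qed
  qed
  moreover have "{f \<in> mfps_ring N. \<pi> f = 0} = {f \<in> mfps_ring N. \<forall>u. ?ev u f = 0}"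
  proof -
    have "\<pi> f = 0 \<longleftrightarrow> (\<forall>u. ?ev u f = 0)" for f
    proof
      assume "\<pi> f = 0"
      then have E0: "E f = 0" using \<pi>[of f] \<sigma>_0 by simp
      have "?ev u f i = 0" for u i
      proof (cases "d i dvd u")
        case True
        then show ?thesis using E[of f i "u div d i"] E0 by simp
      qed (rule ev_zero)
      then show "\<forall>u. ?ev u f = 0" by (simp add: fun_eq_iff)
    next
      assume "\<forall>u. ?ev u f = 0"
      then have "E f = \<sigma> 0" unfolding \<sigma>_0 by (intro ext fps_ext) (simp add: E)
      then show "\<pi> f = 0" by (rule \<pi>I)
    qed
    then show ?thesis by simp
  qed
  ultimately show ?thesis
    unfolding quasihomogeneous_def using wt ker by (intro exI[of _ N] exI[of _ \<pi>] exI[of _ wt]) simp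
qed

end

subsection \<open>Diagonalizing a derivation\<close>

text \<open>\<open>s = t exp (\<integral> (x(0)/x - 1)/t)\<close> turns the derivation \<open>x t\<partial>\<^sub>t\<close> into \<open>x(0) s\<partial>\<^sub>s\<close>.\<close>
lemma ex_eigen_parameter:
  fixes x :: "'k::field_char_0 fps"
  assumes x0: "x $ 0 \<noteq> 0"
  shows "\<exists>s. s $ 0 = 0 \<and> s $ 1 = 1 \<and> x * (fps_X * fps_deriv s) = fps_const (x $ 0) * s"
proof -
  define h where "h = fps_const (x $ 0) * inverse x"
  have xh: "x * h = fps_const (x $ 0)"
    using inverse_mult_eq_1'[OF x0] by (simp add: h_def mult.left_commute)
  have h0: "h $ 0 = 1" using x0 by (simp add: h_def)
  \<comment> \<open>As \<open>h\<close> has constant term 1, dividing \<open>h - 1\<close> by the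
    parameter gives a power series, which can be integrated without a logarithm.\<close>
  define g where "g = fps_shift 1 (h - 1)"
  have g: "h = 1 + fps_X * g"
  proof (rule fps_ext)
    fix n show "h $ n = (1 + fps_X * g) $ n" using h0 by (cases n) (simp_all add: g_def)
  qed
  define G where "G = fps_integral0 g"
  have G: "G $ 0 = 0" "fps_deriv G = g" by (simp_all add: G_def fps_deriv_fps_integral)
  define e where "e = fps_exp 1 oo G"
  have e: "fps_deriv e = e * g" "e $ 0 = 1"
    unfolding e_def using fps_compose_deriv[OF G(1), of "fps_exp 1"] G(2) by simp_all
  define s where "s = fps_X * e"
  have "fps_X * fps_deriv s = s * h"
    unfolding s_def g by (simp add: e(1) algebra_simps)
  then have "x * (fps_X * fps_deriv s) = s * (x * h)" by (simp only: ac_simps)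
  then have "x * (fps_X * fps_deriv s) = fps_const (x $ 0) * s" unfolding xh by (simp only: mult.commute)
  moreover have "s $ 0 = 0" "s $ 1 = 1" using e(2) by (simp_all add: s_def)
  ultimately show ?thesis by blast
qed

text \<open>Eigenvalues \<open>n c i\<close> and \<open>n' c j\<close> can only agree for \<open>i\<close> and \<open>j\<close> with rational \<open>c i/c j > 0\<close>. On each
  class of such indices \<open>d\<close> is a rational multiple of \<open>c\<close>.\<close>
lemma ex_compatible_weights:
  fixes c :: "'r::finite \<Rightarrow> 'k::field_char_0"
  assumes c0: "\<And>i. c i \<noteq> 0"
  shows "\<exists>d :: 'r \<Rightarrow> nat. (\<forall>i. d i > 0) \<and>
    (\<forall>i j n n'. n > 0 \<longrightarrow> n' > 0 \<longrightarrow> of_nat n * c i = of_nat n' * c j \<longrightarrow> n * d i = n' * d j)"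
proof -
  define rel where "rel i j \<longleftrightarrow> (\<exists>n n'. n > 0 \<and> n' > 0 \<and> of_nat n * c i = of_nat n' * c j)" for i j
  have refl: "rel i i" for i unfolding rel_def by (intro exI[of _ 1]) simp
  have sym: "rel j i" if "rel i j" for i j using that unfolding rel_def by metis
  have trans: "rel i l" if r: "rel i j" "rel j l" for i j l
  proof -
    obtain n n' where a: "n > 0" "n' > 0" "of_nat n * c i = of_nat n' * c j"
      using r(1) unfolding rel_def by (elim exE conjE)
    obtain m m' where b: "m > 0" "m' > 0" "of_nat m * c j = of_nat m' * c l"
      using r(2) unfolding rel_def by (elim exE conjE)
    have "of_nat (m * n) * c i = of_nat m * (of_nat n * c i)" by simp
    also have "\<dots> = of_nat n' * (of_nat m * c j)" unfolding a(3) by (simp only: ac_simps)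
    also have "\<dots> = of_nat (n' * m') * c l" unfolding b(3) by simp
    finally show ?thesis unfolding rel_def using a b by (intro exI[of _ "m * n"] exI[of _ "n' * m'"]) simp
  qed
  \<comment> \<open>Related indices satisfy the same predicate, so the choice returns the same
    representative for both.\<close>
  define rep where "rep i = (SOME j. rel i j)" for i
  have rep: "rel i (rep i)" for i unfolding rep_def using refl by (rule someI)
  have rep_eq: "rep i = rep j" if "rel i j" for i j
  proof -
    have "rel i l \<longleftrightarrow> rel j l" for l using trans[OF that] trans[OF sym[OF that]] by blast
    then show ?thesis by (simp add: rep_def)
  qed
  have "\<forall>i. \<exists>a b. a > 0 \<and> b > 0 \<and> of_nat a * c i = of_nat b * c (rep i)"
    by (intro allI) (rule rep[unfolded rel_def])
  then obtain a b where ab: "\<forall>i. a i > (0::nat) \<and> b i > (0::nat) \<and> of_nat (a i) * c i = of_nat (b i) * c (rep i)"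
    unfolding choice_iff by (elim exE)
  \<comment> \<open>The ratio \<open>c i / c (rep i)\<close> is \<open>b i / a i\<close>; the common
    denominator \<open>P\<close> turns it into the natural number \<open>d i\<close>.\<close>
  define P where "P = (\<Prod>i\<in>UNIV. a i)"
  define d where "d i = b i * (\<Prod>j\<in>UNIV - {i}. a j)" for i
  have P: "a i * d i = b i * P" for i
    unfolding P_def d_def by (subst prod.remove[of UNIV i]) (simp_all add: ac_simps)
  have d_pos: "d i > 0" for i unfolding d_def using ab by (simp add: prod_pos)
  have key: "n * d i = n' * d j"
    if n: "n > 0" "n' > 0" and e: "of_nat n * c i = of_nat n' * c j" for i j n n'
  proof -
    define p where "p = c (rep i)"
    have "rel i j" unfolding rel_def using n e by (intro exI conjI)
    then have ri: "of_nat (a i) * c i = of_nat (b i) * p" and rj: "of_nat (a j) * c j = of_nat (b j) * p"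
      using ab rep_eq by (auto simp: p_def)
    have "of_nat (n * b i * a j) * p = of_nat n * of_nat (a j) * (of_nat (b i) * p)"
      by (simp add: ac_simps)
    also have "\<dots> = of_nat (a j) * of_nat (a i) * (of_nat n * c i)"
      unfolding ri[symmetric] by (simp only: ac_simps)
    also have "\<dots> = of_nat n' * of_nat (a i) * (of_nat (a j) * c j)"
      unfolding e by (simp only: ac_simps)
    also have "\<dots> = of_nat (n' * b j * a i) * p" unfolding rj by (simp add: ac_simps)
    finally have "of_nat (n * b i * a j) = (of_nat (n' * b j * a i) :: 'k)"
      using c0[of "rep i"] unfolding p_def by (simp only: mult_cancel_right) simp
    then have f: "n * b i * a j = n' * b j * a i" by (simp only: of_nat_eq_iff)
    have "(n * d i) * (a i * a j) = n * (a i * d i) * a j" by (simp only: ac_simps)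
    also have "\<dots> = (n * b i * a j) * P" unfolding P by (simp only: ac_simps)
    also have "\<dots> = n' * (b j * P) * a i" unfolding f by (simp only: ac_simps)
    also have "\<dots> = (n' * d j) * (a i * a j)" unfolding P[symmetric] by (simp only: ac_simps)
    finally have "n * d i * (a i * a j) = n' * d j * (a i * a j)" .
    moreover have "a i * a j \<noteq> 0" using ab by simp
    ultimately show ?thesis by (metis mult_cancel2)
  qed
  show ?thesis by (intro exI[of _ d] conjI allI impI) (rule d_pos, rule key)
qed

context normalized_curve
begin

theorem quasihomogeneous_if_derivation:
  fixes x :: "'r \<Rightarrow> 'k fps"
  assumes x0: "\<And>i. x i $ 0 \<noteq> 0"
    and der: "\<And>a. (\<lambda>i. x i * (fps_X * fps_deriv (\<psi> a i))) \<in> range \<psi>"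
  shows "quasihomogeneous \<iota>"
proof -
  define c where "c i = x i $ 0" for i
  have c0: "c i \<noteq> 0" for i using x0 by (simp add: c_def)
  have "\<forall>i. \<exists>s. s $ 0 = 0 \<and> s $ 1 = 1 \<and> x i * (fps_X * fps_deriv s) = fps_const (c i) * s"
    using ex_eigen_parameter[OF x0] by (simp add: c_def)
  then obtain s where "\<forall>i. s i $ 0 = 0 \<and> s i $ 1 = 1 \<and> x i * (fps_X * fps_deriv (s i)) = fps_const (c i) * s i"
    unfolding choice_iff by (elim exE)
  then have s: "\<And>i. s i $ 0 = 0" "\<And>i. s i $ 1 \<noteq> 0"
    "\<And>i. x i * (fps_X * fps_deriv (s i)) = fps_const (c i) * s i" by simp_all
  define r where "r i = fps_inv (s i)" for i
  have r0: "r i $ 0 = 0" for i by (simp add: r_def fps_inv_def)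
  have rs: "r i oo s i = fps_X" "s i oo r i = fps_X" for i
    unfolding r_def using fps_inv[OF s(1,2)] fps_inv_right[OF s(1,2)] by simp_all
  \<comment> \<open>Composition with the inverse series \<open>r i\<close> rewrites the
    \<open>i\<close>-th component in the parameter \<open>s i\<close>.\<close>
  define \<sigma> where "\<sigma> a = (\<lambda>i. \<psi> a i oo r i)" for a
  have \<sigma>_s: "\<sigma> a i oo s i = \<psi> a i" for a i
    unfolding \<sigma>_def using fps_compose_assoc[OF s(1)[of i] r0[of i], of "\<psi> a i"] by (simp add: rs)
  have range_\<sigma>: "f \<in> range \<sigma>" if f: "(\<lambda>i. f i oo s i) \<in> range \<psi>" for f
  proof -
    obtain a where a: "(\<lambda>i. f i oo s i) = \<psi> a" using f by (elim rangeE)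
    have "\<sigma> a i = f i" for i
      unfolding \<sigma>_def a[symmetric]
      using fps_compose_assoc[OF r0[of i] s(1)[of i], of "f i"] by (simp add: rs)
    then have "f = \<sigma> a" by (simp add: fun_eq_iff)
    then show ?thesis by blast
  qed
  have \<sigma>_add: "\<sigma> (a + b) = \<sigma> a + \<sigma> b" and \<sigma>_mult: "\<sigma> (a * b) = \<sigma> a * \<sigma> b" for a b
    by (simp_all add: \<sigma>_def fun_eq_iff fps_compose_add_distrib fps_compose_mult_distrib[OF r0])
  have \<sigma>_const: "\<sigma> (\<iota> e) = (\<lambda>_. fps_const e)" for e by (simp add: \<sigma>_def)
  have \<sigma>_diff: "\<sigma> (a - b) = \<sigma> a - \<sigma> b" for a b
    using \<sigma>_add[of "a - b" b] by (simp add: eq_diff_eq)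
  have \<sigma>_nth_0: "\<sigma> a i $ 0 = \<psi> a i $ 0" for a i by (simp add: \<sigma>_def)
  \<comment> \<open>By the chain rule and the eigenvector equation for \<open>s i\<close>, this
    diagonal operator is the derivation of \<open>der\<close> in the new parameters.\<close>
  have \<theta>: "(\<lambda>i. fps_const (c i) * (fps_X * fps_deriv (f i))) \<in> range \<sigma>" if f: "f \<in> range \<sigma>" for f
  proof (rule range_\<sigma>)
    obtain a where a: "f = \<sigma> a" using f by blast
    have "(fps_const (c i) * (fps_X * fps_deriv (f i))) oo s i = x i * (fps_X * fps_deriv (\<psi> a i))" for i
    proof -
      have "(fps_const (c i) * (fps_X * fps_deriv (f i))) oo s i
          = (fps_const (c i) * s i) * (fps_deriv (f i) oo s i)"
        by (simp add: fps_compose_mult_distrib[OF s(1)] s(1) mult.assoc)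
      also have "\<dots> = x i * (fps_X * ((fps_deriv (f i) oo s i) * fps_deriv (s i)))"
        unfolding s(3)[symmetric] by (simp only: ac_simps)
      also have "\<dots> = x i * (fps_X * fps_deriv (\<psi> a i))"
        unfolding fps_compose_deriv[OF s(1), symmetric] a \<sigma>_s ..
      finally show ?thesis .
    qed
    then show "(\<lambda>i. (fps_const (c i) * (fps_X * fps_deriv (f i))) oo s i) \<in> range \<psi>"
      using der[of a] by simp
  qed
  obtain D where D: "\<And>f. ord_ge D f \<Longrightarrow> f \<in> range \<psi>" using conductor by blast
  have \<sigma>_conductor: "f \<in> range \<sigma>" if "ord_ge D f" for f
  proof (rule range_\<sigma>, rule D)
    show "ord_ge D (\<lambda>i. f i oo s i)"
      unfolding ord_ge_def fps_compose_nth using that by (auto intro!: sum.neutral simp: ord_ge_def)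
  qed
  have \<sigma>_sum: "(\<Sum>i\<in>I. f i) \<in> range \<sigma>" if f: "\<And>i. i \<in> I \<Longrightarrow> f i \<in> range \<sigma>" for I :: "'k set" and f
  proof -
    have "\<forall>i. \<exists>b. i \<in> I \<longrightarrow> f i = \<sigma> b" using f by blast
    then obtain g where "\<forall>i. i \<in> I \<longrightarrow> f i = \<sigma> (g i)" unfolding choice_iff by (elim exE)
    moreover have "\<sigma> (\<Sum>i\<in>I. g i) = (\<Sum>i\<in>I. \<sigma> (g i))"
      using \<sigma>_add[of 0 0] \<sigma>_add by (induction I rule: infinite_finite_induct) simp_all
    ultimately have "(\<Sum>i\<in>I. f i) = \<sigma> (\<Sum>i\<in>I. g i)" by simp
    then show ?thesis by blast
  qed
  \<comment> \<open>Interpolation polynomials in the diagonal operator: the product annihilates the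
    eigenvalues in \<open>\<Lambda>\<close> and fixes the terms with eigenvalue
    \<open>\<xi>\<close>.\<close>
  have spec: "\<exists>g\<in>range \<sigma>. \<forall>i n. g i $ n = f i $ n * (\<Prod>\<mu>\<in>\<Lambda>. (of_nat n * c i - \<mu>) / (\<xi> - \<mu>))"
    if "finite \<Lambda>" "\<xi> \<notin> \<Lambda>" "f \<in> range \<sigma>" for \<Lambda> \<xi> f
    using that(1,2)
  proof (induction \<Lambda> rule: finite_induct)
    case empty
    then show ?case using that(3) by (intro bexI[of _ f]) auto
  next
    case (insert \<mu> \<Lambda>)
    then obtain g where g: "g \<in> range \<sigma>"
      "\<And>i n. g i $ n = f i $ n * (\<Prod>\<mu>\<in>\<Lambda>. (of_nat n * c i - \<mu>) / (\<xi> - \<mu>))" by auto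
    obtain a where a: "g = \<sigma> a" using g by blast
    obtain b where b: "(\<lambda>i. fps_const (c i) * (fps_X * fps_deriv (g i))) = \<sigma> b" using \<theta>[OF g(1)] by blast
    define h where "h = \<sigma> (\<iota> (1 / (\<xi> - \<mu>)) * (b - \<iota> \<mu> * a))"
    have X_deriv: "(fps_X * fps_deriv u) $ n = of_nat n * u $ n" for u :: "'k fps" and n
      by (cases n) simp_all
    have "\<sigma> b i $ n = of_nat n * c i * g i $ n" for i n
      unfolding b[symmetric] by (simp add: X_deriv mult.assoc del: fps_X_mult_nth fps_mult_fps_X_commute)
    then have "h i $ n = (of_nat n * c i - \<mu>) / (\<xi> - \<mu>) * g i $ n" for i n
      by (simp add: h_def \<sigma>_mult \<sigma>_diff \<sigma>_const a left_diff_distrib)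
    then have "h i $ n = f i $ n * (\<Prod>\<mu>\<in>insert \<mu> \<Lambda>. (of_nat n * c i - \<mu>) / (\<xi> - \<mu>))" for i n
      using insert.hyps by (simp add: g(2) ac_simps)
    then show ?case unfolding h_def by blast
  qed
  define Ev where "Ev \<xi> f = (\<lambda>i. Abs_fps (\<lambda>n. if of_nat n * c i = \<xi> then f i $ n else 0))"
    for \<xi> and f :: "'r \<Rightarrow> 'k fps"
  have Ev: "Ev \<xi> f i $ n = (if of_nat n * c i = \<xi> then f i $ n else 0)" for \<xi> f i n
    by (simp add: Ev_def)
  have Ev_range: "Ev \<xi> f \<in> range \<sigma>" if f: "f \<in> range \<sigma>" for \<xi> f
  proof -
    \<comment> \<open>Only finitely many eigenvalues occur below order \<open>D\<close>.
      Annihilating all of them except \<open>\<xi>\<close> gives the eigencomponent up to an element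
      of the conductor.\<close>
    define \<Lambda> where "\<Lambda> = (\<lambda>(i, n). of_nat n * c i) ` (UNIV \<times> {..<D}) - {\<xi>}"
    have fin: "finite \<Lambda>" "\<xi> \<notin> \<Lambda>" by (auto simp: \<Lambda>_def)
    obtain g where g: "g \<in> range \<sigma>"
      "\<And>i n. g i $ n = f i $ n * (\<Prod>\<mu>\<in>\<Lambda>. (of_nat n * c i - \<mu>) / (\<xi> - \<mu>))"
      using spec[OF fin f] by blast
    have "ord_ge D (g - Ev \<xi> f)"
      unfolding ord_ge_def
    proof (intro allI impI)
      fix i n assume n: "n < D"
      show "(g - Ev \<xi> f) i $ n = 0"
      proof (cases "of_nat n * c i = \<xi>")
        case True
        have "(\<Prod>\<mu>\<in>\<Lambda>. (of_nat n * c i - \<mu>) / (\<xi> - \<mu>)) = 1"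
          unfolding True using fin(2) by (intro prod.neutral) auto
        then show ?thesis using True by (simp add: g(2) Ev)
      next
        case False
        then have "of_nat n * c i \<in> \<Lambda>" using n by (auto simp: \<Lambda>_def)
        then have "(\<Prod>\<mu>\<in>\<Lambda>. (of_nat n * c i - \<mu>) / (\<xi> - \<mu>)) = 0"
          using fin(1) by (intro prod_zero bexI[of _ "of_nat n * c i"]) simp_all
        then show ?thesis using False by (simp add: g(2) Ev)
      qed
    qed
    then obtain b where b: "g - Ev \<xi> f = \<sigma> b" using \<sigma>_conductor by blast
    obtain a where "g = \<sigma> a" using g(1) by blast
    then have "Ev \<xi> f = \<sigma> (a - b)" using b by (simp add: \<sigma>_diff algebra_simps)
    then show ?thesis by blast
  qed
  obtain d :: "'r \<Rightarrow> nat" where d: "\<And>i. d i > 0"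
    "\<And>i j n n'. n > 0 \<Longrightarrow> n' > 0 \<Longrightarrow> of_nat n * c i = of_nat n' * c j \<Longrightarrow> n * d i = n' * d j"
  proof -
    obtain d :: "'r \<Rightarrow> nat" where d: "\<forall>i. d i > 0"
      "\<forall>i j n n'. n > 0 \<longrightarrow> n' > 0 \<longrightarrow> of_nat n * c i = of_nat n' * c j \<longrightarrow> n * d i = n' * d j"
      using ex_compatible_weights[of c, OF c0] by (elim exE conjE)
    show ?thesis by (rule that[of d]) (rule d[rule_format]; assumption)+
  qed
  have local: "\<exists>e. \<forall>i. \<sigma> a i $ 0 = e" for a
  proof -
    obtain e where "a - \<iota> e \<in> \<mm>" by (rule residue)
    then have "\<sigma> a i $ 0 = e" for i using psi_m[of "a - \<iota> e" i] by (simp add: \<sigma>_nth_0)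
    then show ?thesis by blast
  qed
  have graded: "weight_comp d w f \<in> range \<sigma>" if f: "f \<in> range \<sigma>" for w f
  proof (cases "w = 0")
    case True
    \<comment> \<open>The compatibility of \<open>d\<close> concerns positive exponents only. In
      weight 0 the component is the constant term, which is common to all branches.\<close>
    obtain a where a: "f = \<sigma> a" using f by blast
    obtain e where e: "\<And>i. \<sigma> a i $ 0 = e" using local[of a] by blast
    have "weight_comp d w f = \<sigma> (\<iota> e)"
    proof (intro ext fps_ext)
      fix i n
      have "n * d i = 0 \<longleftrightarrow> n = 0" using d(1)[of i] by simp
      then show "weight_comp d w f i $ n = \<sigma> (\<iota> e) i $ n"
        unfolding True by (simp add: weight_comp_nth \<sigma>_const a e)
    qed
    then show ?thesis by blast
  next
    case False
    \<comment> \<open>The eigenvalues of the terms of weight \<open>w\<close>; by the choice of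
      \<open>d\<close> no term of another weight shares one of them.\<close>
    define \<Lambda> where "\<Lambda> = (\<lambda>i. of_nat (w div d i) * c i) ` {i. d i dvd w}"
    have mem: "of_nat n * c i \<in> \<Lambda> \<longleftrightarrow> n * d i = w" for i n
    proof
      assume "of_nat n * c i \<in> \<Lambda>"
      then obtain j where j: "d j dvd w" "of_nat n * c i = of_nat (w div d j) * c j"
        unfolding \<Lambda>_def by blast
      have w: "w div d j * d j = w" using j(1) by simp
      then have p: "w div d j > 0" using False by (metis gr0I mult_0)
      then have "of_nat (w div d j) * c j \<noteq> 0" using c0 by simp
      then have "n > 0" using j(2) by (cases n) auto
      then show "n * d i = w" using d(2)[OF _ p j(2)] w by simp
    next
      assume n: "n * d i = w"
      then have "d i dvd w" "w div d i = n" using d(1)[of i] by auto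
      then show "of_nat n * c i \<in> \<Lambda>" unfolding \<Lambda>_def by blast
    qed
    have "weight_comp d w f = (\<Sum>\<xi>\<in>\<Lambda>. Ev \<xi> f)"
    proof (intro ext fps_ext)
      fix i n
      have "finite \<Lambda>" by (simp add: \<Lambda>_def)
      then show "weight_comp d w f i $ n = (\<Sum>\<xi>\<in>\<Lambda>. Ev \<xi> f) i $ n"
        by (simp add: weight_comp_nth sum_fun_apply fps_sum_nth Ev mem)
    qed
    then show ?thesis using \<sigma>_sum[of \<Lambda> "\<lambda>\<xi>. Ev \<xi> f", OF Ev_range[OF f]] by simp
  qed
  interpret graded_curve \<iota> \<sigma> d D
  proof
    show "inj \<sigma>"
    proof (rule injI)
      fix a b assume "\<sigma> a = \<sigma> b"
      then have "\<psi> a = \<psi> b" using \<sigma>_s by (metis ext)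
      then show "a = b" by (simp add: psi_inj)
    qed
  qed (use \<sigma>_add \<sigma>_mult \<sigma>_const \<sigma>_conductor local d(1) graded in blast)+
  show ?thesis by (rule quasihomogeneous)
qed

end

subsection \<open>The inverse of the maximal ideal\<close>

lemma enat_SUP_eq_1:
  assumes "1 \<in> S" "\<And>n. n \<in> S \<Longrightarrow> n \<le> 1"
  shows "(SUP n\<in>S. enat n) = 1"
proof (rule antisym)
  show "(SUP n\<in>S. enat n) \<le> 1"
    by (rule SUP_least) (use assms(2) in \<open>simp add: one_enat_def\<close>)
  show "1 \<le> (SUP n\<in>S. enat n)"
    using SUP_upper[OF assms(1), of enat] by (simp add: one_enat_def)
qed

lemma fls_fun_unit: "(\<And>i. f i \<noteq> 0) \<Longrightarrow> \<exists>g. f * g = (1 :: 'r \<Rightarrow> 'k::field fls)"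
  by (intro exI[of _ "\<lambda>i. inverse (f i)"]) (simp add: fun_eq_iff)

context normalized_curve
begin

interpretation am: module "act \<phi>"
  by (rule module_act) (rule phi_hom)

lemma phi_eq_iff: "\<phi> a = \<phi> b \<longleftrightarrow> a = b"
  using phi_inj by (auto dest: injD)

lemma phi_sub: "am.subspace (range \<phi>)"
proof (rule am.subspaceI)
  show "0 \<in> range \<phi>" using phi_0 by (metis rangeI)
  show "x + y \<in> range \<phi>" if xy: "x \<in> range \<phi>" "y \<in> range \<phi>" for x y
  proof -
    obtain a b where "x = \<phi> a" "y = \<phi> b" using xy by blast
    then have "x + y = \<phi> (a + b)" by simp
    then show ?thesis by blast
  qed
  show "act \<phi> c x \<in> range \<phi>" if x: "x \<in> range \<phi>" for c x
  proof -
    obtain a where "x = \<phi> a" using x by blast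
    then have "act \<phi> c x = \<phi> (c * a)" by (simp add: act_def)
    then show ?thesis by blast
  qed
qed

lemma frac_inverse_iff: "x \<in> frac_inverse \<phi> I \<longleftrightarrow> (\<forall>w\<in>I. x * w \<in> range \<phi>)"
  by (simp add: frac_inverse_def frac_Hom_def)

lemma frac_inverse_sub: "am.subspace (frac_inverse \<phi> I)"
proof (rule am.subspaceI)
  show "0 \<in> frac_inverse \<phi> I"
    using am.subspace_0[OF phi_sub] by (simp add: frac_inverse_iff)
  show "x + y \<in> frac_inverse \<phi> I" if xy: "x \<in> frac_inverse \<phi> I" "y \<in> frac_inverse \<phi> I" for x y
    using xy am.subspace_add[OF phi_sub] by (simp add: frac_inverse_iff distrib_right)
  show "act \<phi> c x \<in> frac_inverse \<phi> I" if x: "x \<in> frac_inverse \<phi> I" for c x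
    using x am.subspace_scale[OF phi_sub, of _ c] by (simp add: frac_inverse_iff act_def mult.assoc)
qed

lemma frac_End_iff: "x \<in> frac_End I \<longleftrightarrow> (\<forall>w\<in>I. x * w \<in> I)"
  by (simp add: frac_End_def frac_Hom_def)

lemma frac_End_sub: assumes "am.subspace I" shows "am.subspace (frac_End I)"
proof (rule am.subspaceI)
  show "0 \<in> frac_End I"
    using am.subspace_0[OF assms] by (simp add: frac_End_iff)
  show "x + y \<in> frac_End I" if xy: "x \<in> frac_End I" "y \<in> frac_End I" for x y
    using xy am.subspace_add[OF assms] by (simp add: frac_End_iff distrib_right)
  show "act \<phi> c x \<in> frac_End I" if x: "x \<in> frac_End I" for c x
    using x am.subspace_scale[OF assms, of _ c] by (simp add: frac_End_iff act_def mult.assoc)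
qed

lemma range_frac_End: assumes "am.subspace I" shows "range \<phi> \<subseteq> frac_End I"
proof
  fix x assume "x \<in> range \<phi>"
  then obtain a where "x = \<phi> a" by blast
  then show "x \<in> frac_End I" using am.subspace_scale[OF assms, of _ a] by (simp add: frac_End_iff act_def)
qed

text \<open>After division by \<open>y\<close>, an element of a high power of \<open>\<mm>\<close>
  still has order at least \<open>D\<close> on every branch, so the quotient lies in
  \<open>A\<close>.\<close>

lemma parameter:
  assumes "\<And>i. \<psi> y i \<noteq> 0"
  shows "\<exists>n. ideal_power \<mm> n \<subseteq> ideal_gen {y}"
proof -
  obtain D where D: "\<And>f. ord_ge D f \<Longrightarrow> f \<in> range \<psi>" using conductor by blast
  define n where "n = (\<Sum>i\<in>UNIV. subdegree (\<psi> y i)) + D"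
  have "a \<in> ideal_gen {y}" if a: "a \<in> ideal_power \<mm> n" for a
  proof -
    have o: "ord_ge n (\<psi> a)" by (rule psi_ideal_power[OF a])
    have "\<exists>h. \<psi> a i = \<psi> y i * (fps_X ^ D * h)" for i
    proof -
      have "\<psi> y i * fps_X ^ D dvd \<psi> a i"
      proof (cases "\<psi> a i = 0")
        case False
        have "subdegree (\<psi> y i * fps_X ^ D) = subdegree (\<psi> y i) + D"
          using assms[of i] by (simp add: fps_subdegree_mult_fps_X_power)
        also have "\<dots> \<le> n" unfolding n_def by (intro add_right_mono member_le_sum) auto
        also have "n \<le> subdegree (\<psi> a i)" using False o by (intro subdegree_geI) (auto simp: ord_ge_def)
        finally show ?thesis using False assms[of i] by (simp add: fps_dvd_iff)
      qed simp
      then show ?thesis unfolding dvd_def by (simp add: mult.assoc)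
    qed
    then have "\<forall>i. \<exists>h. \<psi> a i = \<psi> y i * (fps_X ^ D * h)" by blast
    then obtain h where h: "\<forall>i. \<psi> a i = \<psi> y i * (fps_X ^ D * h i)" unfolding choice_iff by (elim exE)
    have "ord_ge D (\<lambda>i. fps_X ^ D * h i)" by (simp add: ord_ge_def fps_X_power_mult_nth)
    then obtain b where b: "(\<lambda>i. fps_X ^ D * h i) = \<psi> b" using D by blast
    have "\<psi> a = \<psi> (b * y)" using h fun_cong[OF b] by (simp add: fun_eq_iff mult.commute)
    then have "a = b * y" by (simp only: psi_inj)
    then show ?thesis by (simp add: ideal_gen_single)
  qed
  then show ?thesis by blast
qed

lemma phi_unit: assumes "\<And>i. \<psi> y i \<noteq> 0" shows "\<exists>g. \<phi> y * g = 1"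
  by (rule fls_fun_unit) (use assms in \<open>simp flip: psi_phi\<close>)

abbreviation Minv :: "('r \<Rightarrow> 'k fls) set" where "Minv \<equiv> frac_inverse \<phi> (M_module \<phi>)"

abbreviation minv :: "('r \<Rightarrow> 'k fls) set" where "minv \<equiv> frac_inverse \<phi> (\<phi> ` \<mm>)"

lemma range_minv: "range \<phi> \<subseteq> minv"
proof
  fix x assume "x \<in> range \<phi>"
  then obtain a where a: "x = \<phi> a" by blast
  have "x * \<phi> b \<in> range \<phi>" for b unfolding a by (metis phi(3) rangeI)
  then show "x \<in> minv" by (auto simp: frac_inverse_iff)
qed

text \<open>For \<open>x\<close> in \<open>minv\<close> the numerator \<open>x * \<phi> y\<close> is
  killed by \<open>\<mm>\<close> modulo \<open>y\<close>, hence belongs to the one-dimensional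
  socle. So the quotient \<open>z\<close> of \<open>s\<close> by \<open>y\<close>, together with 1,
  generates \<open>minv\<close>.\<close>

lemma minv_generator:
  "\<exists>z. z \<in> minv \<and> z \<notin> range \<phi> \<and> (\<forall>x\<in>minv. \<exists>u v. x = \<phi> u * z + \<phi> v)"
proof -
  obtain y where y: "y \<in> \<mm>" "nonzerodivisor y" using ex_nonzerodivisor by blast
  obtain n where n: "ideal_power \<mm> n \<subseteq> ideal_gen {y}" using parameter psi_nzd[OF y(2)] by blast
  obtain s where s: "s \<notin> ideal_gen {y}" "\<And>x. x \<in> \<mm> \<Longrightarrow> x * s \<in> ideal_gen {y}"
    using ex_socle[OF y(1) n] by blast
  obtain g where g: "\<phi> y * g = 1" using phi_unit psi_nzd[OF y(2)] by blast
  define z where "z = \<phi> s * g"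
  have zy: "z * \<phi> y = \<phi> s" using g by (simp add: z_def mult.assoc mult.commute[of g])
  have cancel: "p = q" if "p * \<phi> y = q * \<phi> y" for p q
  proof -
    have "p = (p * \<phi> y) * g" using g by (simp add: mult.assoc)
    also have "\<dots> = q" unfolding that using g by (simp add: mult.assoc)
    finally show ?thesis .
  qed
  have "z \<in> minv"
    unfolding frac_inverse_iff
  proof
    fix w assume "w \<in> \<phi> ` \<mm>"
    then obtain a where a: "w = \<phi> a" "a \<in> \<mm>" by blast
    obtain c where c: "a * s = c * y" using s(2)[OF a(2)] by (auto simp: ideal_gen_single)
    have "(z * w) * \<phi> y = \<phi> a * (z * \<phi> y)" unfolding a(1) by (simp only: ac_simps)
    also have "\<dots> = \<phi> (a * s)" unfolding zy by simp
    also have "\<dots> = \<phi> c * \<phi> y" unfolding c by simp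
    finally have "z * w = \<phi> c" by (rule cancel)
    then show "z * w \<in> range \<phi>" by blast
  qed
  moreover have "z \<notin> range \<phi>"
  proof
    assume "z \<in> range \<phi>"
    then obtain b where "z = \<phi> b" by blast
    then have "\<phi> s = \<phi> (b * y)" using zy by simp
    then have "s = b * y" by (simp only: phi_eq_iff)
    then show False using s(1) by (simp add: ideal_gen_single)
  qed
  moreover have "\<exists>u v. x = \<phi> u * z + \<phi> v" if x: "x \<in> minv" for x
  proof -
    obtain w where w: "x * \<phi> y = \<phi> w" using x y(1) unfolding frac_inverse_iff by blast
    have "a * w \<in> ideal_gen {y}" if a: "a \<in> \<mm>" for a
    proof -
      obtain c where c: "x * \<phi> a = \<phi> c" using x a unfolding frac_inverse_iff by blast
      have "\<phi> (a * w) = (x * \<phi> a) * \<phi> y" by (simp add: w[symmetric] ac_simps)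
      also have "\<dots> = \<phi> (c * y)" unfolding c by simp
      finally have "a * w = c * y" by (simp only: phi_eq_iff)
      then show ?thesis by (simp add: ideal_gen_single)
    qed
    then have "w \<in> ideal_gen {s, y}" using socle_annihilator[OF y(1) n s] by blast
    then obtain u where "w - u * s \<in> ideal_gen {y}" using ideal_gen_insert by blast
    then obtain v where "w - u * s = v * y" by (auto simp: ideal_gen_single)
    then have v: "w = u * s + v * y" by (simp add: algebra_simps)
    have "x * \<phi> y = \<phi> u * (z * \<phi> y) + \<phi> v * \<phi> y" unfolding w zy v by simp
    then have "x * \<phi> y = (\<phi> u * z + \<phi> v) * \<phi> y" by (simp only: distrib_right mult.assoc)
    then have "x = \<phi> u * z + \<phi> v" by (rule cancel)
    then show ?thesis by blast
  qed
  ultimately show ?thesis by blast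
qed

text \<open>Modulo \<open>A\<close> the generator \<open>z\<close> is killed by
  \<open>\<mm>\<close>, and every unit multiple of it gives \<open>z\<close> back.\<close>

lemma minv_simple:
  assumes N: "am.subspace N" "range \<phi> \<subseteq> N" "N \<subseteq> minv"
  shows "N = range \<phi> \<or> N = minv"
proof (rule disjCI)
  assume ne: "N \<noteq> minv"
  obtain z where z: "z \<in> minv" "\<And>x. x \<in> minv \<Longrightarrow> \<exists>u v. x = \<phi> u * z + \<phi> v"
    using minv_generator by blast
  have "x \<in> range \<phi>" if x: "x \<in> N" for x
  proof -
    obtain u v where uv: "x = \<phi> u * z + \<phi> v" using z(2) x N(3) by blast
    show ?thesis
    proof (cases "u \<in> \<mm>")
      case True
      then have "z * \<phi> u \<in> range \<phi>" using z(1) by (auto simp: frac_inverse_iff)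
      then have "\<phi> u * z + \<phi> v \<in> range \<phi>"
        by (intro am.subspace_add[OF phi_sub]) (simp_all add: mult.commute)
      then show ?thesis using uv by simp
    next
      case False
      then obtain u' where u': "u' * u = 1" using unit_inverse by blast
      have xv: "x - \<phi> v \<in> N" using am.subspace_diff[OF N(1) x] N(2) by blast
      have "act \<phi> u' (x - \<phi> v) = \<phi> (u' * u) * z" by (simp add: act_def uv mult.assoc)
      then have "z \<in> N" using am.subspace_scale[OF N(1) xv, of u'] u' by simp
      then have "\<phi> a * z + \<phi> b \<in> N" for a b
        using am.subspace_add[OF N(1) am.subspace_scale[OF N(1), of z a]] N(2) by (auto simp: act_def)
      then have "minv \<subseteq> N" using z(2) by blast
      then show ?thesis using ne N(3) by blast
    qed
  qed
  then show "N = range \<phi>" using N(2) by blast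
qed

lemma minv_strict: "range \<phi> \<subset> minv"
  using minv_generator range_minv by blast

lemma length_minv: "quotient_length (act \<phi>) minv (range \<phi>) = 1"
  unfolding quotient_length_def
proof (rule enat_SUP_eq_1)
  let ?S = "{n. \<exists>C. (\<forall>i\<le>n. am.subspace (C i) \<and> range \<phi> \<subseteq> C i \<and> C i \<subseteq> minv) \<and> (\<forall>i<n. C i \<subset> C (Suc i))}"
  show "1 \<in> ?S"
    by (intro CollectI exI[of _ "\<lambda>i. if i = 0 then range \<phi> else minv"])
      (use minv_strict phi_sub frac_inverse_sub in auto)
  fix n assume "n \<in> ?S"
  then obtain C where C: "\<And>i. i \<le> n \<Longrightarrow> am.subspace (C i) \<and> range \<phi> \<subseteq> C i \<and> C i \<subseteq> minv"
    "\<And>i. i < n \<Longrightarrow> C i \<subset> C (Suc i)" by blast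
  show "n \<le> 1"
  proof (rule ccontr)
    assume n: "\<not> n \<le> 1"
    have "C 1 = range \<phi> \<or> C 1 = minv" using minv_simple C(1)[of 1] n by simp
    moreover have "C 0 \<subset> C 1" "C 1 \<subset> C 2" using C(2)[of 0] C(2)[of 1] n by (simp_all add: numeral_2_eq_2)
    moreover have "range \<phi> \<subseteq> C 0" "C 2 \<subseteq> minv" using C(1)[of 0] C(1)[of 2] n by simp_all
    ultimately show False by blast
  qed
qed

lemma length_1_eq_minv:
  assumes N: "am.subspace N" "minv \<subseteq> N" and len: "quotient_length (act \<phi>) N (range \<phi>) = 1"
  shows "N = minv"
proof (rule ccontr)
  assume "N \<noteq> minv"
  then have s: "minv \<subset> N" using N(2) by blast
  let ?C = "\<lambda>i::nat. if i = 0 then range \<phi> else if i = 1 then minv else N"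
  have "\<forall>i\<le>2. am.subspace (?C i) \<and> range \<phi> \<subseteq> ?C i \<and> ?C i \<subseteq> N"
    using N range_minv phi_sub frac_inverse_sub by auto
  moreover have "\<forall>i<2. ?C i \<subset> ?C (Suc i)"
    using s minv_strict by (auto simp: less_2_cases_iff)
  ultimately have "\<exists>C. (\<forall>i\<le>2. am.subspace (C i) \<and> range \<phi> \<subseteq> C i \<and> C i \<subseteq> N) \<and> (\<forall>i<2. C i \<subset> C (Suc i))"
    by (intro exI[of _ ?C] conjI)
  then have "enat 2 \<le> quotient_length (act \<phi>) N (range \<phi>)"
    unfolding quotient_length_def by (intro SUP_upper) simp
  then show False unfolding len by (simp add: one_enat_def)
qed

lemma length_range: "quotient_length (act \<phi>) (range \<phi>) (range \<phi>) \<noteq> 1"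
proof -
  have "quotient_length (act \<phi>) (range \<phi>) (range \<phi>) \<le> 0"
    unfolding quotient_length_def
  proof (rule SUP_least)
    fix n assume "n \<in> {n. \<exists>C. (\<forall>i\<le>n. am.subspace (C i) \<and> range \<phi> \<subseteq> C i \<and> C i \<subseteq> range \<phi>) \<and>
        (\<forall>i<n. C i \<subset> C (Suc i))}"
    then obtain C where C: "\<forall>i\<le>n. am.subspace (C i) \<and> range \<phi> \<subseteq> C i \<and> C i \<subseteq> range \<phi>"
      "\<forall>i<n. C i \<subset> C (Suc i)" by (elim CollectE exE conjE)
    have "n = 0"
    proof (rule ccontr)
      assume n: "n \<noteq> 0"
      have "C 0 \<subset> C 1" using C(2)[rule_format, of 0] n by simp
      moreover have "range \<phi> \<subseteq> C 0" "C 1 \<subseteq> range \<phi>"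
        using C(1)[rule_format, of 0] C(1)[rule_format, of 1] n by simp_all
      ultimately show False by blast
    qed
    then show "enat n \<le> 0" by (simp add: zero_enat_def)
  qed
  then show ?thesis by auto
qed

text \<open>If \<open>x * \<phi> a\<close> were a unit, every \<open>c\<close> in
  \<open>\<mm>\<close> would be \<open>a\<close> times the element
  \<open>(x * \<phi> c) / (x * \<phi> a)\<close> of \<open>A\<close>. Then \<open>\<mm>\<close>
  would be principal and \<open>A\<close> regular.\<close>

lemma minv_mult_m:
  assumes "\<not> smooth TYPE('a)" "x \<in> minv" "a \<in> \<mm>"
  shows "x * \<phi> a \<in> \<phi> ` \<mm>"
proof (rule ccontr)
  assume n: "x * \<phi> a \<notin> \<phi> ` \<mm>"
  obtain b where b: "x * \<phi> a = \<phi> b" using assms(2,3) unfolding frac_inverse_iff by blast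
  then have "b \<notin> \<mm>" using n by blast
  then obtain b' where b': "b' * b = 1" using unit_inverse by blast
  have "ideal_gen {a} = \<mm>"
  proof
    show "ideal_gen {a} \<subseteq> \<mm>" using assms(3) m_ideal by (intro rm.span_minimal) auto
    show "\<mm> \<subseteq> ideal_gen {a}"
    proof
      fix c assume "c \<in> \<mm>"
      then obtain d where d: "x * \<phi> c = \<phi> d" using assms(2) unfolding frac_inverse_iff by blast
      have "\<phi> (b * c) = (x * \<phi> a) * \<phi> c" by (simp add: b)
      also have "\<dots> = (x * \<phi> c) * \<phi> a" by (simp only: ac_simps)
      also have "\<dots> = \<phi> (d * a)" by (simp add: d)
      finally have "b * c = d * a" by (simp only: phi_eq_iff)
      then have "b' * (b * c) = b' * (d * a)" by (rule arg_cong)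
      then have "c = (b' * d) * a" using b' by (simp flip: mult.assoc)
      then show "c \<in> ideal_gen {a}" unfolding ideal_gen_single by blast
    qed
  qed
  then have "regular_local_ring TYPE('a)"
    unfolding regular_local_ring_def using local noeth dim1
    by (intro conjI exI[of _ "{a}"]) (simp_all add: one_enat_def)
  then show False using assms(1) by simp
qed

theorem rho'_eq_1_if_iso:
  assumes ns: "\<not> smooth TYPE('a)" and u: "u * v = 1"
    and uM: "\<And>w. w \<in> M_module \<phi> \<Longrightarrow> u * w \<in> \<phi> ` \<mm>"
    and Mu: "\<And>a. a \<in> \<mm> \<Longrightarrow> \<exists>w\<in>M_module \<phi>. \<phi> a = u * w"
  shows "rho' \<phi> = 1"
proof -
  have "frac_End Minv = minv"
  proof (intro equalityI subsetI)
    fix e assume e: "e \<in> frac_End Minv"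
    \<comment> \<open>Then \<open>e * u\<close> maps \<open>M\<close> into \<open>A\<close>; since
      \<open>u\<close> maps \<open>M\<close> onto \<open>\<mm>\<close>, this says that
      \<open>e\<close> maps \<open>\<mm>\<close> into \<open>A\<close>.\<close>
    have "u \<in> Minv" using uM by (auto simp: frac_inverse_iff)
    then have eu: "e * u \<in> Minv" using e by (simp add: frac_End_iff)
    show "e \<in> minv" unfolding frac_inverse_iff
    proof
      fix w assume "w \<in> \<phi> ` \<mm>"
      then obtain w' where "w' \<in> M_module \<phi>" "w = u * w'" using Mu by blast
      then show "e * w \<in> range \<phi>" using eu by (simp add: frac_inverse_iff mult.assoc)
    qed
  next
    fix e assume e: "e \<in> minv"
    show "e \<in> frac_End Minv" unfolding frac_End_iff
    proof
      fix x assume x: "x \<in> Minv"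
      \<comment> \<open>By \<open>minv_mult_m\<close> it follows that \<open>x * v\<close> maps
        \<open>\<mm>\<close> into \<open>\<mm>\<close>, so \<open>e\<close> may be applied
        afterwards.\<close>
      have "x * v \<in> minv" unfolding frac_inverse_iff
      proof
        fix w assume "w \<in> \<phi> ` \<mm>"
        then obtain w' where w': "w' \<in> M_module \<phi>" "w = u * w'" using Mu by blast
        have "x * v * w = x * w' * (u * v)" unfolding w'(2) by (simp only: ac_simps)
        then show "x * v * w \<in> range \<phi>" using x w'(1) u by (simp add: frac_inverse_iff)
      qed
      note xv = this
      show "e * x \<in> Minv" unfolding frac_inverse_iff
      proof
        fix w assume "w \<in> M_module \<phi>"
        then obtain a where a: "a \<in> \<mm>" "u * w = \<phi> a" using uM by blast
        obtain b where b: "b \<in> \<mm>" "x * v * \<phi> a = \<phi> b" using minv_mult_m[OF ns xv a(1)] by blast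
        have "e * x * w = e * (x * w * (u * v))" using u by (simp add: mult.assoc)
        also have "\<dots> = e * (x * v * (u * w))" by (simp only: ac_simps)
        also have "\<dots> = e * \<phi> b" unfolding a(2) b(2) ..
        finally show "e * x * w \<in> range \<phi>" using e b(1) by (simp add: frac_inverse_iff)
      qed
    qed
  qed
  then show ?thesis unfolding rho'_def using length_minv by simp
qed

section \<open>Orders on the branches and the trace ideal\<close>

lemma t_deriv_phi: "t_deriv (\<phi> a) i = fps_to_fls (fps_X * fps_deriv (\<psi> a i))"
  using fls_deriv_fps_to_fls[of "\<psi> a i"] by (simp add: t_deriv_def fls_times_fps_to_fls)

lemma M_module_gen: "a \<in> \<mm> \<Longrightarrow> t_deriv (\<phi> a) \<in> M_module \<phi>"
  unfolding M_module_def by (rule am.span_base) blast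

lemma X_deriv_nth: "(fps_X * fps_deriv u) $ n = of_nat n * u $ n" for u :: "'k fps"
  by (cases n) simp_all

text \<open>Divisibility within the power series instead of a bound on the order: zero needs no
  special case.\<close>

definition X_multiple :: "nat \<Rightarrow> 'k fls \<Rightarrow> bool" where
  "X_multiple \<mu> f \<longleftrightarrow> (\<exists>g. f = fps_to_fls (fps_X ^ \<mu> * g))"

lemma X_multiple_0: "X_multiple \<mu> 0"
  unfolding X_multiple_def by (intro exI[of _ 0]) simp

lemma X_multiple_add: assumes "X_multiple \<mu> f" "X_multiple \<mu> g" shows "X_multiple \<mu> (f + g)"
proof -
  obtain f' g' where "f = fps_to_fls (fps_X ^ \<mu> * f')" "g = fps_to_fls (fps_X ^ \<mu> * g')"
    using assms unfolding X_multiple_def by blast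
  then have "f + g = fps_to_fls (fps_X ^ \<mu> * (f' + g'))" by (simp add: distrib_left)
  then show ?thesis unfolding X_multiple_def by blast
qed

lemma X_multiple_mult: assumes "X_multiple \<mu> f" "X_multiple \<nu> g" shows "X_multiple (\<mu> + \<nu>) (f * g)"
proof -
  obtain f' g' where "f = fps_to_fls (fps_X ^ \<mu> * f')" "g = fps_to_fls (fps_X ^ \<nu> * g')"
    using assms unfolding X_multiple_def by blast
  then have "f * g = fps_to_fls (fps_X ^ (\<mu> + \<nu>) * (f' * g'))"
    by (simp add: power_add ac_simps flip: fls_times_fps_to_fls)
  then show ?thesis unfolding X_multiple_def by blast
qed

lemma X_multiple_phi: "X_multiple 0 (\<phi> a i)"
  unfolding X_multiple_def by (intro exI[of _ "\<psi> a i"]) simp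

lemma X_multiple_fps: "(\<And>k. k < \<mu> \<Longrightarrow> f $ k = 0) \<Longrightarrow> X_multiple \<mu> (fps_to_fls f)"
  unfolding X_multiple_def
  by (intro exI[of _ "fps_shift \<mu> f"] arg_cong[of _ _ fps_to_fls] fps_ext) (simp add: fps_X_power_mult_nth)

lemma X_multiple_nth: "X_multiple \<mu> (fps_to_fls f) \<Longrightarrow> k < \<mu> \<Longrightarrow> f $ k = 0"
  unfolding X_multiple_def by (auto simp: fps_X_power_mult_nth)

lemma X_multiple_span:
  assumes "w \<in> am.span S" "\<And>s. s \<in> S \<Longrightarrow> X_multiple \<mu> (s i)"
  shows "X_multiple \<mu> (w i)"
  using assms(1)
proof (induction rule: am.span_induct_alt)
  case base
  then show ?case by (simp add: X_multiple_0)
next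
  case (step c x y)
  have "X_multiple (0 + \<mu>) (\<phi> c i * x i)" by (rule X_multiple_mult[OF X_multiple_phi assms(2)[OF step(1)]])
  then show ?case using X_multiple_add[OF _ step(2)] by (simp add: act_def)
qed

lemma M_X_multiple:
  assumes "w \<in> M_module \<phi>" "\<And>a k. a \<in> \<mm> \<Longrightarrow> k < \<mu> \<Longrightarrow> \<psi> a i $ k = 0"
  shows "X_multiple \<mu> (w i)"
  using assms(1) unfolding M_module_def
proof (rule X_multiple_span)
  fix s assume "s \<in> (\<lambda>a. t_deriv (\<phi> a)) ` \<mm>"
  then obtain a where a: "a \<in> \<mm>" "s = t_deriv (\<phi> a)" by blast
  show "X_multiple \<mu> (s i)"
    unfolding a(2) t_deriv_phi by (rule X_multiple_fps) (use assms(2)[OF a(1)] in \<open>simp only: X_deriv_nth mult_zero_right\<close>)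
qed

text \<open>Since \<open>t\<partial>\<^sub>t\<close> preserves the order on each branch, \<open>\<mm>\<close> and \<open>M\<close> have the same minimal order there. So
  if \<open>M\<^sup>-\<^sup>1 M = \<mm>\<close> then the minimal order of \<open>M\<^sup>-\<^sup>1\<close> on each branch is \<open>0\<close>.\<close>
lemma inverse_M_order:
  assumes T: "\<And>x w. x \<in> Minv \<Longrightarrow> w \<in> M_module \<phi> \<Longrightarrow> x * w \<in> \<phi> ` \<mm>"
    and span: "\<And>a. a \<in> \<mm> \<Longrightarrow>
      \<phi> a \<in> am.span {x * w |x w. x \<in> Minv \<and> w \<in> M_module \<phi>}"
  shows "z \<in> Minv \<Longrightarrow> X_multiple 0 (z i)"
    and "\<exists>z\<in>Minv. fls_nth (z i) 0 \<noteq> 0"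
proof -
  define Q where "Q \<mu> \<longleftrightarrow> (\<exists>a\<in>\<mm>. \<psi> a i $ \<mu> \<noteq> 0)" for \<mu>
  obtain y where y: "y \<in> \<mm>" "nonzerodivisor y" using ex_nonzerodivisor by blast
  then have "Q (subdegree (\<psi> y i))" unfolding Q_def using psi_nzd[OF y(2), of i] by (intro bexI[of _ y]) auto
  define \<mu> where "\<mu> = (LEAST \<mu>. Q \<mu>)"
  have "Q \<mu>" unfolding \<mu>_def by (rule LeastI) (rule \<open>Q (subdegree (\<psi> y i))\<close>)
  then obtain f where f: "f \<in> \<mm>" "\<psi> f i $ \<mu> \<noteq> 0" unfolding Q_def by blast
  have low: "\<psi> a i $ k = 0" if "a \<in> \<mm>" "k < \<mu>" for a k
    using not_less_Least[of k Q] that unfolding \<mu>_def Q_def by blast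
  have \<mu>_pos: "\<mu> > 0" using psi_m[OF f(1), of i] f(2) by (cases \<mu>) auto
  show X0: "X_multiple 0 (z i)" if z: "z \<in> Minv" for z
  proof -
    obtain b where b: "b \<in> \<mm>" "z * t_deriv (\<phi> f) = \<phi> b" using T[OF z M_module_gen[OF f(1)]] by blast
    \<comment> \<open>\<open>h\<close> is a unit: its constant term is \<open>\<mu>\<close> times
      the lowest coefficient of \<open>\<psi> f i\<close>, and \<open>\<mu>\<close> is positive.
      Cancelling \<open>fps_X ^ \<mu>\<close> exhibits \<open>z i\<close> as a power series divided
      by \<open>h\<close>.\<close>
    define h where "h = fps_shift \<mu> (fps_X * fps_deriv (\<psi> f i))"
    have h: "fps_X * fps_deriv (\<psi> f i) = fps_X ^ \<mu> * h"
      unfolding h_def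
    proof (rule fps_ext)
      fix n
      show "(fps_X * fps_deriv (\<psi> f i)) $ n
          = (fps_X ^ \<mu> * fps_shift \<mu> (fps_X * fps_deriv (\<psi> f i))) $ n"
        by (simp only: fps_X_power_mult_nth fps_shift_nth X_deriv_nth) (use low[OF f(1)] in auto)
    qed
    have "h $ 0 = of_nat \<mu> * \<psi> f i $ \<mu>" unfolding h_def fps_shift_nth X_deriv_nth by simp
    then have h0: "h $ 0 \<noteq> 0" using f(2) \<mu>_pos by simp
    obtain g where g: "\<phi> b i = fps_to_fls (fps_X ^ \<mu> * g)"
      using X_multiple_fps[of \<mu> "\<psi> b i"] low[OF b(1)] unfolding X_multiple_def by auto
    let ?h' = "fps_to_fls (inverse h)"
    have hh: "fps_to_fls h * ?h' = 1"
      using inverse_mult_eq_1'[OF h0] by (simp flip: fls_times_fps_to_fls)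
    have "fls_X ^ \<mu> * (z i * fps_to_fls h) = z i * t_deriv (\<phi> f) i"
      unfolding t_deriv_phi h by (simp add: fls_times_fps_to_fls fps_to_fls_power ac_simps)
    also have "\<dots> = fls_X ^ \<mu> * fps_to_fls g"
      using fun_cong[OF b(2), of i] unfolding g by (simp add: fls_times_fps_to_fls fps_to_fls_power)
    finally have "z i * fps_to_fls h = fps_to_fls g" by simp
    then have "z i * (fps_to_fls h * ?h') = fps_to_fls g * ?h'" by (simp flip: mult.assoc)
    then have "z i = fps_to_fls (g * inverse h)" unfolding hh by (simp add: fls_times_fps_to_fls)
    then show ?thesis unfolding X_multiple_def by auto
  qed
  show "\<exists>z\<in>Minv. fls_nth (z i) 0 \<noteq> 0"
  proof (rule ccontr)
    assume n: "\<not> ?thesis"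
    have X1: "X_multiple 1 (z i)" if z: "z \<in> Minv" for z
    proof -
      obtain g where g: "z i = fps_to_fls g" using X0[OF z] unfolding X_multiple_def by auto
      have "g $ 0 = 0" using n z g by auto
      then show ?thesis unfolding g by (intro X_multiple_fps) simp
    qed
    \<comment> \<open>If all of \<open>Minv\<close> had positive order on branch \<open>i\<close>,
      all products with \<open>M\<close>, and then \<open>\<phi> f\<close>, would have order greater
      than \<open>\<mu>\<close>.\<close>
    have "X_multiple (1 + \<mu>) (\<phi> f i)"
    proof (rule X_multiple_span[OF span[OF f(1)]])
      fix s assume "s \<in> {x * w |x w. x \<in> Minv \<and> w \<in> M_module \<phi>}"
      then obtain x w where s: "s = x * w" "x \<in> Minv" "w \<in> M_module \<phi>" by blast
      show "X_multiple (1 + \<mu>) (s i)"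
        using X_multiple_mult[OF X1[OF s(2)] M_X_multiple[OF s(3) low]] unfolding s(1) by simp
    qed
    then have "X_multiple (1 + \<mu>) (fps_to_fls (\<psi> f i))" by simp
    then have "\<psi> f i $ \<mu> = 0" by (rule X_multiple_nth) simp
    then show False using f(2) by simp
  qed
qed

text \<open>If \<open>x * w\<close> were a unit of \<open>A\<close>, each \<open>e\<close> in
  \<open>frac_End Minv\<close> would be \<open>(e * x) * w\<close> divided by this unit, hence in
  \<open>A\<close>, and the quotient would have length 0.\<close>

lemma inverse_M_mult:
  assumes "rho' \<phi> = 1"
    and x: "x \<in> Minv" and w: "w \<in> M_module \<phi>"
  shows "x * w \<in> \<phi> ` \<mm>"
proof (rule ccontr)
  assume n: "x * w \<notin> \<phi> ` \<mm>"
  obtain b where b: "x * w = \<phi> b" using x w unfolding frac_inverse_iff by blast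
  then have "b \<notin> \<mm>" using n by blast
  then obtain b' where b': "b' * b = 1" using unit_inverse by blast
  have "frac_End Minv \<subseteq> range \<phi>"
  proof
    fix e assume "e \<in> frac_End Minv"
    then have "e * x \<in> Minv" using x by (simp add: frac_End_iff)
    then obtain c where c: "e * x * w = \<phi> c" using w unfolding frac_inverse_iff by blast
    have "e = e * \<phi> (b' * b)" using b' by simp
    also have "\<dots> = \<phi> b' * (e * (x * w))" unfolding b phi(3) by (simp only: ac_simps)
    also have "\<dots> = \<phi> (b' * c)" using c by (simp add: mult.assoc)
    finally show "e \<in> range \<phi>" by blast
  qed
  then have "frac_End Minv = range \<phi>" using range_frac_End[OF frac_inverse_sub] by blast
  then show False using assms(1) length_range unfolding rho'_def by simp
qed

text \<open>As \<open>Minv\<close> times \<open>M\<close> lies in \<open>\<mm>\<close>,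
  multiplication by \<open>minv\<close> preserves \<open>Minv\<close>; a larger endomorphism ring
  would give a chain of length two.\<close>

lemma End_inverse_M:
  assumes "rho' \<phi> = 1"
  shows "frac_End (Minv) = minv"
proof (rule length_1_eq_minv)
  show "minv \<subseteq> frac_End Minv"
  proof
    fix e assume e: "e \<in> minv"
    have "e * x * w \<in> range \<phi>" if xw: "x \<in> Minv" "w \<in> M_module \<phi>" for x w
    proof -
      obtain a where a: "a \<in> \<mm>" "x * w = \<phi> a" using inverse_M_mult[OF assms xw] by blast
      show ?thesis using e a by (simp add: frac_inverse_iff mult.assoc)
    qed
    then show "e \<in> frac_End Minv" by (simp add: frac_End_iff frac_inverse_iff)
  qed
qed (use assms in \<open>simp_all add: frac_End_sub frac_inverse_sub rho'_def\<close>)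

text \<open>If \<open>x0\<close> is not in the trace ideal \<open>J\<close>, duality modulo some
  \<open>y\<close> in \<open>J\<close> gives a \<open>b\<close> that multiplies \<open>J\<close>,
  but not \<open>x0\<close>, into \<open>ideal_gen {y}\<close>. The quotient of \<open>b\<close> by
  \<open>y\<close> then lies in \<open>frac_End Minv\<close>, which is \<open>minv\<close>, and yet
  does not map \<open>x0\<close> into \<open>A\<close>.\<close>

lemma m_in_inverse_M_mult:
  assumes rho: "rho' \<phi> = 1" and a: "x0 \<in> \<mm>"
  shows "\<phi> x0 \<in> am.span {x * w |x w. x \<in> Minv \<and> w \<in> M_module \<phi>}"
proof (rule ccontr)
  let ?S = "{x * w |x w. x \<in> Minv \<and> w \<in> M_module \<phi>}"
  assume n: "\<phi> x0 \<notin> am.span ?S"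
  define J where "J = {a. \<phi> a \<in> am.span ?S}"
  have J: "is_ideal J"
  proof (rule rm.subspaceI)
    show "c * a \<in> J" if "a \<in> J" for c a
      using am.span_scale[of "\<phi> a" ?S c] that by (simp add: J_def act_def)
  qed (simp_all add: J_def am.span_zero am.span_add)
  obtain D where D: "\<And>f. ord_ge D f \<Longrightarrow> f \<in> range \<psi>" using conductor by blast
  \<comment> \<open>\<open>M\<close> consists of power series, so \<open>p\<close> maps it into the
    conductor. The exponent is positive even for \<open>D = 0\<close>, so \<open>p\<close> is in
    \<open>\<mm>\<close> and is an eigenvector of \<open>t_deriv\<close> with nonzero eigenvalue,
    hence in \<open>M\<close>.\<close>
  have "(\<lambda>_. fps_X ^ Suc D) \<in> range \<psi>"
    by (rule D) (simp add: ord_ge_def fps_X_power_nth del: power_Suc)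
  then obtain p where p: "\<psi> p = (\<lambda>_. fps_X ^ Suc D)" by (metis rangeE)
  have pm: "p \<in> \<mm>" unfolding m_iff by (simp add: p)
  have pI: "\<phi> p \<in> Minv" unfolding frac_inverse_iff
  proof
    fix w assume w: "w \<in> M_module \<phi>"
    have "X_multiple 0 (w i)" for i by (rule M_X_multiple[OF w]) simp
    then have "\<forall>i. \<exists>g. w i = fps_to_fls g" unfolding X_multiple_def by auto
    then obtain g where g: "\<forall>i. w i = fps_to_fls (g i)" unfolding choice_iff by (elim exE)
    have "ord_ge (Suc D + 0) (\<psi> p * g)"
      by (rule ord_ge_mult) (simp_all add: p ord_ge_def fps_X_power_nth del: power_Suc)
    then obtain c where c: "\<psi> p * g = \<psi> c" using D ord_ge_mono[of "Suc D + 0" _ D] by fastforce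
    have "\<phi> p * w = \<phi> c"
    proof
      fix i
      have "(\<phi> p * w) i = fps_to_fls ((\<psi> p * g) i)" using g by (simp add: fls_times_fps_to_fls)
      then show "(\<phi> p * w) i = \<phi> c i" unfolding c by simp
    qed
    then show "\<phi> p * w \<in> range \<phi>" by blast
  qed
  define N :: 'k where "N = of_nat (Suc D)"
  have N0: "N \<noteq> 0" unfolding N_def by (simp del: of_nat_Suc)
  have "t_deriv (\<phi> p) = \<phi> (\<iota> N * p)"
  proof
    fix i
    have "fps_X * fps_deriv (\<psi> p i) = \<psi> (\<iota> N * p) i"
      by (rule fps_ext, simp only: X_deriv_nth, simp add: p fps_X_power_nth del: power_Suc) (simp add: N_def)
    then show "t_deriv (\<phi> p) i = \<phi> (\<iota> N * p) i" unfolding t_deriv_phi by (simp only: psi_phi)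
  qed
  then have "act \<phi> (\<iota> (1 / N)) (t_deriv (\<phi> p)) = \<phi> (\<iota> (1 / N * N) * p)"
    by (simp only: act_def phi(3) iota(4) mult.assoc)
  also have "\<dots> = \<phi> p" using N0 by simp
  finally have pM: "\<phi> p \<in> M_module \<phi>"
    using am.span_scale[OF M_module_gen[OF pm, unfolded M_module_def], of "\<iota> (1 / N)"]
    unfolding M_module_def by simp
  \<comment> \<open>One factor is taken in \<open>Minv\<close> and the other in \<open>M\<close>,
    which puts \<open>y\<close> into the trace ideal.\<close>
  define y where "y = p * p"
  have yJ: "y \<in> J" unfolding J_def y_def using pI pM by (auto intro!: am.span_base)
  have ym: "y \<in> \<mm>" unfolding y_def using pm ideal_mult[OF m_ideal] by blast
  have y0: "\<psi> y i \<noteq> 0" for i by (simp add: y_def p)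
  obtain l where l: "ideal_power \<mm> l \<subseteq> ideal_gen {y}" using parameter[OF y0] by blast
  obtain s where s: "s \<notin> ideal_gen {y}" "\<And>x. x \<in> \<mm> \<Longrightarrow> x * s \<in> ideal_gen {y}"
    using ex_socle[OF ym l] by blast
  have "x0 \<notin> J" using n by (simp add: J_def)
  then obtain b where b: "\<And>a. a \<in> J \<Longrightarrow> b * a \<in> ideal_gen {y}" "b * x0 \<notin> ideal_gen {y}"
    using annihilator_duality[OF ym l s J yJ] by blast
  obtain g where g: "\<phi> y * g = 1" using phi_unit y0 by blast
  define z where "z = \<phi> b * g"
  have "z \<in> frac_End Minv" unfolding frac_End_iff frac_inverse_iff[of "z * _"]
  proof (intro ballI)
    fix x w assume xw: "x \<in> Minv" "w \<in> M_module \<phi>"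
    obtain a where a: "x * w = \<phi> a" using inverse_M_mult[OF rho xw] by blast
    have "\<phi> a \<in> am.span ?S" unfolding a[symmetric] using xw by (auto intro!: am.span_base)
    then obtain c where c: "b * a = c * y" using b(1)[of a] by (auto simp: J_def ideal_gen_single)
    have "z * x * w = g * \<phi> (b * a)" by (simp add: z_def a[symmetric] ac_simps)
    also have "\<dots> = \<phi> c * (\<phi> y * g)" unfolding c by (simp add: ac_simps)
    also have "\<dots> = \<phi> c" using g by simp
    finally show "z * x * w \<in> range \<phi>" by blast
  qed
  then have "z * \<phi> x0 \<in> range \<phi>" using a unfolding End_inverse_M[OF rho] frac_inverse_iff by blast
  then obtain c where c: "z * \<phi> x0 = \<phi> c" by blast
  have "\<phi> (b * x0) = \<phi> b * \<phi> x0 * (\<phi> y * g)" using g by simp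
  also have "\<dots> = (z * \<phi> x0) * \<phi> y" by (simp add: z_def ac_simps)
  also have "\<dots> = \<phi> (c * y)" by (simp add: c)
  finally have "b * x0 = c * y" by (simp only: phi_eq_iff)
  then show False using b(2) by (simp add: ideal_gen_single)
qed

theorem quasihomogeneous_if_rho':
  assumes rho: "rho' \<phi> = 1"
  shows "quasihomogeneous \<iota>"
proof -
  have span: "\<phi> a \<in> am.span {x * w |x w. x \<in> Minv \<and> w \<in> M_module \<phi>}" if "a \<in> \<mm>" for a
    by (rule m_in_inverse_M_mult[OF rho that])
  have ord: "z \<in> Minv \<Longrightarrow> X_multiple 0 (z i)" "\<exists>z\<in>Minv. fls_nth (z i) 0 \<noteq> 0" for z i
    by (rule inverse_M_order[OF inverse_M_mult[OF rho] span]; assumption)+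
  \<comment> \<open>Prime avoidance over an infinite field: a general combination of two elements is
    nonzero at each branch where one of them is.\<close>
  have "\<exists>z\<in>Minv. \<forall>i\<in>K. fls_nth (z i) 0 \<noteq> 0" if "finite K" for K :: "'r set"
    using that
  proof (induction K rule: finite_induct)
    case empty
    then show ?case using am.subspace_0[OF frac_inverse_sub] by blast
  next
    case (insert i K)
    then obtain z where z: "z \<in> Minv" "\<And>j. j \<in> K \<Longrightarrow> fls_nth (z j) 0 \<noteq> 0" by blast
    obtain z' where z': "z' \<in> Minv" "fls_nth (z' i) 0 \<noteq> 0" using ord(2)[of i] by blast
    \<comment> \<open>Each branch forbids at most one scalar. Where \<open>z'\<close> vanishes the
      quotient is 0 by convention, and excluding 0 is harmless.\<close>
    let ?bad = "(\<lambda>j. - fls_nth (z j) 0 / fls_nth (z' j) 0) ` insert i K"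
    obtain c where c: "c \<notin> ?bad"
      using ex_new_if_finite[OF infinite_UNIV_char_0, of ?bad] insert.hyps by blast
    define v where "v = z + act \<phi> (\<iota> c) z'"
    have "v \<in> Minv" unfolding v_def
      by (intro am.subspace_add[OF frac_inverse_sub] am.subspace_scale[OF frac_inverse_sub] z z')
    moreover have "fls_nth (v j) 0 \<noteq> 0" if j: "j \<in> insert i K" for j
    proof
      assume "fls_nth (v j) 0 = 0"
      then have e: "fls_nth (z j) 0 + c * fls_nth (z' j) 0 = 0"
        by (simp add: v_def act_def phi_const)
      show False
      proof (cases "fls_nth (z' j) 0 = 0")
        case True
        then have "j \<in> K" using z'(2) j by blast
        then show False using z(2)[of j] e True by simp
      next
        case False
        then have "c = - fls_nth (z j) 0 / fls_nth (z' j) 0"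
          using e by (simp add: field_simps eq_neg_iff_add_eq_0)
        then show False using c j by blast
      qed
    qed
    ultimately show ?case by blast
  qed
  from this[OF finite] obtain z where z: "z \<in> Minv" "\<And>i. fls_nth (z i) 0 \<noteq> 0" by blast
  have "\<forall>i. \<exists>g. z i = fps_to_fls g" using ord(1)[OF z(1)] unfolding X_multiple_def by auto
  then obtain x where x: "\<forall>i. z i = fps_to_fls (x i)" unfolding choice_iff by (elim exE)
  show ?thesis
  proof (rule quasihomogeneous_if_derivation)
    show "x i $ 0 \<noteq> 0" for i using z(2)[of i] x by simp
    fix a
    \<comment> \<open>\<open>M\<close> is generated by derivatives of elements of
      \<open>\<mm>\<close>; subtracting the residue leaves the derivative of \<open>a\<close>
      unchanged.\<close>
    obtain e where e: "a - \<iota> e \<in> \<mm>" by (rule residue)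
    obtain b where b: "z * t_deriv (\<phi> (a - \<iota> e)) = \<phi> b"
      using z(1) M_module_gen[OF e] unfolding frac_inverse_iff by blast
    have "(\<lambda>i. x i * (fps_X * fps_deriv (\<psi> a i))) = \<psi> b"
    proof (rule ext, rule fps_to_fls_eq_imp_fps_eq)
      fix i
      have d: "fps_deriv (\<psi> (a - \<iota> e) i) = fps_deriv (\<psi> a i)" by simp
      have "fps_to_fls (x i * (fps_X * fps_deriv (\<psi> a i))) = (z * t_deriv (\<phi> (a - \<iota> e))) i"
        using x by (simp only: times_fun_def t_deriv_phi d fls_times_fps_to_fls)
      then show "fps_to_fls (x i * (fps_X * fps_deriv (\<psi> a i))) = fps_to_fls (\<psi> b i)"
        unfolding b by simp
    qed
    then show "(\<lambda>i. x i * (fps_X * fps_deriv (\<psi> a i))) \<in> range \<psi>" by blast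
  qed
qed

text \<open>By the conductor, \<open>\<delta>\<close> is determined by its values at large powers of the parameters, and these are
  proportional to those of \<open>t\<partial>\<^sub>t\<close> by the Leibniz rule. To avoid denominators, the factor is multiplied
  by \<open>t\<^sub>j\<^sup>e\<close>.\<close>
lemma derivation_multiple_of_t_deriv:
  assumes add: "\<And>a b. \<delta> (a + b) = \<delta> a + \<delta> b" and mult: "\<And>a b. \<delta> (a * b) = \<delta> a * b + a * \<delta> b"
    and const: "\<And>c. \<delta> (\<iota> c) = 0"
  shows "\<exists>u. \<forall>a. \<phi> (\<delta> a) = u * t_deriv (\<phi> a)"
proof -
  have "\<exists>u. \<forall>a. \<phi> (\<delta> a) j = u * t_deriv (\<phi> a) j" for j
  proof -
    obtain D where D: "\<And>f. ord_ge D f \<Longrightarrow> f \<in> range \<psi>" using conductor by blast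
    \<comment> \<open>Large enough for the conductor, and positive so that it is invertible in
      \<open>k\<close>.\<close>
    define e where "e = Suc D"
    define single :: "'k fps \<Rightarrow> 'r \<Rightarrow> 'k fps" where "single f i = (if i = j then f else 0)" for f i
    have ex: "\<exists>a. \<psi> a = single (fps_X ^ e * f)" for f
    proof -
      have "ord_ge D (single (fps_X ^ e * f))"
        by (simp add: ord_ge_def single_def fps_X_power_mult_nth e_def del: power_Suc)
      then obtain a where "single (fps_X ^ e * f) = \<psi> a" using D by blast
      then show ?thesis by metis
    qed
    then obtain el where el: "\<And>f. \<psi> (el f) = single (fps_X ^ e * f)" by metis
    \<comment> \<open>For \<open>n\<close> at least \<open>e\<close> this is the \<open>n\<close>-th
      power of the \<open>j\<close>-th parameter, and zero on the other branches; smaller powers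
      need not belong to \<open>A\<close>.\<close>
    define \<tau> where "\<tau> n = el (fps_X ^ (n - e))" for n
    have \<tau>: "\<psi> (\<tau> n) = single (fps_X ^ n)" if "n \<ge> e" for n
      unfolding \<tau>_def el using that by (simp flip: power_add)
    have \<tau>j: "\<psi> (\<tau> n) j = fps_X ^ n" if "n \<ge> e" for n using \<tau>[OF that] by (simp add: single_def)
    have \<tau>_add: "\<tau> (n + m) = \<tau> n * \<tau> m" if "n \<ge> e" "m \<ge> e" for n m
    proof -
      have "\<psi> (\<tau> (n + m)) = \<psi> (\<tau> n * \<tau> m)"
        using that by (simp add: \<tau> single_def fun_eq_iff power_add)
      then show ?thesis by (simp only: psi_inj)
    qed
    define l where "l n = \<psi> (\<delta> (\<tau> n)) j" for n
    have l_add: "l (n + m) = l n * fps_X ^ m + fps_X ^ n * l m" if "n \<ge> e" "m \<ge> e" for n m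
      unfolding l_def \<tau>_add[OF that] mult using \<tau>j[OF that(1)] \<tau>j[OF that(2)] by simp
    \<comment> \<open>The power rule for \<open>\<tau> n\<close>, multiplied by
      \<open>fps_X ^ n\<close> to avoid negative exponents.\<close>
    have l_mult: "l (Suc k * n) * fps_X ^ n = of_nat (Suc k) * l n * fps_X ^ (Suc k * n)" if n: "n \<ge> e" for n k
    proof (induction k)
      case (Suc k)
      have "Suc k * n \<ge> e" using n by (simp add: trans_le_add1)
      then have "l (n + Suc k * n) = l n * fps_X ^ (Suc k * n) + fps_X ^ n * l (Suc k * n)"
        by (rule l_add[OF n])
      then have "l (Suc (Suc k) * n) * fps_X ^ n
          = l n * fps_X ^ (Suc k * n) * fps_X ^ n + fps_X ^ n * (l (Suc k * n) * fps_X ^ n)"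
        by (simp add: algebra_simps)
      also have "\<dots> = of_nat (Suc (Suc k)) * l n * fps_X ^ (Suc (Suc k) * n)"
        unfolding Suc by (simp add: algebra_simps power_add)
      finally show ?case .
    qed (simp add: mult.commute)
    \<comment> \<open>Compares two evaluations of \<open>l (e * n)\<close>: by the
      \<open>e\<close>-th power of \<open>\<tau> n\<close> and by the \<open>n\<close>-th power of
      \<open>\<tau> e\<close>.\<close>
    have l_eq: "of_nat e * l n * fps_X ^ e = of_nat n * l e * fps_X ^ n" if n: "n \<ge> e" for n
    proof -
      obtain n' where n': "n = Suc n'" using n by (cases n) (auto simp: e_def)
      have A: "l (e * n) * fps_X ^ n = of_nat e * l n * fps_X ^ (e * n)"
        using l_mult[OF n, of D] by (simp only: e_def)
      have B: "l (e * n) * fps_X ^ e = of_nat n * l e * fps_X ^ (e * n)"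
        using l_mult[OF order.refl, of n'] unfolding n'[symmetric] by (simp only: mult.commute[of n e])
      have "(of_nat e * l n * fps_X ^ e) * fps_X ^ (e * n) = (l (e * n) * fps_X ^ n) * fps_X ^ e"
        unfolding A by (simp only: ac_simps)
      also have "\<dots> = (l (e * n) * fps_X ^ e) * fps_X ^ n" by (simp only: ac_simps)
      also have "\<dots> = (of_nat n * l e * fps_X ^ n) * fps_X ^ (e * n)"
        unfolding B by (simp only: ac_simps)
      finally show ?thesis by (simp only: mult_cancel_right) simp
    qed
    define ie :: "'k fps" where "ie = fps_const (1 / of_nat e)"
    have ie: "ie * of_nat e = 1"
      by (simp add: ie_def e_def fps_of_nat[symmetric] del: of_nat_Suc)
    define \<theta> :: "'k fps \<Rightarrow> 'k fps" where "\<theta> f = fps_X * fps_deriv f" for f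
    have \<theta>_mult: "\<theta> (f * g) = \<theta> f * g + f * \<theta> g" and \<theta>_add: "\<theta> (f + g) = \<theta> f + \<theta> g" for f g
      by (simp_all add: \<theta>_def algebra_simps)
    have \<theta>_X: "\<theta> (fps_X ^ n) = of_nat n * fps_X ^ n" for n
      unfolding \<theta>_def by (rule fps_ext) (simp only: X_deriv_nth, simp add: fps_X_power_nth flip: fps_of_nat)
    \<comment> \<open>The defect of the claimed proportionality, with the denominator cleared. It is
      again a derivation along branch \<open>j\<close>, and it kills constants and all
      \<open>\<tau> n\<close> with \<open>n \<ge> e\<close>.\<close>
    define E where "E a = fps_X ^ e * \<psi> (\<delta> a) j - ie * l e * \<theta> (\<psi> a j)" for a
    have E_mult: "E (a * b) = E a * \<psi> b j + \<psi> a j * E b" for a b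
      by (simp add: E_def mult \<theta>_mult algebra_simps)
    have E_add: "E (a + b) = E a + E b" for a b
      by (simp add: E_def add \<theta>_add algebra_simps)
    have E_const: "E (\<iota> c) = 0" for c by (simp add: E_def const \<theta>_def)
    have E_sum: "E (\<Sum>i\<in>I. f i) = (\<Sum>i\<in>I. E (f i))" for I :: "nat set" and f
      using E_const[of 0] by (induction I rule: infinite_finite_induct) (simp_all add: E_add)
    have E_\<tau>: "E (\<tau> n) = 0" if n: "n \<ge> e" for n
    proof -
      have "fps_X ^ e * l n = (ie * of_nat e) * (fps_X ^ e * l n)" unfolding ie by simp
      also have "\<dots> = ie * (of_nat e * l n * fps_X ^ e)" by (simp only: ac_simps)
      also have "\<dots> = ie * l e * (of_nat n * fps_X ^ n)" unfolding l_eq[OF n] by (simp only: ac_simps)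
      finally show ?thesis unfolding E_def \<tau>j[OF n] \<theta>_X l_def[symmetric] by simp
    qed
    \<comment> \<open>The factor \<open>\<tau> e\<close> isolates branch \<open>j\<close>. In the
      expansion of \<open>a * \<tau> e\<close> only the remainder survives \<open>E\<close>, so
      \<open>E a\<close> is divisible by \<open>fps_X ^ Suc k\<close> for every
      \<open>k\<close>.\<close>
    have E_zero: "E a = 0" for a
    proof (rule fps_ext)
      fix k
      define K where "K = e + Suc k"
      let ?f = "\<psi> a j"
      define \<rho> where "\<rho> = el (fps_shift K ?f)"
      have "a * \<tau> e = (\<Sum>n<K. \<iota> (?f $ n) * \<tau> (n + e)) + \<tau> K * \<rho>"
      proof -
        have "\<psi> (a * \<tau> e) = \<psi> ((\<Sum>n<K. \<iota> (?f $ n) * \<tau> (n + e)) + \<tau> K * \<rho>)"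
        proof
          fix i
          show "\<psi> (a * \<tau> e) i = \<psi> ((\<Sum>n<K. \<iota> (?f $ n) * \<tau> (n + e)) + \<tau> K * \<rho>) i"
          proof (cases "i = j")
            case True
            have f: "?f = fps_cutoff K ?f + fps_X ^ K * fps_shift K ?f"
              by (rule fps_ext) (simp add: fps_X_power_mult_nth)
            have "\<psi> (a * \<tau> e) i = fps_X ^ e * ?f"
              using True \<tau>j[of e] by (simp add: mult.commute)
            also have "\<dots> = fps_X ^ e * (fps_cutoff K ?f + fps_X ^ K * fps_shift K ?f)"
              by (subst f) (rule refl)
            also have "\<dots> = fps_X ^ e * (\<Sum>n<K. fps_const (?f $ n) * fps_X ^ n) + fps_X ^ K * (fps_X ^ e * fps_shift K ?f)"
              unfolding fps_cutoff_eq_sum by (simp only: distrib_left ac_simps)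
            also have "fps_X ^ e * (\<Sum>n<K. fps_const (?f $ n) * fps_X ^ n) = (\<Sum>n<K. fps_const (?f $ n) * fps_X ^ (n + e))"
              unfolding sum_distrib_left power_add by (simp only: ac_simps)
            also have "\<dots> + fps_X ^ K * (fps_X ^ e * fps_shift K ?f)
                = \<psi> ((\<Sum>n<K. \<iota> (?f $ n) * \<tau> (n + e)) + \<tau> K * \<rho>) i"
              using True \<tau>j[of K] by (simp add: psi_sum sum_fun_apply \<tau>j \<rho>_def el single_def K_def)
            finally show ?thesis .
          next
            case False
            then show ?thesis by (simp add: psi_sum sum_fun_apply \<tau> single_def K_def)
          qed
        qed
        then show ?thesis by (simp only: psi_inj)
      qed
      then have "E (a * \<tau> e) = fps_X ^ K * E \<rho>"
        using \<tau>j[of K] by (simp add: E_add E_sum E_mult E_const E_\<tau> K_def)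
      moreover have "E (a * \<tau> e) = fps_X ^ e * E a" using \<tau>j[of e] E_\<tau>[of e] by (simp add: E_mult mult.commute)
      ultimately have "fps_X ^ e * E a = fps_X ^ e * (fps_X ^ Suc k * E \<rho>)"
        by (simp only: K_def power_add mult.assoc)
      then have "E a = fps_X ^ Suc k * E \<rho>" by (simp only: mult_cancel_left) simp
      then show "E a $ k = 0 $ k" by (simp add: fps_X_power_mult_nth del: power_Suc)
    qed
    let ?X = "fls_X ^ e :: 'k fls"
    define u where "u = fps_to_fls (ie * l e) / ?X"
    have "\<phi> (\<delta> a) j = u * t_deriv (\<phi> a) j" for a
    proof -
      have "fps_X ^ e * \<psi> (\<delta> a) j = ie * l e * \<theta> (\<psi> a j)"
        using E_zero[of a] unfolding E_def by simp
      then have "fps_to_fls (fps_X ^ e * \<psi> (\<delta> a) j) = fps_to_fls (ie * l e * \<theta> (\<psi> a j))" by (rule arg_cong)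
      then have "?X * \<phi> (\<delta> a) j = fps_to_fls (ie * l e) * t_deriv (\<phi> a) j"
        by (simp only: fls_times_fps_to_fls fps_to_fls_power fps_X_to_fls psi_phi t_deriv_phi \<theta>_def)
      then have "\<phi> (\<delta> a) j * ?X = fps_to_fls (ie * l e) * t_deriv (\<phi> a) j"
        by (simp only: mult.commute[of ?X])
      moreover have "?X \<noteq> 0" by simp
      ultimately have "\<phi> (\<delta> a) j = fps_to_fls (ie * l e) * t_deriv (\<phi> a) j / ?X"
        using nonzero_eq_divide_eq by blast
      then show ?thesis unfolding u_def by (simp only: times_divide_eq_left)
    qed
    then show ?thesis by blast
  qed
  then have "\<forall>j. \<exists>u. \<forall>a. \<phi> (\<delta> a) j = u * t_deriv (\<phi> a) j" by blast
  then obtain u where "\<forall>j. \<forall>a. \<phi> (\<delta> a) j = u j * t_deriv (\<phi> a) j" unfolding choice_iff by (elim exE)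
  then have "\<forall>a. \<phi> (\<delta> a) = u * t_deriv (\<phi> a)" by (simp add: fun_eq_iff)
  then show ?thesis by blast
qed

lemma rho'_if_derivation:
  assumes ns: "\<not> smooth TYPE('a)"
    and add: "\<And>a b. \<delta> (a + b) = \<delta> a + \<delta> b" and mult: "\<And>a b. \<delta> (a * b) = \<delta> a * b + a * \<delta> b"
    and const: "\<And>c. \<delta> (\<iota> c) = 0" and im: "\<delta> ` \<mm> = \<mm>"
  shows "rho' \<phi> = 1"
proof -
  have "\<exists>u. \<forall>a. \<phi> (\<delta> a) = u * t_deriv (\<phi> a)"
    by (rule derivation_multiple_of_t_deriv) (fact add mult const)+
  then obtain u where u: "\<And>a. \<phi> (\<delta> a) = u * t_deriv (\<phi> a)" by blast
  \<comment> \<open>A nonzerodivisor in \<open>\<mm>\<close> is a value of \<open>\<delta>\<close>,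
    so \<open>u\<close> cannot vanish on any branch.\<close>
  have "u i \<noteq> 0" for i
  proof
    assume u0: "u i = 0"
    obtain y where y: "y \<in> \<mm>" "nonzerodivisor y" using ex_nonzerodivisor by blast
    then obtain g where "y = \<delta> g" using im by blast
    then have "\<phi> y i = 0" using u[of g] u0 by simp
    then show False using psi_nzd[OF y(2), of i] by (simp flip: psi_phi)
  qed
  then obtain v where v: "u * v = 1" using fls_fun_unit by blast
  show ?thesis
  proof (rule rho'_eq_1_if_iso[OF ns v])
    fix w assume "w \<in> M_module \<phi>"
    then show "u * w \<in> \<phi> ` \<mm>" unfolding M_module_def
    proof (induction rule: am.span_induct_alt)
      case base
      have "0 \<in> \<mm>" by (rule rm.subspace_0[OF m_ideal])
      then show ?case by (intro image_eqI[of _ _ 0]) simp_all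
    next
      case (step c x y)
      then obtain a b where a: "a \<in> \<mm>" "x = t_deriv (\<phi> a)" and b: "b \<in> \<mm>" "u * y = \<phi> b" by blast
      have "u * (act \<phi> c x + y) = \<phi> (c * \<delta> a + b)"
        by (simp add: act_def a(2) u b(2)[symmetric] algebra_simps)
      moreover have "c * \<delta> a + b \<in> \<mm>"
        using im a(1) b(1) by (intro rm.subspace_add[OF m_ideal] ideal_mult[OF m_ideal]) auto
      ultimately show ?case by blast
    qed
  next
    fix a assume "a \<in> \<mm>"
    then obtain b where "b \<in> \<mm>" "a = \<delta> b" using im by blast
    then show "\<exists>w\<in>M_module \<phi>. \<phi> a = u * w" using u M_module_gen by blast
  qed
qed

end

subsection \<open>The Euler derivation\<close>

text \<open>The derivation \<open>\<Sum> w_i x_i d/dx_i\<close>, written on coefficients.\<close>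

definition euler :: "(nat \<Rightarrow> nat) \<Rightarrow> 'k::comm_ring_1 mfps \<Rightarrow> 'k mfps" where
  "euler w f = Abs_mfps (\<lambda>m. of_nat (weighted_degree w m) * mcoeff f m)"

lemma mcoeff_euler: "mcoeff (euler w f) m = of_nat (weighted_degree w m) * mcoeff f m"
  by (simp add: euler_def Abs_mfps_inverse)

lemma euler_add: "euler w (f + g) = euler w f + euler w g"
  by (rule mfps_eqI) (simp add: mcoeff_euler distrib_left)

lemma euler_diff: "euler w (f - g) = euler w f - euler w g"
  by (rule mfps_eqI) (simp add: mcoeff_euler right_diff_distrib)

lemma euler_sum: "euler w (\<Sum>i\<in>I. f i) = (\<Sum>i\<in>I. euler w (f i))"
  by (rule mfps_eqI) (simp add: mcoeff_euler mcoeff_sum sum_distrib_left)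

lemma euler_mult: "euler w (f * g) = euler w f * g + f * euler w g"
proof (rule mfps_eqI)
  fix m
  show "mcoeff (euler w (f * g)) m = mcoeff (euler w f * g + f * euler w g) m"
    unfolding mcoeff_simps mcoeff_euler mcoeff_mult sum_distrib_left sum.distrib[symmetric]
    by (rule sum.cong) (auto simp: algebra_simps)
qed

lemma euler_const: "euler w (mfps_const c) = 0"
  by (rule mfps_eqI) (simp add: mcoeff_euler mfps_const.rep_eq)

lemma euler_ring: "f \<in> mfps_ring N \<Longrightarrow> euler w f \<in> mfps_ring N"
  by (simp add: mfps_ring_iff mcoeff_euler)

lemma euler_homogeneous:
  "(\<And>m. mcoeff s m \<noteq> 0 \<Longrightarrow> weighted_degree w m = d) \<Longrightarrow> euler w s = mfps_const (of_nat d) * s"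
proof (rule mfps_eqI)
  fix m
  assume "\<And>m. mcoeff s m \<noteq> 0 \<Longrightarrow> weighted_degree w m = d"
  from this[of m] show "mcoeff (euler w s) m = mcoeff (mfps_const (of_nat d) * s) m"
    by (cases "mcoeff s m = 0") (simp_all add: mcoeff_euler)
qed

lemma mcoeff_mult_0: "mcoeff (f * g) 0 = mcoeff f 0 * mcoeff g 0"
proof -
  have z: "a = 0 \<and> b = 0" if "a + b = 0" for a b :: "nat \<Rightarrow>\<^sub>0 nat"
  proof -
    have "keys a \<union> keys b = {}" using keys_plus_nat[of a b] that by simp
    then show ?thesis by simp
  qed
  have "{(a, b). a + b = (0 :: nat \<Rightarrow>\<^sub>0 nat)} = {(0, 0)}"
  proof (intro equalityI subsetI)
    fix p assume "p \<in> {(a, b). a + b = (0 :: nat \<Rightarrow>\<^sub>0 nat)}"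
    then obtain a b where "p = (a, b)" "a + b = 0" by (elim CollectE case_prodE)
    then show "p \<in> {(0, 0)}" using z[of a b] by simp
  qed simp
  then show ?thesis by (simp add: mcoeff_mult)
qed

lemma weighted_degree_pos:
  assumes "\<And>i. i < N \<Longrightarrow> w i > 0" "keys m \<subseteq> {..<N}" "m \<noteq> 0"
  shows "weighted_degree w m > 0"
proof -
  have "keys m \<noteq> {}" using assms(3) by simp
  then obtain i where i: "i \<in> keys m" by blast
  then have "i < N" using assms(2) by auto
  then have "0 < w i * lookup m i" using assms(1)[of i] i by (simp add: in_keys_iff)
  also have "\<dots> \<le> weighted_degree w m" unfolding weighted_degree_def
    by (rule member_le_sum) (use i in auto)
  finally show ?thesis .
qed

context normalized_curve
begin

text \<open>The homogeneous generators of the kernel are eigenvectors of the Euler derivation, so it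
  preserves the kernel and descends to \<open>A\<close>. Positive weights make it surjective on
  series without constant term.\<close>

theorem rho'_if_quasihomogeneous:
  assumes ns: "\<not> smooth TYPE('a)" and qh: "quasihomogeneous \<iota>"
  shows "rho' \<phi> = 1"
proof -
  obtain N \<pi> w where epi: "algebra_epimorphism \<iota> N \<pi>" and w: "\<forall>i<N. w i > 0"
    and ker: "quasihomogeneous_ideal N w {f \<in> mfps_ring N. \<pi> f = 0}"
    using qh unfolding quasihomogeneous_def by (elim exE conjE)
  let ?R = "mfps_ring N :: 'k mfps set"
  obtain S where S: "S \<subseteq> ?R" "\<forall>s\<in>S. weighted_homogeneous_polynomial w s"
    and gen: "{f \<in> ?R. \<pi> f = 0} = mfps_ideal_gen N S"
    using ker unfolding quasihomogeneous_ideal_def by (elim exE conjE)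
  have \<pi>_const: "\<pi> (mfps_const c) = \<iota> c" for c
    using epi unfolding algebra_epimorphism_def by blast
  have \<pi>_add: "\<pi> (f + g) = \<pi> f + \<pi> g" and \<pi>_mult: "\<pi> (f * g) = \<pi> f * \<pi> g"
    if "f \<in> ?R" "g \<in> ?R" for f g
    using epi that unfolding algebra_epimorphism_def by blast+
  have \<pi>_surj: "\<exists>f\<in>?R. a = \<pi> f" for a
    using epi unfolding algebra_epimorphism_def by blast
  have \<pi>_0: "\<pi> 0 = 0" using \<pi>_add[of 0 0] by simp
  have \<pi>_diff: "\<pi> (f - g) = \<pi> f - \<pi> g" if fg: "f \<in> ?R" "g \<in> ?R" for f g
    using \<pi>_add[of "f - g" g] fg by simp
  have \<pi>_sum: "\<pi> (\<Sum>i\<in>I. f i) = (\<Sum>i\<in>I. \<pi> (f i))" if "\<And>i. i \<in> I \<Longrightarrow> f i \<in> ?R" for I :: "'k mfps set" and f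
    using that by (induction I rule: infinite_finite_induct) (simp_all add: \<pi>_0 \<pi>_add)
  have S_hom: "\<exists>d. \<forall>m. mcoeff s m \<noteq> 0 \<longrightarrow> weighted_degree w m = d" if "s \<in> S" for s
    using S(2) that unfolding weighted_homogeneous_polynomial_def by blast
  have S_ker: "\<pi> s = 0" if "s \<in> S" for s
  proof -
    have "s \<in> mfps_ideal_gen N S" unfolding mfps_ideal_gen_def
      using that by (intro CollectI exI[of _ "{s}"] exI[of _ "\<lambda>_. 1"]) simp
    then show ?thesis unfolding gen[symmetric] by blast
  qed
  have ker_rep: "\<exists>F c. finite F \<and> F \<subseteq> S \<and> (\<forall>s\<in>F. c s \<in> ?R) \<and> f = (\<Sum>s\<in>F. c s * s)"
    if "f \<in> ?R" "\<pi> f = 0" for f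
  proof -
    have "f \<in> mfps_ideal_gen N S" using that unfolding gen[symmetric] by blast
    then show ?thesis unfolding mfps_ideal_gen_def by blast
  qed
  have ker_euler: "\<pi> (euler w f) = 0" if f: "f \<in> ?R" "\<pi> f = 0" for f
  proof -
    obtain F c where F: "finite F" "F \<subseteq> S" "\<forall>s\<in>F. c s \<in> ?R" "f = (\<Sum>s\<in>F. c s * s)"
      using ker_rep[OF f] by blast
    have z: "\<pi> (euler w (c s * s)) = 0" "euler w (c s * s) \<in> ?R" if s: "s \<in> F" for s
    proof -
      have sR: "s \<in> ?R" "c s \<in> ?R" "s \<in> S" using s F S(1) by auto
      obtain d where d: "\<And>m. mcoeff s m \<noteq> 0 \<Longrightarrow> weighted_degree w m = d" using S_hom[OF sR(3)] by blast
      have h: "euler w s = mfps_const (of_nat d) * s" by (rule euler_homogeneous) (rule d)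
      have e: "euler w (c s * s) = (euler w (c s) + c s * mfps_const (of_nat d)) * s"
        unfolding euler_mult h by (simp add: distrib_right mult.assoc)
      have r: "euler w (c s) + c s * mfps_const (of_nat d) \<in> ?R" using sR by (simp add: euler_ring)
      show "\<pi> (euler w (c s * s)) = 0" unfolding e \<pi>_mult[OF r sR(1)] S_ker[OF sR(3)] by simp
      show "euler w (c s * s) \<in> ?R" unfolding e using r sR(1) by simp
    qed
    have "\<pi> (euler w f) = (\<Sum>s\<in>F. \<pi> (euler w (c s * s)))"
      unfolding F(4) euler_sum by (rule \<pi>_sum) (rule z(2))
    also have "\<dots> = 0" using z(1) by simp
    finally show ?thesis .
  qed
  have "\<forall>a. \<exists>f. f \<in> ?R \<and> a = \<pi> f" using \<pi>_surj by blast
  then obtain pre where pre: "\<forall>a. pre a \<in> ?R \<and> a = \<pi> (pre a)" unfolding choice_iff by (elim exE)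
  define \<delta> where "\<delta> a = \<pi> (euler w (pre a))" for a
  have \<delta>: "\<delta> (\<pi> f) = \<pi> (euler w f)" if f: "f \<in> ?R" for f
  proof -
    have p: "pre (\<pi> f) \<in> ?R" "\<pi> (pre (\<pi> f)) = \<pi> f" using pre by metis+
    have "\<pi> (euler w (f - pre (\<pi> f))) = 0"
      by (rule ker_euler) (use f p \<pi>_diff in simp_all)
    then show ?thesis
      unfolding \<delta>_def euler_diff using \<pi>_diff[OF euler_ring[OF f] euler_ring[OF p(1)]] by simp
  qed
  have \<delta>_add: "\<delta> (a + b) = \<delta> a + \<delta> b" for a b
  proof -
    obtain f g where fg: "f \<in> ?R" "g \<in> ?R" "a = \<pi> f" "b = \<pi> g" using \<pi>_surj by metis
    have "\<delta> (a + b) = \<pi> (euler w (f + g))" using \<delta>[of "f + g"] \<pi>_add fg by simp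
    also have "\<dots> = \<delta> a + \<delta> b"
      unfolding euler_add fg(3,4) \<delta>[OF fg(1)] \<delta>[OF fg(2)]
      by (rule \<pi>_add[OF euler_ring[OF fg(1)] euler_ring[OF fg(2)]])
    finally show ?thesis .
  qed
  have \<delta>_mult: "\<delta> (a * b) = \<delta> a * b + a * \<delta> b" for a b
  proof -
    obtain f g where fg: "f \<in> ?R" "g \<in> ?R" "a = \<pi> f" "b = \<pi> g" using \<pi>_surj by metis
    have e: "euler w f \<in> ?R" "euler w g \<in> ?R"
      by (rule euler_ring[OF fg(1)], rule euler_ring[OF fg(2)])
    have "\<delta> (a * b) = \<pi> (euler w (f * g))" using \<delta>[of "f * g"] \<pi>_mult fg by simp
    also have "\<dots> = \<delta> a * b + a * \<delta> b"
      unfolding euler_mult fg(3,4) \<delta>[OF fg(1)] \<delta>[OF fg(2)] using fg e by (simp add: \<pi>_add \<pi>_mult)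
    finally show ?thesis .
  qed
  have \<delta>_const: "\<delta> (\<iota> c) = 0" for c
    using \<delta>[of "mfps_const c"] \<pi>_0 by (simp add: \<pi>_const euler_const)
  define m0 where "m0 = \<pi> ` {f \<in> ?R. mcoeff f 0 = 0}"
  have m0: "is_ideal m0"
  proof (rule rm.subspaceI)
    show "0 \<in> m0" unfolding m0_def using \<pi>_0 by (intro image_eqI[of _ _ 0]) simp_all
    show "a + b \<in> m0" if ab: "a \<in> m0" "b \<in> m0" for a b
    proof -
      obtain f g where fg: "f \<in> ?R" "mcoeff f 0 = 0" "a = \<pi> f" "g \<in> ?R" "mcoeff g 0 = 0" "b = \<pi> g"
        using ab unfolding m0_def by blast
      then show ?thesis unfolding m0_def by (intro image_eqI[of _ _ "f + g"]) (simp_all add: \<pi>_add)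
    qed
    show "c * a \<in> m0" if a: "a \<in> m0" for c a
    proof -
      obtain f where f: "f \<in> ?R" "mcoeff f 0 = 0" "a = \<pi> f" using a unfolding m0_def by blast
      obtain g where g: "g \<in> ?R" "c = \<pi> g" using \<pi>_surj by blast
      show ?thesis unfolding m0_def
        by (rule image_eqI[of _ _ "g * f"]) (use f g in \<open>simp_all add: \<pi>_mult mcoeff_mult_0\<close>)
    qed
  qed
  have "1 \<notin> m0"
  proof
    assume "1 \<in> m0"
    then obtain f where f: "f \<in> ?R" "mcoeff f 0 = 0" "\<pi> f = 1" unfolding m0_def by auto
    have "mfps_const 1 = (1 :: 'k mfps)"
      by (rule mfps_eqI) (simp add: mfps_const.rep_eq one_mfps.rep_eq)
    then have "\<pi> 1 = 1" using \<pi>_const[of 1] by simp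
    then have "\<pi> (1 - f) = 0" using \<pi>_diff[of 1 f] f by simp
    then obtain F c where F: "finite F" "F \<subseteq> S" "\<forall>s\<in>F. c s \<in> ?R" "1 - f = (\<Sum>s\<in>F. c s * s)"
      using ker_rep[of "1 - f"] f(1) by auto
    have "mcoeff (1 - f) 0 = 1" using f(2) by (simp add: one_mfps.rep_eq)
    then have one: "(\<Sum>s\<in>F. mcoeff (c s) 0 * mcoeff s 0) = 1"
      unfolding F(4) mcoeff_sum mcoeff_mult_0 .
    \<comment> \<open>A homogeneous generator with nonzero constant term has weighted degree 0, and
      positive weights make it a constant. Its image would be a unit and zero at once.\<close>
    have "\<exists>s\<in>F. mcoeff s 0 \<noteq> 0"
    proof (rule ccontr)
      assume "\<not> ?thesis"
      then have "(\<Sum>s\<in>F. mcoeff (c s) 0 * mcoeff s 0) = 0" by (intro sum.neutral) simp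
      then show False using one by simp
    qed
    then obtain s where s: "s \<in> F" "mcoeff s 0 \<noteq> 0" by blast
    then have sS: "s \<in> S" using F(2) by blast
    obtain d where d: "\<And>m. mcoeff s m \<noteq> 0 \<Longrightarrow> weighted_degree w m = d" using S_hom[OF sS] by blast
    have "d = 0" using d[OF s(2)] by simp
    have sR: "s \<in> ?R" using sS S(1) by blast
    have "s = mfps_const (mcoeff s 0)"
    proof (rule mfps_eqI)
      fix m
      show "mcoeff s m = mcoeff (mfps_const (mcoeff s 0)) m"
      proof (cases "m = 0 \<or> mcoeff s m = 0")
        case True
        then show ?thesis by (auto simp: mfps_const.rep_eq)
      next
        case False
        then have "keys m \<subseteq> {..<N}" using sR unfolding mfps_ring_def by blast
        then have "weighted_degree w m > 0" using False w by (intro weighted_degree_pos[of N]) auto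
        then show ?thesis using d[of m] False \<open>d = 0\<close> by simp
      qed
    qed
    then have "\<iota> (mcoeff s 0) = 0" using \<pi>_const S_ker[OF sS] by metis
    then show False using iota_notin_m[OF s(2)] rm.subspace_0[OF m_ideal] by simp
  qed
  then have "m0 \<subseteq> \<mm>" using proper_ideal_subset[OF m0] by blast
  moreover have "\<mm> \<subseteq> m0"
  proof
    fix a assume a: "a \<in> \<mm>"
    obtain f where f: "f \<in> ?R" "a = \<pi> f" using \<pi>_surj by blast
    let ?c = "mcoeff f 0"
    have "a - \<iota> ?c \<in> m0" unfolding m0_def
      by (rule image_eqI[of _ _ "f - mfps_const ?c"]) (use f in \<open>simp_all add: \<pi>_diff \<pi>_const mfps_const.rep_eq\<close>)
    then have "a - \<iota> ?c \<in> \<mm>" using \<open>m0 \<subseteq> \<mm>\<close> by blast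
    then have "a - (a - \<iota> ?c) \<in> \<mm>" by (rule rm.subspace_diff[OF m_ideal a])
    then have "\<iota> ?c \<in> \<mm>" by simp
    then have "?c = 0" using iota_notin_m by blast
    then show "a \<in> m0" using \<open>a - \<iota> ?c \<in> m0\<close> by simp
  qed
  ultimately have m: "\<mm> = m0" by blast
  have "\<delta> ` \<mm> = \<mm>"
  proof (intro equalityI subsetI)
    fix b assume "b \<in> \<delta> ` \<mm>"
    then obtain f where f: "f \<in> ?R" "mcoeff f 0 = 0" "b = \<delta> (\<pi> f)" unfolding m m0_def by blast
    show "b \<in> \<mm>" unfolding m m0_def f(3) \<delta>[OF f(1)]
      using f by (intro image_eqI[of _ _ "euler w f"]) (simp_all add: euler_ring mcoeff_euler)
  next
    fix b assume "b \<in> \<mm>"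
    then obtain f where f: "f \<in> ?R" "mcoeff f 0 = 0" "b = \<pi> f" unfolding m m0_def by blast
    \<comment> \<open>A preimage under the Euler derivation. At the monomial 1 the quotient by 0 is
      0, in agreement with the missing constant term of \<open>f\<close>.\<close>
    define g where "g = Abs_mfps (\<lambda>m. mcoeff f m / of_nat (weighted_degree w m))"
    have g: "mcoeff g m = mcoeff f m / of_nat (weighted_degree w m)" for m
      by (simp add: g_def Abs_mfps_inverse)
    have gR: "g \<in> ?R" using f(1) by (simp add: mfps_ring_iff g)
    have "euler w g = f"
    proof (rule mfps_eqI)
      fix m
      show "mcoeff (euler w g) m = mcoeff f m"
      proof (cases "m = 0 \<or> mcoeff f m = 0")
        case True
        then show ?thesis using f(2) by (auto simp: mcoeff_euler g)
      next
        case False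
        then have "keys m \<subseteq> {..<N}" using f(1) unfolding mfps_ring_def by blast
        then have "weighted_degree w m > 0" using False w by (intro weighted_degree_pos[of N]) auto
        then show ?thesis by (simp add: mcoeff_euler g)
      qed
    qed
    then have "b = \<delta> (\<pi> g)" using \<delta>[OF gR] f(3) by simp
    moreover have "\<pi> g \<in> \<mm>" unfolding m m0_def
      using gR f(2) by (intro image_eqI[of _ _ g]) (simp_all add: g)
    ultimately show "b \<in> \<delta> ` \<mm>" by blast
  qed
  then show ?thesis by (intro rho'_if_derivation[OF ns, of \<delta>] \<delta>_add \<delta>_mult \<delta>_const)
qed

end

theorem theorem3p5:
  fixes \<iota> :: "'k::{alg_closed_field, field_char_0} \<Rightarrow> 'a::comm_ring_1"
    and \<phi> :: "'a \<Rightarrow> 'r::finite \<Rightarrow> 'k fls"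
  assumes "reduced_algebroid_curve \<iota>"
    and "\<not> smooth TYPE('a)"
    and "gorenstein TYPE('a)"
    and "normalization \<iota> \<phi>"
  shows "quasihomogeneous \<iota> \<longleftrightarrow> rho' \<phi> = 1"
proof -
  interpret normalized_curve \<iota> \<phi>
    by unfold_locales (fact assms)+
  show ?thesis
    using rho'_if_quasihomogeneous[OF assms(2)] quasihomogeneous_if_rho' by blast
qed

end
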